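(* Let $G$ be a finite abelian group, let $\mathbf{k}$ be a field with $\operatorname{char}\mathbf{k}\nmid|G|$, and let $V$ be a nontrivial finite-dimensional representation of $G$ over $\mathbf{k}$. Then $\gamma^{\mathbf{r}}_{\mathrm{field}}(G,V)=2$ if and only if all the nontrivial characters in $V$ are involutions; otherwise, $\gamma^{\mathbf{r}}_{\mathrm{field}}(G,V)\geq 3$. In particular, if $m$ is the number of distinct nontrivial characters in $V$ and $\tau$ is the number of involutions in $G$, then the condition $m>\tau$ implies $\gamma^{\mathbf{r}}_{\mathrm{field}}(G,V)\geq 3$.
   Context: "$V$ nontrivial" means that $G$ acts nontrivially on $V$, i.e., at least one nontrivial character occurs in $V$. Let $\overline{\mathbf{k}}$ be an algebraic closure of $\mathbf{k}$. Since $G$ is abelian and $\operatorname{char}\mathbf{k}\nmid|G|$, $\overline{\mathbf{k}}\otimes_{\mathbf{k}}V$ is a direct sum of one-dimensional representations given by characters $G\to\overline{\mathbf{k}}^\times$; these are the characters in $V$. An involution is an element of order exactly $2$ (of $G$, or of the character group $\operatorname{Hom}(G,\overline{\mathbf{k}}^\times)$ in the case of characters). $\mathbf{k}[V]$ is the polynomial ring of $V$ (the symmetric algebra of $V^*$, with its induced $G$-action), $\mathbf{k}(V)$ is its fraction field, and $\mathbf{k}(V)^G$ is the field of invariant rational functions. For $f\in\mathbf{k}(V)$ written as $f=f_1/f_2$ with $f_1,f_2\in\mathbf{k}[V]$ and $\gcd(f_1,f_2)=1$, the degree of $f$ is $\deg f:=\deg f_1+\deg f_2$ (constants, including $0$,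 have degree $0$). $\mathbf{k}(V)^G_{\leq d}$ is the set of invariant rational functions of degree $\leq d$. Define $$\gamma^{\mathbf{r}}_{\mathrm{field}}(G,V):=\min\{d:\mathbf{k}(V)^G_{\leq d}\text{ contains a transcendence basis for }\mathbf{k}(V)^G\text{ over }\mathbf{k}\},$$ the minimum being over positive integers $d$. *)

theory Defs
  imports
    "HOL-Algebra.Algebra"
    "HOL-Algebra.Algebraic_Closure_Type"
    "HOL-Library.Poly_Mapping"
    "HOL-Computational_Algebra.Fraction_Field"
    "Jordan_Normal_Form.Matrix"
begin

section \<open>Polynomials and rational functions in finitely many variables\<close>

text \<open>
  The variables are indexed by all of \<^typ>\<open>nat\<close>; only finitely many of them are ever used,
  see \<open>poly_ring\<close> and \<open>ratfuns\<close> below.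
\<close>

type_synonym 'k mpol = "(nat \<Rightarrow>\<^sub>0 nat) \<Rightarrow>\<^sub>0 'k"

definition mconst :: "'k::zero \<Rightarrow> 'k mpol" where
  "mconst c = Poly_Mapping.single 0 c"

definition mvar :: "nat \<Rightarrow> ('k::zero_neq_one) mpol" where
  "mvar i = Poly_Mapping.single (Poly_Mapping.single i 1) 1"

text \<open>Evaluation at \<open>x\<close> after mapping the coefficients by \<open>c\<close>; the index type of the variables
  is arbitrary.\<close>

definition mpoly_eval ::
    "('k::zero \<Rightarrow> 'a::comm_semiring_1) \<Rightarrow> ('i \<Rightarrow> 'a) \<Rightarrow> (('i \<Rightarrow>\<^sub>0 nat) \<Rightarrow>\<^sub>0 'k) \<Rightarrow> 'a" where
  "mpoly_eval c x p =
     (\<Sum>m\<in>Poly_Mapping.keys p.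
        c (Poly_Mapping.lookup p m) * (\<Prod>i\<in>Poly_Mapping.keys m. x i ^ Poly_Mapping.lookup m i))"

definition mpoly_vars :: "(('i \<Rightarrow>\<^sub>0 nat) \<Rightarrow>\<^sub>0 'k::zero) \<Rightarrow> 'i set" where
  "mpoly_vars p = (\<Union>m\<in>Poly_Mapping.keys p. Poly_Mapping.keys m)"

definition total_degree :: "('k::zero) mpol \<Rightarrow> nat" where
  "total_degree p =
     Max (insert 0 ((\<lambda>m. \<Sum>i\<in>Poly_Mapping.keys m. Poly_Mapping.lookup m i) ` Poly_Mapping.keys p))"

definition poly_ring :: "nat \<Rightarrow> ('k::zero) mpol set" where
  "poly_ring n = {p. mpoly_vars p \<subseteq> {..<n}}"

definition ratfuns :: "nat \<Rightarrow> ('k::field) mpol fract set" where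
  "ratfuns n = {Fract p q | p q. p \<in> poly_ring n \<and> q \<in> poly_ring n \<and> q \<noteq> 0}"

definition ratfun_const :: "'k::field \<Rightarrow> 'k mpol fract" where
  "ratfun_const c = Fract (mconst c) 1"

text \<open>The library constant \<^const>\<open>coprime\<close> needs a class of which polynomials in several variables
  are not an instance. A divisor of a nonzero element of \<open>poly_ring n\<close> lies in \<open>poly_ring n\<close>, so it does
  not matter that \<open>h\<close> is not restricted to \<open>poly_ring n\<close>.\<close>

definition mpoly_coprime :: "('k::field) mpol \<Rightarrow> 'k mpol \<Rightarrow> bool" where
  "mpoly_coprime p q \<longleftrightarrow> (\<forall>h. h dvd p \<and> h dvd q \<longrightarrow> h dvd 1)"

text \<open>All coprime representations of \<open>f\<close> have the same degree sum, because they differ only by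
  a constant factor; the \<open>LEAST\<close> merely names this common value.\<close>

definition ratfun_degree :: "nat \<Rightarrow> ('k::field) mpol fract \<Rightarrow> nat" where
  "ratfun_degree n f =
     (LEAST d. \<exists>p\<in>poly_ring n. \<exists>q\<in>poly_ring n. q \<noteq> 0 \<and> mpoly_coprime p q \<and>
        f = Fract p q \<and> d = total_degree p + total_degree q)"


section \<open>Transcendence bases\<close>

text \<open>The ground field is embedded in the ambient field by \<open>c\<close>. The relation polynomials have their
  variables indexed by the elements of \<open>B\<close> themselves.\<close>

definition alg_independent :: "('k::field \<Rightarrow> 'f::field) \<Rightarrow> 'f set \<Rightarrow> bool" where
  "alg_independent c B \<longleftrightarrow>
     (\<forall>p :: ('f \<Rightarrow>\<^sub>0 nat) \<Rightarrow>\<^sub>0 'k. mpoly_vars p \<subseteq> B \<and> mpoly_eval c (\<lambda>b. b) p = 0 \<longrightarrow> p = 0)"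

definition transcendence_basis :: "('k::field \<Rightarrow> 'f::field) \<Rightarrow> 'f set \<Rightarrow> 'f set \<Rightarrow> bool" where
  "transcendence_basis c L B \<longleftrightarrow>
     B \<subseteq> L \<and> alg_independent c B \<and>
     (\<forall>f\<in>L. ring.algebraic ring_of_type_algebra
              (generate_field ring_of_type_algebra (range c \<union> B)) f)"


section \<open>Representations\<close>

definition is_representation ::
    "('g, 'm) monoid_scheme \<Rightarrow> ('k::field \<Rightarrow> 'v::ab_group_add \<Rightarrow> 'v) \<Rightarrow> ('g \<Rightarrow> 'v \<Rightarrow> 'v) \<Rightarrow> bool" where
  "is_representation G scale \<rho> \<longleftrightarrow>
     group_action G UNIV \<rho> \<and> (\<forall>g\<in>carrier G. Vector_Spaces.linear scale scale (\<rho> g))"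

definition acts_nontrivially :: "('g, 'm) monoid_scheme \<Rightarrow> ('g \<Rightarrow> 'v \<Rightarrow> 'v) \<Rightarrow> bool" where
  "acts_nontrivially G \<rho> \<longleftrightarrow> (\<exists>g\<in>carrier G. \<exists>v. \<rho> g v \<noteq> v)"

text \<open>An ordered basis of a finite-dimensional vector space whose carrier is the whole type.\<close>

definition ordered_basis :: "('k::field \<Rightarrow> 'v::ab_group_add \<Rightarrow> 'v) \<Rightarrow> 'v list \<Rightarrow> bool" where
  "ordered_basis scale bs \<longleftrightarrow> finite_dimensional_vector_space scale (set bs) \<and> distinct bs"

text \<open>Column \<open>j\<close> holds the coordinates of \<open>\<phi> (bs ! j)\<close>.\<close>

definition coord_mat :: "('k::field \<Rightarrow> 'v::ab_group_add \<Rightarrow> 'v) \<Rightarrow> 'v list \<Rightarrow> ('v \<Rightarrow> 'v) \<Rightarrow> 'k mat" where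
  "coord_mat scale bs \<phi> =
     mat (length bs) (length bs)
       (\<lambda>(i, j). module.representation scale (set bs) (\<phi> (bs ! j)) (bs ! i))"


section \<open>Characters\<close>

text \<open>Homomorphisms from \<open>G\<close> to the multiplicative group of the algebraic closure, made
  extensional so that distinct characters are distinct functions.\<close>

definition char_group :: "('g, 'm) monoid_scheme \<Rightarrow> ('g \<Rightarrow> ('k::field) alg_closure) monoid" where
  "char_group G =
     \<lparr>carrier = hom G (mult_of (ring_of_type_algebra :: 'k alg_closure ring)) \<inter> extensional (carrier G),
      monoid.mult = (\<lambda>\<chi> \<psi>. \<lambda>g\<in>carrier G. \<chi> g * \<psi> g),
      one = (\<lambda>g\<in>carrier G. 1)\<rparr>"

definition involutions :: "('a, 'm) monoid_scheme \<Rightarrow> 'a set" where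
  "involutions H = {x \<in> carrier H. group.ord H x = 2}"

text \<open>The basis \<open>bs\<close> identifies the extension of scalars of the representation to the algebraic
  closure with column vectors. A decomposition into one-dimensional representations is given by an
  invertible matrix \<open>P\<close> whose \<open>i\<close>-th column spans the summand on which \<open>G\<close> acts through
  \<open>\<chi>s ! i\<close>.\<close>

definition char_decomposition ::
    "('g, 'm) monoid_scheme \<Rightarrow> ('k::field \<Rightarrow> 'v::ab_group_add \<Rightarrow> 'v) \<Rightarrow> 'v list \<Rightarrow> ('g \<Rightarrow> 'v \<Rightarrow> 'v) \<Rightarrow>
     'k alg_closure mat \<Rightarrow> ('g \<Rightarrow> 'k alg_closure) list \<Rightarrow> bool" where
  "char_decomposition G scale bs \<rho> P \<chi>s \<longleftrightarrow>
     P \<in> carrier_mat (length bs) (length bs) \<and> invertible_mat P \<and>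
     length \<chi>s = length bs \<and> set \<chi>s \<subseteq> carrier (char_group G) \<and>
     (\<forall>i<length bs. \<forall>g\<in>carrier G.
        map_mat to_ac (coord_mat scale bs (\<rho> g)) *\<^sub>v col P i = (\<chi>s ! i) g \<cdot>\<^sub>v col P i)"

definition characters_in ::
    "('g, 'm) monoid_scheme \<Rightarrow> ('k::field \<Rightarrow> 'v::ab_group_add \<Rightarrow> 'v) \<Rightarrow> 'v list \<Rightarrow> ('g \<Rightarrow> 'v \<Rightarrow> 'v) \<Rightarrow>
     ('g \<Rightarrow> 'k alg_closure) set" where
  "characters_in G scale bs \<rho> =
     {\<chi>. \<exists>P \<chi>s. char_decomposition G scale bs \<rho> P \<chi>s \<and> \<chi> \<in> set \<chi>s}"

definition nontrivial_characters_in ::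
    "('g, 'm) monoid_scheme \<Rightarrow> ('k::field \<Rightarrow> 'v::ab_group_add \<Rightarrow> 'v) \<Rightarrow> 'v list \<Rightarrow> ('g \<Rightarrow> 'v \<Rightarrow> 'v) \<Rightarrow>
     ('g \<Rightarrow> 'k alg_closure) set" where
  "nontrivial_characters_in G scale bs \<rho> =
     {\<chi> \<in> characters_in G scale bs \<rho>. \<chi> \<noteq> \<one>\<^bsub>char_group G\<^esub>}"


section \<open>Invariant rational functions\<close>

text \<open>The polynomial \<open>p\<close> stands for the element of the symmetric algebra of the dual space obtained
  by letting \<open>mvar i\<close> be the \<open>i\<close>-th coordinate function with respect to \<open>bs\<close>. If \<open>\<phi>\<close> has
  coordinate matrix \<open>A\<close>, then \<open>lin_subst A p\<close> is \<open>p \<circ> \<phi>\<close>.\<close>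

definition lin_subst :: "('k::field) mat \<Rightarrow> 'k mpol \<Rightarrow> 'k mpol" where
  "lin_subst A p = mpoly_eval mconst (\<lambda>i. \<Sum>j<dim_col A. mconst (A $$ (i, j)) * mvar j) p"

text \<open>The induced action on functions is \<open>(g \<cdot> p) v = p (g\<inverse> v)\<close>.\<close>

definition poly_act ::
    "('g, 'm) monoid_scheme \<Rightarrow> ('k::field \<Rightarrow> 'v::ab_group_add \<Rightarrow> 'v) \<Rightarrow> 'v list \<Rightarrow> ('g \<Rightarrow> 'v \<Rightarrow> 'v) \<Rightarrow>
     'g \<Rightarrow> 'k mpol \<Rightarrow> 'k mpol" where
  "poly_act G scale bs \<rho> g p = lin_subst (coord_mat scale bs (\<rho> (inv\<^bsub>G\<^esub> g))) p"

definition ratfun_act ::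
    "('g, 'm) monoid_scheme \<Rightarrow> ('k::field \<Rightarrow> 'v::ab_group_add \<Rightarrow> 'v) \<Rightarrow> 'v list \<Rightarrow> ('g \<Rightarrow> 'v \<Rightarrow> 'v) \<Rightarrow>
     'g \<Rightarrow> 'k mpol fract \<Rightarrow> 'k mpol fract" where
  "ratfun_act G scale bs \<rho> g f =
     (THE h. \<exists>p\<in>poly_ring (length bs). \<exists>q\<in>poly_ring (length bs). q \<noteq> 0 \<and> f = Fract p q \<and>
        h = Fract (poly_act G scale bs \<rho> g p) (poly_act G scale bs \<rho> g q))"

definition invariant_ratfuns ::
    "('g, 'm) monoid_scheme \<Rightarrow> ('k::field \<Rightarrow> 'v::ab_group_add \<Rightarrow> 'v) \<Rightarrow> 'v list \<Rightarrow> ('g \<Rightarrow> 'v \<Rightarrow> 'v) \<Rightarrow>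
     'k mpol fract set" where
  "invariant_ratfuns G scale bs \<rho> =
     {f \<in> ratfuns (length bs). \<forall>g\<in>carrier G. ratfun_act G scale bs \<rho> g f = f}"

definition invariant_ratfuns_le ::
    "('g, 'm) monoid_scheme \<Rightarrow> ('k::field \<Rightarrow> 'v::ab_group_add \<Rightarrow> 'v) \<Rightarrow> 'v list \<Rightarrow> ('g \<Rightarrow> 'v \<Rightarrow> 'v) \<Rightarrow>
     nat \<Rightarrow> 'k mpol fract set" where
  "invariant_ratfuns_le G scale bs \<rho> d =
     {f \<in> invariant_ratfuns G scale bs \<rho>. ratfun_degree (length bs) f \<le> d}"

definition gamma_rfield ::
    "('g, 'm) monoid_scheme \<Rightarrow> ('k::field \<Rightarrow> 'v::ab_group_add \<Rightarrow> 'v) \<Rightarrow> 'v list \<Rightarrow> ('g \<Rightarrow> 'v \<Rightarrow> 'v) \<Rightarrow>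
     nat" where
  "gamma_rfield G scale bs \<rho> =
     (LEAST d. 0 < d \<and>
        (\<exists>B \<subseteq> invariant_ratfuns_le G scale bs \<rho> d.
           transcendence_basis ratfun_const (invariant_ratfuns G scale bs \<rho>) B))"

end

theory Submission
  imports Defs "Jordan_Normal_Form.Char_Poly"
begin

text \<open>
  Over an algebraic closure of the ground field the group acts diagonally in suitable coordinates
  \<open>Y\<^sub>1, \<dots>, Y\<^sub>n\<close>, each of which carries a character (\<open>exists_char_decomposition\<close>). Both halves
  of the theorem read off what this means for invariants of small degree.

  An invariant of degree at most two is, up to constants, a polynomial of degree at most two, the
  inverse of one, or a quotient of two affine polynomials. Comparing coefficients shows that its
  invariance only involves which products of at most two coordinates have trivial character and which
  coordinates have equal characters (\<open>scaling_quotient_of_small_degree\<close>). Suppose that some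
  character \<open>\<chi>\<close> that occurs is neither trivial nor an involution. The torus that multiplies the
  coordinates with character \<open>\<chi>\<close> by \<open>t\<close>, those with the inverse character by \<open>1 / t\<close>, and fixes the other
  coordinates respects these relations, hence fixes all invariants of degree at most two. If they
  contained a transcendence basis of the invariants, then every rational function would be algebraic
  over a field fixed by the torus, because the field of rational functions is algebraic over the
  invariants; its orbit under the torus would consist of roots of a single polynomial and would
  be finite. But the torus is infinite and moves some coordinate function of the representation
  through infinitely many values (\<open>no_transcendence_basis_of_small_degree\<close>). This bounds the degree from
  below by three. For degree one the same argument works with any nontrivial character \<open>\<chi>\<close>, when only
  the coordinates with character \<open>\<chi>\<close> are scaled, and bounds the degree from below by two.

  Conversely, if all nontrivial characters are involutions, then every group element acts with square
  one, and already over the ground field every linear form is a sum of common eigenforms with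
  eigenvalues \<open>1\<close> and \<open>- 1\<close>. The squares of these eigenforms are invariants of degree two over which
  all rational functions are algebraic (\<open>quadratic_transcendence_basis\<close>). That the minimum in the
  definition exists at all follows from the orbit polynomials of the variables
  (\<open>exists_transcendence_basis_of_bounded_degree\<close>).

  The last claim compares numbers of involutions: if all nontrivial characters that occur are
  involutions, there are at most as many as involutions in the character group, and these are at
  most as many as the involutions of the group (\<open>card_char_involutions_le\<close>).
\<close>

section \<open>Evaluation of polynomials in several variables\<close>

definition monom_eval :: "('i \<Rightarrow> 'a::comm_semiring_1) \<Rightarrow> ('i \<Rightarrow>\<^sub>0 nat) \<Rightarrow> 'a" where
  "monom_eval x m = (\<Prod>i\<in>Poly_Mapping.keys m. x i ^ Poly_Mapping.lookup m i)"

lemma mpoly_eval_monom_eval: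
  "mpoly_eval c x p = (\<Sum>m\<in>Poly_Mapping.keys p. c (Poly_Mapping.lookup p m) * monom_eval x m)"
  by (simp add: mpoly_eval_def monom_eval_def)

lemma monom_eval_superset:
  assumes "finite A" "Poly_Mapping.keys m \<subseteq> A"
  shows "monom_eval x m = (\<Prod>i\<in>A. x i ^ Poly_Mapping.lookup m i)"
  unfolding monom_eval_def
  by (rule prod.mono_neutral_left) (use assms in \<open>auto simp: in_keys_iff\<close>)

lemma monom_eval_0 [simp]: "monom_eval x 0 = 1"
  by (simp add: monom_eval_def)

lemma monom_eval_single [simp]: "monom_eval x (Poly_Mapping.single i e) = x i ^ e"
  by (cases "e = 0") (simp_all add: monom_eval_def)

lemma monom_eval_add: "monom_eval x (m + m') = monom_eval x m * monom_eval x m'"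
proof -
  let ?A = "Poly_Mapping.keys m \<union> Poly_Mapping.keys m'"
  have "monom_eval x (m + m') = (\<Prod>i\<in>?A. x i ^ Poly_Mapping.lookup (m + m') i)"
    by (rule monom_eval_superset) (use Poly_Mapping.keys_add[of m m'] in auto)
  also have "\<dots> = (\<Prod>i\<in>?A. x i ^ Poly_Mapping.lookup m i) * (\<Prod>i\<in>?A. x i ^ Poly_Mapping.lookup m' i)"
    by (simp add: lookup_add power_add prod.distrib)
  also have "\<dots> = monom_eval x m * monom_eval x m'"
    by (simp add: monom_eval_superset[of ?A])
  finally show ?thesis .
qed

lemma poly_mapping_eq_sum_single:
  "p = (\<Sum>m\<in>Poly_Mapping.keys p. Poly_Mapping.single m (Poly_Mapping.lookup p m))"
  by (rule poly_mapping_eqI)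
    (simp add: lookup_sum lookup_single when_def sum.delta in_keys_iff)

lemma mpoly_eval_superset:
  assumes "c 0 = 0" "finite A" "Poly_Mapping.keys p \<subseteq> A"
  shows "mpoly_eval c x p = (\<Sum>m\<in>A. c (Poly_Mapping.lookup p m) * monom_eval x m)"
  unfolding mpoly_eval_monom_eval
  by (rule sum.mono_neutral_left) (use assms in \<open>auto simp: in_keys_iff\<close>)

lemma mpoly_eval_single:
  assumes "c 0 = 0"
  shows "mpoly_eval c x (Poly_Mapping.single m a) = c a * monom_eval x m"
  using assms by (cases "a = 0") (simp_all add: mpoly_eval_monom_eval)

lemma mpoly_eval_cong:
  assumes "\<And>i. i \<in> mpoly_vars p \<Longrightarrow> x i = y i"
  shows "mpoly_eval c x p = mpoly_eval c y p"
proof -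
  have "x i = y i" if "m \<in> Poly_Mapping.keys p" "i \<in> Poly_Mapping.keys m" for m i
    using assms that by (auto simp: mpoly_vars_def)
  then show ?thesis
    unfolding mpoly_eval_def by (intro sum.cong prod.cong arg_cong2[of _ _ _ _ times] refl) simp
qed

context comm_ring_hom
begin

lemma mpoly_eval_add: "mpoly_eval hom x (p + q) = mpoly_eval hom x p + mpoly_eval hom x q"
proof -
  let ?A = "Poly_Mapping.keys p \<union> Poly_Mapping.keys q"
  have "mpoly_eval hom x (p + q) =
      (\<Sum>m\<in>?A. hom (Poly_Mapping.lookup (p + q) m) * monom_eval x m)"
    by (rule mpoly_eval_superset) (use Poly_Mapping.keys_add[of p q] in auto)
  also have "\<dots> = mpoly_eval hom x p + mpoly_eval hom x q"
    by (simp add: mpoly_eval_superset[of _ ?A] lookup_add hom_add distrib_right sum.distrib)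
  finally show ?thesis .
qed

lemma mpoly_eval_sum: "mpoly_eval hom x (\<Sum>j\<in>J. f j) = (\<Sum>j\<in>J. mpoly_eval hom x (f j))"
  by (induction J rule: infinite_finite_induct)
    (simp_all add: mpoly_eval_add, simp_all add: mpoly_eval_def)

lemma mpoly_eval_mult: "mpoly_eval hom x (p * q) = mpoly_eval hom x p * mpoly_eval hom x q"
proof -
  let ?s = Poly_Mapping.single and ?l = Poly_Mapping.lookup and ?k = Poly_Mapping.keys
  have "p * q = (\<Sum>m\<in>?k p. ?s m (?l p m)) * (\<Sum>m\<in>?k q. ?s m (?l q m))"
    by (subst (1 2) poly_mapping_eq_sum_single) (rule refl)
  also have "\<dots> = (\<Sum>m\<in>?k p. \<Sum>m'\<in>?k q. ?s (m + m') (?l p m * ?l q m'))"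
    by (simp add: sum_product mult_single)
  finally have *: "mpoly_eval hom x (p * q) =
      mpoly_eval hom x (\<Sum>m\<in>?k p. \<Sum>m'\<in>?k q. ?s (m + m') (?l p m * ?l q m'))"
    by simp
  show ?thesis
    unfolding * mpoly_eval_sum mpoly_eval_single[of hom, OF hom_zero] hom_mult monom_eval_add
    by (simp add: mpoly_eval_monom_eval sum_product mult_ac)
qed

lemma comm_ring_hom_mpoly_eval: "comm_ring_hom (mpoly_eval hom x)"
proof
  show "mpoly_eval hom x 1 = 1"
    using mpoly_eval_single[of hom x 0 1] by simp
  show "mpoly_eval hom x 0 = 0"
    by (simp add: mpoly_eval_def)
qed (rule mpoly_eval_mult mpoly_eval_add)+

lemma hom_mpoly_eval: "hom (mpoly_eval c x p) = mpoly_eval (\<lambda>a. hom (c a)) (\<lambda>i. hom (x i)) p"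
  by (simp add: mpoly_eval_def hom_sum hom_mult hom_prod hom_power)

end

lemma monom_eval_mvar: "monom_eval mvar m = (Poly_Mapping.single m 1 :: 'k::comm_ring_1 mpol)"
proof -
  have *: "mvar i ^ e = (Poly_Mapping.single (Poly_Mapping.single i e) 1 :: 'k mpol)" for i e
    by (induction e) (simp_all add: mvar_def mult_single flip: single_add)
  have **: "(\<Prod>i\<in>A. Poly_Mapping.single (f i) 1) =
      (Poly_Mapping.single (sum f A) 1 :: 'k mpol)" for f :: "nat \<Rightarrow> _" and A
    by (induction A rule: infinite_finite_induct) (simp_all add: mult_single)
  show ?thesis
    by (subst (2) poly_mapping_eq_sum_single[of m]) (simp add: monom_eval_def * **)
qed

lemma comm_ring_hom_mconst: "comm_ring_hom (mconst :: 'k::comm_ring_1 \<Rightarrow> 'k mpol)"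
  by standard (simp_all add: mconst_def mult_single single_add)

lemma lookup_mpoly_eval_mvar:
  assumes "c 0 = 0"
  shows "Poly_Mapping.lookup (mpoly_eval (\<lambda>a. mconst (c a)) mvar p) m =
    (c (Poly_Mapping.lookup p m) :: 'k::comm_ring_1)"
  using assms
  by (simp add: mpoly_eval_monom_eval monom_eval_mvar mconst_def mult_single lookup_sum
      lookup_single when_def sum.delta in_keys_iff)

lemma mpoly_eval_mconst_mvar: "mpoly_eval mconst mvar p = (p :: 'k::comm_ring_1 mpol)"
  by (rule poly_mapping_eqI) (use lookup_mpoly_eval_mvar[of "\<lambda>a. a" p] in simp)


section \<open>Algebraic elements\<close>

lemma ring_of_type_algebra_simps:
  "carrier ring_of_type_algebra = UNIV"
  "\<zero>\<^bsub>ring_of_type_algebra\<^esub> = 0" "\<one>\<^bsub>ring_of_type_algebra\<^esub> = 1"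
  "x \<oplus>\<^bsub>ring_of_type_algebra\<^esub> y = x + y" "x \<otimes>\<^bsub>ring_of_type_algebra\<^esub> y = x * y"
  by (simp_all add: ring_of_type_algebra_def)

lemma ring_of_type_algebra_pow:
  "x [^]\<^bsub>ring_of_type_algebra\<^esub> (n::nat) = (x::'f::field) ^ n"
proof -
  interpret R: field "ring_of_type_algebra :: 'f ring"
    by (rule field_from_type_algebra)
  show ?thesis
    by (induction n) (simp_all add: ring_of_type_algebra_simps)
qed

lemma ring_of_type_algebra_a_inv: "\<ominus>\<^bsub>ring_of_type_algebra\<^esub> x = - (x::'f::field)"
proof -
  interpret R: field "ring_of_type_algebra :: 'f ring"
    by (rule field_from_type_algebra)
  show ?thesis
    by (rule R.minus_equality) (simp_all add: ring_of_type_algebra_simps)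
qed

lemma ring_of_type_algebra_m_inv:
  assumes "(x::'f::field) \<noteq> 0"
  shows "inv\<^bsub>ring_of_type_algebra\<^esub> x = inverse x"
proof -
  interpret R: field "ring_of_type_algebra :: 'f ring"
    by (rule field_from_type_algebra)
  show ?thesis
    by (rule R.comm_inv_char) (use assms in \<open>simp_all add: ring_of_type_algebra_simps\<close>)
qed

abbreviation adjoin :: "('k \<Rightarrow> 'f::field) \<Rightarrow> 'f set \<Rightarrow> 'f set" where
  "adjoin c B \<equiv> generate_field ring_of_type_algebra (range c \<union> B)"

abbreviation algebraic_over :: "'f::field set \<Rightarrow> 'f \<Rightarrow> bool" where
  "algebraic_over \<equiv> ring.algebraic ring_of_type_algebra"

abbreviation is_subfield :: "'f::field set \<Rightarrow> bool" where
  "is_subfield K \<equiv> subfield K ring_of_type_algebra"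

lemma is_subfieldD:
  assumes "is_subfield (K :: 'f::field set)"
  shows "0 \<in> K" "1 \<in> K" "x \<in> K \<Longrightarrow> y \<in> K \<Longrightarrow> x + y \<in> K" "x \<in> K \<Longrightarrow> y \<in> K \<Longrightarrow> x * y \<in> K"
    "x \<in> K \<Longrightarrow> x ^ n \<in> K" "finite A \<Longrightarrow> (\<And>a. a \<in> A \<Longrightarrow> f a \<in> K) \<Longrightarrow> prod f A \<in> K"
    "finite A \<Longrightarrow> (\<And>a. a \<in> A \<Longrightarrow> f a \<in> K) \<Longrightarrow> sum f A \<in> K"
    "x \<in> K \<Longrightarrow> - x \<in> K" "x \<in> K \<Longrightarrow> inverse x \<in> K"
proof -
  interpret R: field "ring_of_type_algebra :: 'f ring"
    by (rule field_from_type_algebra)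
  note S = subfieldE(1)[OF assms]
  show 0: "0 \<in> K" and 1: "1 \<in> K" and m: "x \<in> K \<Longrightarrow> - x \<in> K" for x
    using subringE(2,3,5)[OF S] by (simp_all add: ring_of_type_algebra_simps ring_of_type_algebra_a_inv)
  show a: "x \<in> K \<Longrightarrow> y \<in> K \<Longrightarrow> x + y \<in> K" and t: "x \<in> K \<Longrightarrow> y \<in> K \<Longrightarrow> x * y \<in> K" for x y
    using subringE(6,7)[OF S] by (simp_all add: ring_of_type_algebra_simps)
  show "x \<in> K \<Longrightarrow> x ^ n \<in> K" for n
    by (induction n) (auto intro: 1 t)
  show "finite A \<Longrightarrow> (\<And>a. a \<in> A \<Longrightarrow> f a \<in> K) \<Longrightarrow> prod f A \<in> K"
    by (induction A rule: finite_induct) (auto intro: 1 t)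
  show "finite A \<Longrightarrow> (\<And>a. a \<in> A \<Longrightarrow> f a \<in> K) \<Longrightarrow> sum f A \<in> K"
    by (induction A rule: finite_induct) (auto intro: 0 a)
  show "x \<in> K \<Longrightarrow> inverse x \<in> K"
    using R.subfield_m_inv(1)[OF assms, of x] 0
    by (cases "x = 0") (auto simp: ring_of_type_algebra_simps ring_of_type_algebra_m_inv)
qed

lemma is_subfieldI:
  assumes "0 \<in> K" "1 \<in> K" "\<And>x y. x \<in> K \<Longrightarrow> y \<in> K \<Longrightarrow> x + y \<in> K"
    "\<And>x y. x \<in> K \<Longrightarrow> y \<in> K \<Longrightarrow> x * y \<in> K" "\<And>x. x \<in> K \<Longrightarrow> - x \<in> K"
    "\<And>x. x \<in> K \<Longrightarrow> inverse x \<in> K"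
  shows "is_subfield (K :: 'f::field set)"
proof -
  interpret R: field "ring_of_type_algebra :: 'f ring"
    by (rule field_from_type_algebra)
  show ?thesis
    by (intro R.subfieldI' R.subringI)
      (use assms in \<open>auto simp: ring_of_type_algebra_simps ring_of_type_algebra_a_inv
        ring_of_type_algebra_m_inv\<close>)
qed

lemma is_subfield_adjoin: "is_subfield (adjoin c B)"
  by (rule field.generate_field_is_subfield[OF field_from_type_algebra])
    (simp add: ring_of_type_algebra_simps)

lemma adjoin_subset:
  assumes "is_subfield E" "range c \<subseteq> E" "B \<subseteq> E"
  shows "adjoin c B \<subseteq> E"
  by (rule field.generate_field_min_subfield1[OF field_from_type_algebra])
    (use assms in \<open>simp_all add: ring_of_type_algebra_simps\<close>)

lemma eval_ring_of_type_algebra: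
  "ring.eval ring_of_type_algebra p (x::'f::field) = poly (Poly (rev p)) x"
proof -
  interpret R: field "ring_of_type_algebra :: 'f ring"
    by (rule field_from_type_algebra)
  show ?thesis
    by (induction p)
      (simp_all add: ring_of_type_algebra_simps ring_of_type_algebra_pow Poly_append poly_monom
        mult.commute)
qed

text \<open>The library defines algebraic elements through polynomials given as coefficient lists with the
  leading coefficient first; reversing such a list gives an element of \<^typ>\<open>'f poly\<close>.\<close>

lemma algebraic_over_iff:
  assumes "is_subfield (K :: 'f::field set)"
  shows "algebraic_over K x \<longleftrightarrow> (\<exists>p. p \<noteq> 0 \<and> (\<forall>i. Polynomial.coeff p i \<in> K) \<and> poly p x = 0)"
proof
  interpret R: field "ring_of_type_algebra :: 'f ring"
    by (rule field_from_type_algebra)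
  assume "algebraic_over K x"
  then obtain p where p: "p \<in> carrier (K[X]\<^bsub>ring_of_type_algebra\<^esub>)" "p \<noteq> []"
      "R.eval p x = 0"
    using R.algebraicE[OF subfieldE(1)[OF assms], of x]
    by (auto simp: ring_of_type_algebra_simps over_def)
  then have s: "set p \<subseteq> K" and l: "hd p \<noteq> 0"
    by (auto simp: univ_poly_carrier[symmetric] polynomial_def ring_of_type_algebra_simps)
  have "nth_default 0 (rev p) (length p - 1) = hd p"
    using p(2) by (cases p) (simp_all add: nth_default_append)
  then have "Poly (rev p) \<noteq> 0"
    using l by (metis coeff_0 coeff_Poly_eq)
  moreover have "Polynomial.coeff (Poly (rev p)) i \<in> K" for i
    using s is_subfieldD(1)[OF assms]
    by (auto simp: nth_default_def intro!: subsetD[OF s] nth_mem[of _ "rev p", simplified])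
  ultimately show "\<exists>p. p \<noteq> 0 \<and> (\<forall>i. Polynomial.coeff p i \<in> K) \<and> poly p x = 0"
    using p(3) by (auto simp: eval_ring_of_type_algebra)
next
  interpret R: field "ring_of_type_algebra :: 'f ring"
    by (rule field_from_type_algebra)
  assume "\<exists>p. p \<noteq> 0 \<and> (\<forall>i. Polynomial.coeff p i \<in> K) \<and> poly p x = 0"
  then obtain p where p: "p \<noteq> 0" "\<And>i. Polynomial.coeff p i \<in> K" "poly p x = 0"
    by auto
  have "rev (coeffs p) \<in> carrier (K[X]\<^bsub>ring_of_type_algebra\<^esub>)"
    using p(1,2)
    by (auto simp: univ_poly_carrier[symmetric] polynomial_def ring_of_type_algebra_simps
        hd_rev last_coeffs_eq_coeff_degree coeffs_def)
  then show "algebraic_over K x"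
    using R.algebraicI[of "rev (coeffs p)" K x] p(1,3)
    by (auto simp: eval_ring_of_type_algebra ring_of_type_algebra_simps over_def)
qed

lemma is_subfield_algebraic_over:
  assumes "is_subfield (K :: 'f::field set)"
  shows "is_subfield {x. algebraic_over K x}"
proof -
  interpret R: field "ring_of_type_algebra :: 'f ring"
    by (rule field_from_type_algebra)
  show ?thesis
    using R.subfield_of_algebraics[OF assms] by (simp add: ring_of_type_algebra_simps over_def)
qed

lemma algebraic_over_self:
  assumes "is_subfield (K :: 'f::field set)" "x \<in> K"
  shows "algebraic_over K x"
proof -
  interpret R: field "ring_of_type_algebra :: 'f ring"
    by (rule field_from_type_algebra)
  show ?thesis
    using R.algebraic_self[OF subfieldE(1)[OF assms(1)] assms(2)] by (simp add: over_def)
qed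

text \<open>A root lies in a tower of two finite extensions, the lower one generated by the
  coefficients. This is transitivity of algebraicity.\<close>

lemma algebraic_over_root:
  fixes K :: "'f::field set"
  assumes K: "is_subfield K" and p: "p \<noteq> 0" "\<And>i. algebraic_over K (Polynomial.coeff p i)"
    and root: "poly p x = 0"
  shows "algebraic_over K x"
proof -
  interpret R: field "ring_of_type_algebra :: 'f ring"
    by (rule field_from_type_algebra)
  define cs where "cs = coeffs p"
  define E where "E = R.finite_extension K cs"
  have carr: "set xs \<subseteq> carrier ring_of_type_algebra" for xs :: "'f list"
    by (simp add: ring_of_type_algebra_simps)
  have alg: "(R.algebraic over K) c" if "c \<in> set cs" for c
    using that p(2) by (auto simp: cs_def coeffs_def over_def split: if_splits)
  have E: "is_subfield E"
    unfolding E_def by (rule R.finite_extension_is_subfield[OF K carr alg])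
  have "set cs \<subseteq> E"
    unfolding E_def by (rule R.finite_extension_mem[OF subfieldE(1)[OF K] carr])
  then have "Polynomial.coeff p i \<in> E" for i
    using is_subfieldD(1)[OF E] nth_default_coeffs_eq[of p, THEN fun_cong, of i]
    by (auto simp: cs_def nth_default_def split: if_splits dest!: nth_mem)
  then have x: "(R.algebraic over E) x"
    using algebraic_over_iff[OF E] p(1) root by (auto simp: over_def)
  have xc: "x \<in> carrier ring_of_type_algebra"
    by (simp add: ring_of_type_algebra_simps)
  have "R.finite_dimension E (R.simple_extension E x)"
    using R.finite_dimension_simple_extension[OF E xc] x by simp
  moreover have "R.finite_dimension K E"
    unfolding E_def by (rule R.finite_extension_finite_dimension(1)[OF K carr alg])
  ultimately have "R.finite_dimension K (R.simple_extension E x)"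
    using R.telescopic_base_dim(1)[OF K E] by blast
  then show ?thesis
    using R.finite_dimension_imp_algebraic[OF K R.simple_extension_is_subring[OF subfieldE(1)[OF E] xc]
        _ R.simple_extension_mem[OF subfieldE(1)[OF E] xc]]
    by (simp add: over_def)
qed

lemma algebraic_over_if_power:
  fixes K :: "'f::field set"
  assumes K: "is_subfield K" and n: "n > 0" and x: "algebraic_over K (x ^ n)"
  shows "algebraic_over K x"
proof -
  let ?p = "Polynomial.monom 1 n - [:x ^ n:]"
  have coeff: "Polynomial.coeff ?p i = (if i = n then 1 else if i = 0 then - (x ^ n) else 0)" for i
    using n by (cases i) (simp_all add: coeff_pCons)
  have nz: "?p \<noteq> 0"
  proof
    assume "?p = 0"
    then have "Polynomial.coeff ?p n = 0"
      by (simp only: coeff_0)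
    then show False
      unfolding coeff by simp
  qed
  have root: "poly ?p x = 0"
    by (simp add: poly_monom)
  note S = is_subfieldD[OF is_subfield_algebraic_over[OF K]]
  have "- (x ^ n) \<in> {x. algebraic_over K x}"
    by (rule S(8)) (use x in simp)
  then have "Polynomial.coeff ?p i \<in> {x. algebraic_over K x}" for i
    unfolding coeff by (simp only: S(1,2) split: if_split) simp
  then show ?thesis
    using algebraic_over_root[OF K nz _ root] by simp
qed


section \<open>Transcendence bases\<close>

text \<open>Sorting a relation by the powers of \<open>s\<close> turns it into a univariate polynomial with the root \<open>s\<close>.
  Its coefficients are values of polynomials in the elements of \<open>B\<close>, and one of these polynomials is
  nonzero, so that independence of \<open>B\<close> keeps the univariate polynomial from vanishing.\<close>

lemma algebraic_over_adjoin_if_dependent: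
  fixes c :: "'k::field \<Rightarrow> 'f::field"
  assumes c: "comm_ring_hom c" and B: "alg_independent c B"
    and dep: "\<not> alg_independent c (insert s B)"
  shows "algebraic_over (adjoin c B) s"
proof -
  interpret c: comm_ring_hom c by (rule c)
  let ?l = Poly_Mapping.lookup and ?k = Poly_Mapping.keys
  from dep obtain p :: "('f \<Rightarrow>\<^sub>0 nat) \<Rightarrow>\<^sub>0 'k"
    where p: "mpoly_vars p \<subseteq> insert s B" "mpoly_eval c (\<lambda>b. b) p = 0" "p \<noteq> 0"
    by (auto simp: alg_independent_def)
  \<comment> \<open>\<open>r m\<close> is \<open>m\<close> without its power of \<open>s\<close>, and \<open>P e\<close> collects the terms of \<open>p\<close> that contain \<open>s\<close> to the
    exponent \<open>e\<close>.\<close>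
  define r where "r m = Poly_Mapping.update s 0 m" for m :: "'f \<Rightarrow>\<^sub>0 nat"
  have keys_r: "?k (r m) = ?k m - {s}" for m
    by (simp add: r_def keys_update)
  have inj: "m = m'" if "r m = r m'" "?l m s = ?l m' s" for m m'
  proof (rule poly_mapping_eqI)
    fix i
    have "?l (r m) i = ?l (r m') i"
      using that by simp
    with that(2) show "?l m i = ?l m' i"
      by (cases "i = s") (simp_all add: r_def lookup_update)
  qed
  have mon: "monom_eval (\<lambda>b. b) m = monom_eval (\<lambda>b. b) (r m) * s ^ ?l m s" for m
  proof -
    have "monom_eval (\<lambda>b. b) m = (\<Prod>i\<in>insert s (?k m). i ^ ?l m i)"
      by (rule monom_eval_superset) auto
    also have "\<dots> = s ^ ?l m s * (\<Prod>i\<in>?k m - {s}. i ^ ?l m i)"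
      by (simp add: prod.insert_remove)
    also have "(\<Prod>i\<in>?k m - {s}. i ^ ?l m i) = monom_eval (\<lambda>b. b) (r m)"
      unfolding monom_eval_def keys_r
      by (rule prod.cong) (auto simp: r_def lookup_update)
    finally show ?thesis
      by (simp add: mult.commute)
  qed
  define P where "P e = (\<Sum>m\<in>{m\<in>?k p. ?l m s = e}. Poly_Mapping.single (r m) (?l p m))" for e
  define U where "U = (\<Sum>m\<in>?k p. Polynomial.monom (c (?l p m) * monom_eval (\<lambda>b. b) (r m)) (?l m s))"
  have coeff_U: "Polynomial.coeff U e = mpoly_eval c (\<lambda>b. b) (P e)" for e
    by (simp add: U_def P_def coeff_sum c.mpoly_eval_sum mpoly_eval_single)
      (simp add: sum.inter_filter)
  have vars_P: "mpoly_vars (P e) \<subseteq> B" for e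
  proof -
    have "?k (P e) \<subseteq> r ` ?k p"
      unfolding P_def
      by (rule order_trans[OF keys_sum]) (auto split: if_splits)
    then show ?thesis
      using p(1) unfolding mpoly_vars_def by (auto simp: keys_r dest!: subsetD)
  qed
  have "U \<noteq> 0"
  proof
    assume "U = 0"
    then have P0: "P e = 0" for e
      using B vars_P[of e] coeff_U[of e] by (auto simp: alg_independent_def)
    have "?l p m = 0" if "m \<in> ?k p" for m
    proof -
      have "0 = ?l (P (?l m s)) (r m)"
        by (simp add: P0)
      also have "\<dots> = (\<Sum>m'\<in>{m'\<in>?k p. ?l m' s = ?l m s}. if m' = m then ?l p m else 0)"
        unfolding P_def lookup_sum
        by (rule sum.cong) (auto simp: lookup_single when_def dest: inj)
      also have "\<dots> = ?l p m"
        using that by simp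
      finally show ?thesis
        by simp
    qed
    then have "?l p m = 0" for m
      by (cases "m \<in> ?k p") (simp_all add: in_keys_iff)
    then have "p = 0"
      by (intro poly_mapping_eqI) simp
    with p(3) show False ..
  qed
  moreover have "poly U s = 0"
    using p(2) by (simp add: U_def poly_sum poly_monom mpoly_eval_monom_eval mult.assoc flip: mon)
  moreover have "Polynomial.coeff U i \<in> adjoin c B" for i
  proof -
    note S = is_subfieldD[OF is_subfield_adjoin[of c B]]
    have "c a \<in> adjoin c B" for a
      by (rule generate_field.incl) simp
    moreover have "monom_eval (\<lambda>b. b) (r m) \<in> adjoin c B" if "m \<in> ?k p" for m
      unfolding monom_eval_def
      by (intro S(5,6) finite_keys generate_field.incl)
        (use that p(1) in \<open>auto simp: keys_r mpoly_vars_def\<close>)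
    ultimately show ?thesis
      unfolding U_def coeff_sum by (intro S(7) finite_keys) (auto intro: S(1,4))
  qed
  ultimately show ?thesis
    unfolding algebraic_over_iff[OF is_subfield_adjoin] by blast
qed

lemma alg_independent_empty:
  fixes c :: "'k::field \<Rightarrow> 'f::field"
  assumes c: "comm_ring_hom c"
  shows "alg_independent c {}"
  unfolding alg_independent_def
proof (intro allI impI)
  interpret c: comm_ring_hom c by (rule c)
  fix p :: "('f \<Rightarrow>\<^sub>0 nat) \<Rightarrow>\<^sub>0 'k"
  assume p: "mpoly_vars p \<subseteq> {} \<and> mpoly_eval c (\<lambda>b. b) p = 0"
  then have "Poly_Mapping.keys p \<subseteq> {0}"
    by (auto simp: mpoly_vars_def)
  then have *: "mpoly_eval c (\<lambda>b. b) p = c (Poly_Mapping.lookup p 0)"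
    by (subst mpoly_eval_superset[of c "{0}"]) simp_all
  have "c a * c (inverse a) = 1" if "a \<noteq> 0" for a
    using that by (simp flip: c.hom_mult)
  then have "Poly_Mapping.lookup p 0 = 0"
    using p * by (metis mult_zero_left zero_neq_one)
  with \<open>Poly_Mapping.keys p \<subseteq> {0}\<close> have "Poly_Mapping.keys p = {}"
    by (auto simp: subset_singleton_iff in_keys_iff)
  then show "p = 0"
    by simp
qed

text \<open>Among the independent subsets of \<open>S\<close>, of which the empty set is one, an inclusion-maximal one serves.\<close>

lemma exists_transcendence_basis_subset:
  fixes c :: "'k::field \<Rightarrow> 'f::field"
  assumes c: "comm_ring_hom c" and "finite S"
  obtains B where "B \<subseteq> S" "alg_independent c B" "\<And>s. s \<in> S \<Longrightarrow> algebraic_over (adjoin c B) s"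
proof -
  define I where "I = {B. B \<subseteq> S \<and> alg_independent c B}"
  have "finite I"
    unfolding I_def by (rule finite_subset[of _ "Pow S"]) (use \<open>finite S\<close> in auto)
  moreover have "{} \<in> I"
    using alg_independent_empty[OF c] by (simp add: I_def)
  ultimately obtain B where B: "B \<in> I" "\<And>B'. B' \<in> I \<Longrightarrow> B \<subseteq> B' \<Longrightarrow> B = B'"
    using finite_has_maximal[of I] by (metis empty_iff)
  have "algebraic_over (adjoin c B) s" if "s \<in> S" for s
  proof (cases "s \<in> B")
    case True
    then show ?thesis
      by (intro algebraic_over_self is_subfield_adjoin generate_field.incl) simp
  next
    case False
    have "\<not> alg_independent c (insert s B)"
    proof
      assume "alg_independent c (insert s B)"
      then have "insert s B \<in> I"
        using B(1) that by (simp add: I_def)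
      from B(2)[OF this] False show False
        by auto
    qed
    then show ?thesis
      using algebraic_over_adjoin_if_dependent[OF c] B(1) by (simp add: I_def)
  qed
  then show thesis
    using that[of B] B(1) by (simp add: I_def)
qed


section \<open>Degrees of polynomials and of rational functions\<close>

definition weight :: "(nat \<Rightarrow> nat) \<Rightarrow> (nat \<Rightarrow>\<^sub>0 nat) \<Rightarrow> nat" where
  "weight \<omega> m = (\<Sum>i\<in>Poly_Mapping.keys m. \<omega> i * Poly_Mapping.lookup m i)"

text \<open>The substitution that multiplies the variable number \<open>i\<close> by \<open>T\<close> to the power \<open>\<omega> i\<close>, for a fresh
  univariate indeterminate \<open>T\<close>. The degree in \<open>T\<close> of the result is the \<open>\<omega>\<close>-weighted degree, which is
  therefore additive on products, because degrees of univariate polynomials over a domain are.\<close>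

definition graded :: "(nat \<Rightarrow> nat) \<Rightarrow> 'k::field mpol \<Rightarrow> 'k mpol poly" where
  "graded \<omega> = mpoly_eval (\<lambda>a. [:mconst a:]) (\<lambda>i. Polynomial.monom (mvar i) (\<omega> i))"

lemma comm_ring_hom_graded: "comm_ring_hom (graded \<omega> :: 'k::field mpol \<Rightarrow> _)"
proof -
  interpret c: comm_ring_hom "mconst :: 'k \<Rightarrow> 'k mpol" by (rule comm_ring_hom_mconst)
  have "comm_ring_hom (\<lambda>a::'k. [:mconst a:])"
    by standard (simp_all add: c.hom_add c.hom_mult one_pCons)
  from comm_ring_hom.comm_ring_hom_mpoly_eval[OF this] show ?thesis
    by (simp add: graded_def)
qed

lemma monom_eval_graded:
  "monom_eval (\<lambda>i. Polynomial.monom (mvar i :: 'k::field mpol) (\<omega> i)) m =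
    Polynomial.monom (Poly_Mapping.single m 1) (weight \<omega> m)"
proof -
  have *: "(\<Prod>i\<in>A. Polynomial.monom (a i) (b i)) = Polynomial.monom (prod a A) (sum b A)"
    for a :: "nat \<Rightarrow> 'k mpol" and b A
    by (induction A rule: infinite_finite_induct) (simp_all add: mult_monom flip: one_pCons monom_0)
  show ?thesis
    by (simp add: monom_eval_def monom_power * weight_def flip: monom_eval_mvar)
qed

lemma lookup_coeff_graded:
  "Poly_Mapping.lookup (Polynomial.coeff (graded \<omega> p) d) m =
    (if weight \<omega> m = d then Poly_Mapping.lookup (p :: 'k::field mpol) m else 0)"
proof -
  have 1: "graded \<omega> p = (\<Sum>m\<in>Poly_Mapping.keys p.
      Polynomial.monom (Poly_Mapping.single m (Poly_Mapping.lookup p m)) (weight \<omega> m))"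
    by (simp add: graded_def mpoly_eval_monom_eval monom_eval_graded smult_monom mconst_def mult_single)
  have "Poly_Mapping.lookup (Polynomial.coeff (graded \<omega> p) d) m =
      (\<Sum>m'\<in>Poly_Mapping.keys p. if m' = m then
        (if weight \<omega> m = d then Poly_Mapping.lookup p m else 0) else 0)"
    unfolding 1 coeff_sum lookup_sum
    by (rule sum.cong) (auto simp: lookup_single when_def)
  also have "\<dots> = (if weight \<omega> m = d then Poly_Mapping.lookup p m else 0)"
    by (simp add: sum.delta in_keys_iff)
  finally show ?thesis .
qed

lemma degree_graded_le_iff:
  "Polynomial.degree (graded \<omega> p) \<le> d \<longleftrightarrow>
    (\<forall>m\<in>Poly_Mapping.keys (p :: 'k::field mpol). weight \<omega> m \<le> d)"
proof
  assume d: "Polynomial.degree (graded \<omega> p) \<le> d"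
  show "\<forall>m\<in>Poly_Mapping.keys p. weight \<omega> m \<le> d"
  proof
    fix m assume "m \<in> Poly_Mapping.keys p"
    then have "Polynomial.coeff (graded \<omega> p) (weight \<omega> m) \<noteq> 0"
      using lookup_coeff_graded[of \<omega> p "weight \<omega> m" m] by (auto simp: in_keys_iff)
    then show "weight \<omega> m \<le> d"
      using d le_degree order_trans by blast
  qed
next
  assume *: "\<forall>m\<in>Poly_Mapping.keys p. weight \<omega> m \<le> d"
  show "Polynomial.degree (graded \<omega> p) \<le> d"
  proof (intro degree_le allI impI poly_mapping_eqI)
    fix i m assume "d < i"
    with * have "weight \<omega> m = i \<Longrightarrow> m \<notin> Poly_Mapping.keys p"
      by auto
    then show "Poly_Mapping.lookup (Polynomial.coeff (graded \<omega> p) i) m = Poly_Mapping.lookup 0 m"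
      by (simp add: lookup_coeff_graded in_keys_iff)
  qed
qed

lemma graded_eq_0_iff [simp]: "graded \<omega> p = 0 \<longleftrightarrow> p = (0 :: 'k::field mpol)"
proof
  assume "graded \<omega> p = 0"
  then have "Poly_Mapping.lookup p m = 0" for m
    using lookup_coeff_graded[of \<omega> p "weight \<omega> m" m] by simp
  then show "p = 0"
    by (intro poly_mapping_eqI) simp
next
  assume "p = 0"
  then show "graded \<omega> p = 0"
    by (simp add: graded_def mpoly_eval_def)
qed

lemma degree_graded_mult:
  "p \<noteq> 0 \<Longrightarrow> q \<noteq> 0 \<Longrightarrow> Polynomial.degree (graded \<omega> (p * q)) =
    Polynomial.degree (graded \<omega> p) + Polynomial.degree (graded \<omega> (q :: 'k::field mpol))"
proof -
  assume pq: "p \<noteq> 0" "q \<noteq> 0"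
  interpret g: comm_ring_hom "graded \<omega> :: 'k mpol \<Rightarrow> _" by (rule comm_ring_hom_graded)
  show ?thesis
    using pq by (simp add: g.hom_mult degree_mult_eq)
qed

lemma weight_superset:
  assumes "finite A" "Poly_Mapping.keys m \<subseteq> A"
  shows "weight \<omega> m = (\<Sum>i\<in>A. \<omega> i * Poly_Mapping.lookup m i)"
  unfolding weight_def
  by (rule sum.mono_neutral_left) (use assms in \<open>auto simp: in_keys_iff\<close>)

lemma weight_add: "weight \<omega> (m + m') = weight \<omega> m + weight \<omega> m'"
proof -
  let ?A = "Poly_Mapping.keys m \<union> Poly_Mapping.keys m'"
  have "weight \<omega> (m + m') = (\<Sum>i\<in>?A. \<omega> i * Poly_Mapping.lookup (m + m') i)"
    by (rule weight_superset) (use Poly_Mapping.keys_add[of m m'] in auto)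
  also have "\<dots> = weight \<omega> m + weight \<omega> m'"
    by (simp add: weight_superset[of ?A] lookup_add distrib_left sum.distrib)
  finally show ?thesis .
qed

lemma weight_single [simp]: "weight \<omega> (Poly_Mapping.single i e) = \<omega> i * e"
  by (simp add: weight_def)

lemma monomial_remove_variable:
  fixes m :: "'i \<Rightarrow>\<^sub>0 nat"
  assumes "m \<noteq> 0"
  obtains i m' where "m = Poly_Mapping.single i 1 + m'" "i \<in> Poly_Mapping.keys m"
proof -
  obtain i where i: "i \<in> Poly_Mapping.keys m"
    using assms by (metis all_not_in_conv keys_eq_empty)
  have "m = Poly_Mapping.single i 1 + (m - Poly_Mapping.single i 1)"
    by (rule poly_mapping_eqI)
      (use i in \<open>auto simp: lookup_add lookup_minus lookup_single when_def in_keys_iff\<close>)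
  then show thesis
    using that i by blast
qed

lemma monomial_degree_le_2_cases:
  assumes "weight (\<lambda>_. 1) m \<le> 2"
  obtains "m = 0" | i where "m = Poly_Mapping.single i 1"
    | i j where "m = Poly_Mapping.single i 1 + Poly_Mapping.single j 1"
proof (cases "m = 0")
  case False
  then obtain i m' where m: "m = Poly_Mapping.single i 1 + m'"
    using monomial_remove_variable by blast
  show thesis
  proof (cases "m' = 0")
    case True
    then show thesis
      using that(2) m by simp
  next
    case False
    then obtain j m'' where m': "m' = Poly_Mapping.single j 1 + m''"
      using monomial_remove_variable by blast
    have "m'' = 0"
    proof (rule ccontr)
      assume "m'' \<noteq> 0"
      then obtain k m3 where "m'' = Poly_Mapping.single k 1 + m3"
        using monomial_remove_variable by blast
      then show False
        using assms by (simp add: m m' weight_add)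
    qed
    then show thesis
      using that(3) m m' by simp
  qed
qed (rule that)

lemma total_degree_le_iff:
  "total_degree p \<le> d \<longleftrightarrow>
    (\<forall>m\<in>Poly_Mapping.keys p. (\<Sum>i\<in>Poly_Mapping.keys m. Poly_Mapping.lookup m i) \<le> d)"
  by (auto simp: total_degree_def)

lemma total_degree_eq_degree_graded:
  "total_degree (p :: 'k::field mpol) = Polynomial.degree (graded (\<lambda>_. 1) p)"
proof -
  have "total_degree p \<le> d \<longleftrightarrow> Polynomial.degree (graded (\<lambda>_. 1) p) \<le> d" for d
    by (simp add: total_degree_le_iff degree_graded_le_iff weight_def)
  then show ?thesis
    by (meson order_antisym order_refl)
qed

lemma total_degree_mult:
  "p \<noteq> 0 \<Longrightarrow> q \<noteq> 0 \<Longrightarrow> total_degree (p * q) = total_degree p + total_degree (q :: 'k::field mpol)"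
  unfolding total_degree_eq_degree_graded by (rule degree_graded_mult)

lemma total_degree_power_le: "total_degree (p ^ n) \<le> n * total_degree (p :: 'k::field mpol)"
proof (induction n)
  case (Suc n)
  have "total_degree (0 :: 'k mpol) = 0"
    by (simp add: total_degree_def)
  with Suc show ?case
    by (cases "p = 0") (simp_all add: total_degree_mult)
qed (simp add: total_degree_def)

lemma mem_poly_ring_iff:
  "p \<in> poly_ring n \<longleftrightarrow> (\<forall>i\<ge>n. \<forall>m\<in>Poly_Mapping.keys p. Poly_Mapping.lookup m i = 0)"
proof -
  have "p \<in> poly_ring n \<longleftrightarrow> (\<forall>m\<in>Poly_Mapping.keys p. \<forall>i. i \<in> Poly_Mapping.keys m \<longrightarrow> i < n)"
    by (auto simp: poly_ring_def mpoly_vars_def)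
  also have "\<dots> \<longleftrightarrow> (\<forall>i\<ge>n. \<forall>m\<in>Poly_Mapping.keys p. Poly_Mapping.lookup m i = 0)"
    by (metis in_keys_iff not_less)
  finally show ?thesis .
qed

lemma weight_indicator: "weight (\<lambda>j. if j = i then 1 else 0) m = Poly_Mapping.lookup m i"
proof -
  have "weight (\<lambda>j. if j = i then 1 else 0) m =
      (\<Sum>j\<in>Poly_Mapping.keys m. if j = i then Poly_Mapping.lookup m i else 0)"
    unfolding weight_def by (rule sum.cong) auto
  then show ?thesis
    by (simp add: sum.delta in_keys_iff)
qed

lemma poly_ring_iff_degree_graded:
  "(p :: 'k::field mpol) \<in> poly_ring n \<longleftrightarrow>
    (\<forall>i\<ge>n. Polynomial.degree (graded (\<lambda>j. if j = i then 1 else 0) p) \<le> 0)"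
  unfolding degree_graded_le_iff weight_indicator mem_poly_ring_iff by simp

lemma poly_ring_factor:
  assumes "p * q \<in> poly_ring n" "p * q \<noteq> (0 :: 'k::field mpol)"
  shows "p \<in> poly_ring n" "q \<in> poly_ring n"
  using assms by (auto simp: poly_ring_iff_degree_graded degree_graded_mult)

lemma mem_poly_ring_mconst [simp]: "mconst a \<in> poly_ring n"
  by (auto simp: mem_poly_ring_iff mconst_def)

lemma mem_poly_ring_mvar [simp]: "i < n \<Longrightarrow> (mvar i :: 'k::field mpol) \<in> poly_ring n"
  by (auto simp: mem_poly_ring_iff mvar_def lookup_single when_def)

lemma mem_poly_ring_0 [simp]: "0 \<in> poly_ring n" and mem_poly_ring_1 [simp]: "(1::'k::field mpol) \<in> poly_ring n"
  by (auto simp: mem_poly_ring_iff)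

lemma mem_poly_ring_add: "p \<in> poly_ring n \<Longrightarrow> q \<in> poly_ring n \<Longrightarrow> p + q \<in> poly_ring n"
  using Poly_Mapping.keys_add[of p q] by (fastforce simp: mem_poly_ring_iff)

lemma mem_poly_ring_uminus:
  "p \<in> poly_ring n \<Longrightarrow> - p \<in> poly_ring n" for p :: "'k::field mpol"
  by (auto simp: mem_poly_ring_iff in_keys_iff)

lemma mem_poly_ring_diff:
  "p \<in> poly_ring n \<Longrightarrow> q \<in> poly_ring n \<Longrightarrow> p - q \<in> poly_ring n" for p :: "'k::field mpol"
  using mem_poly_ring_add[OF _ mem_poly_ring_uminus, of p n q] by simp

lemma mem_poly_ring_mult:
  "p \<in> poly_ring n \<Longrightarrow> q \<in> poly_ring n \<Longrightarrow> p * q \<in> poly_ring n" for p :: "'k::field mpol"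
  by (cases "p = 0 \<or> q = 0") (auto simp: poly_ring_iff_degree_graded degree_graded_mult)

lemma mem_poly_ring_power:
  "p \<in> poly_ring n \<Longrightarrow> p ^ k \<in> poly_ring n" for p :: "'k::field mpol"
  by (induction k) (auto intro: mem_poly_ring_mult)

lemma mem_poly_ring_sum:
  "(\<And>j. j \<in> J \<Longrightarrow> f j \<in> poly_ring n) \<Longrightarrow> sum f J \<in> poly_ring n"
  by (induction J rule: infinite_finite_induct) (auto intro: mem_poly_ring_add)

lemma mem_poly_ring_prod:
  "(\<And>j. j \<in> J \<Longrightarrow> f j \<in> poly_ring n) \<Longrightarrow> prod f J \<in> poly_ring n" for f :: "_ \<Rightarrow> 'k::field mpol"
  by (induction J rule: infinite_finite_induct) (auto intro: mem_poly_ring_mult)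

lemma dvd_one_if_total_degree_0:
  assumes "total_degree h = 0" "h \<noteq> (0 :: 'k::field mpol)"
  shows "h dvd 1"
proof -
  have k: "Poly_Mapping.keys h \<subseteq> {0}"
  proof
    fix m assume "m \<in> Poly_Mapping.keys h"
    then have "(\<Sum>i\<in>Poly_Mapping.keys m. Poly_Mapping.lookup m i) = 0"
      using total_degree_le_iff[of h 0] assms(1) by simp
    then have "Poly_Mapping.lookup m i = Poly_Mapping.lookup 0 i" for i
      by (cases "i \<in> Poly_Mapping.keys m") (simp_all add: in_keys_iff)
    then show "m \<in> {0}"
      by (simp add: poly_mapping_eqI)
  qed
  have h: "h = Poly_Mapping.single 0 (Poly_Mapping.lookup h 0)"
  proof (rule poly_mapping_eqI)
    fix m
    show "Poly_Mapping.lookup h m =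
        Poly_Mapping.lookup (Poly_Mapping.single 0 (Poly_Mapping.lookup h 0)) m"
      using k by (cases "m = 0") (auto simp: lookup_single in_keys_iff)
  qed
  with assms(2) have "Poly_Mapping.lookup h 0 \<noteq> 0"
    by (metis single_zero)
  then have "h * Poly_Mapping.single 0 (inverse (Poly_Mapping.lookup h 0)) = 1"
    by (subst h) (simp add: mult_single)
  then show ?thesis
    by (metis dvd_triv_left)
qed

text \<open>Cancelling a non-constant common factor lowers the degree of the denominator.\<close>

lemma ratfuns_coprime_representation:
  assumes "f \<in> ratfuns n"
  obtains p q where "p \<in> poly_ring n" "q \<in> poly_ring n" "q \<noteq> 0" "mpoly_coprime p q" "f = Fract p q"
proof -
  define R where "R d \<longleftrightarrow> (\<exists>p\<in>poly_ring n. \<exists>q\<in>poly_ring n. q \<noteq> 0 \<and> f = Fract p q \<and>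
    d = total_degree q)" for d
  have "\<exists>d. R d"
    using assms by (auto simp: R_def ratfuns_def)
  then obtain d where d: "R d" "\<And>d'. d' < d \<Longrightarrow> \<not> R d'"
    using exists_least_iff[of R] by auto
  then obtain p q where pq: "p \<in> poly_ring n" "q \<in> poly_ring n" "q \<noteq> 0" "f = Fract p q"
      "d = total_degree q"
    by (auto simp: R_def)
  have "mpoly_coprime p q"
    unfolding mpoly_coprime_def
  proof (intro allI impI, elim conjE)
    fix h assume "h dvd p" "h dvd q"
    then obtain p' q' where p': "p = h * p'" and q': "q = h * q'"
      by (auto simp: dvd_def)
    have h: "h \<noteq> 0" "q' \<noteq> 0"
      using pq(3) q' by auto
    have "p' \<in> poly_ring n"
      using poly_ring_factor(2)[of h p' n] pq(1) p' h(1) by (cases "p' = 0") auto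
    moreover have "q' \<in> poly_ring n"
      using poly_ring_factor(2)[of h q' n] pq(2,3) q' by auto
    moreover have "f = Fract p' q'"
      using h by (simp add: pq(4) p' q' eq_fract)
    ultimately have "R (total_degree q')"
      using h by (auto simp: R_def)
    then have "\<not> total_degree q' < d"
      using d(2) by blast
    then have "total_degree h = 0"
      using h by (simp add: pq(5) q' total_degree_mult)
    then show "h dvd 1"
      using h by (simp add: dvd_one_if_total_degree_0)
  qed
  then show thesis
    using that pq by blast
qed

text \<open>The minimum that defines the degree is attained because coprime representations exist.\<close>

lemma ratfun_degree_leE:
  assumes "f \<in> ratfuns n" "ratfun_degree n f \<le> d"
  obtains p q where "p \<in> poly_ring n" "q \<in> poly_ring n" "q \<noteq> 0" "f = Fract p q"
    "total_degree p + total_degree q \<le> d"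
proof -
  let ?R = "\<lambda>d. \<exists>p\<in>poly_ring n. \<exists>q\<in>poly_ring n. q \<noteq> 0 \<and> mpoly_coprime p q \<and>
        f = Fract p q \<and> d = total_degree p + total_degree q"
  have "\<exists>d. ?R d"
    using ratfuns_coprime_representation[OF assms(1)] by metis
  then have "?R (ratfun_degree n f)"
    unfolding ratfun_degree_def by (rule LeastI_ex)
  then show thesis
    using that assms(2) by auto
qed

lemma ratfun_degree_polynomial_le:
  assumes "p \<in> poly_ring n"
  shows "ratfun_degree n (Fract p 1) \<le> total_degree p"
proof -
  have "total_degree (1 :: 'k::field mpol) = 0"
    by (simp add: total_degree_def)
  moreover have "mpoly_coprime p 1"
    by (simp add: mpoly_coprime_def)
  ultimately show ?thesis
    unfolding ratfun_degree_def using assms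
    by (intro Least_le bexI[of _ p] bexI[of _ 1] conjI refl) simp_all
qed


section \<open>Linear substitutions\<close>

definition linear_form :: "nat \<Rightarrow> (nat \<Rightarrow> 'k::field) \<Rightarrow> 'k mpol" where
  "linear_form n a = (\<Sum>j<n. mconst (a j) * mvar j)"

lemma mconst_mult_mvar: "mconst a * mvar j = (Poly_Mapping.single (Poly_Mapping.single j 1) a :: 'k::field mpol)"
  by (simp add: mconst_def mvar_def mult_single)

lemma single_eq_single_iff:
  "Poly_Mapping.single i (Suc 0) = Poly_Mapping.single j (Suc 0) \<longleftrightarrow> i = j"
  by (metis lookup_single_eq lookup_single_not_eq nat.distinct(1))

lemma lookup_linear_form:
  "j < n \<Longrightarrow> Poly_Mapping.lookup (linear_form n a) (Poly_Mapping.single j 1) = a j"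
  by (simp add: linear_form_def mconst_mult_mvar lookup_sum lookup_single when_def
      single_eq_single_iff)

lemma linear_form_mem_poly_ring [simp]: "linear_form n a \<in> poly_ring n"
  unfolding linear_form_def by (intro mem_poly_ring_sum mem_poly_ring_mult) simp_all

lemma linear_form_unit:
  assumes "i < n"
  shows "linear_form n (\<lambda>j. if j = i then 1 else 0) = mvar i"
proof -
  have "linear_form n (\<lambda>j. if j = i then 1 else 0) =
      (\<Sum>j<n. if j = i then mvar i else 0 :: 'a mpol)"
    unfolding linear_form_def by (rule sum.cong) (auto simp: mconst_def)
  then show ?thesis
    using assms by simp
qed

lemma linear_form_add: "linear_form n a + linear_form n b = linear_form n (\<lambda>j. a j + b j)"
  by (simp add: linear_form_def mconst_mult_mvar single_add sum.distrib)

lemma mconst_mult_linear_form: "mconst c * linear_form n a = linear_form n (\<lambda>j. c * a j)"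
  by (simp add: linear_form_def mconst_def mvar_def mult_single sum_distrib_left)

lemma sum_linear_form: "(\<Sum>i\<in>I. linear_form n (a i)) = linear_form n (\<lambda>j. \<Sum>i\<in>I. a i j)"
  by (induction I rule: infinite_finite_induct)
    (simp_all add: linear_form_add, simp_all add: linear_form_def mconst_def)

lemma linear_form_cong: "(\<And>j. j < n \<Longrightarrow> a j = b j) \<Longrightarrow> linear_form n a = linear_form n b"
  by (simp add: linear_form_def)

text \<open>The variables from \<open>n\<close> on are kept. This makes the substitution by an invertible matrix injective
  on all polynomials, so that it extends to the whole fraction field.\<close>

definition base_subst :: "('k::field \<Rightarrow> 'K::field) \<Rightarrow> nat \<Rightarrow> 'K mat \<Rightarrow> 'k mpol \<Rightarrow> 'K mpol" where
  "base_subst c n B = mpoly_eval (\<lambda>a. mconst (c a))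
     (\<lambda>i. if i < n then linear_form n (\<lambda>j. B $$ (i, j)) else mvar i)"

lemma comm_ring_hom_mconst_comp:
  assumes "comm_ring_hom (c :: 'k::field \<Rightarrow> 'K::field)"
  shows "comm_ring_hom (\<lambda>a. mconst (c a))"
proof -
  interpret c: comm_ring_hom c by (rule assms)
  interpret m: comm_ring_hom "mconst :: 'K \<Rightarrow> _" by (rule comm_ring_hom_mconst)
  show ?thesis
    by standard (simp_all add: c.hom_add m.hom_add c.hom_mult m.hom_mult)
qed

lemma comm_ring_hom_base_subst:
  "comm_ring_hom c \<Longrightarrow> comm_ring_hom (base_subst c n B)"
  unfolding base_subst_def
  by (rule comm_ring_hom.comm_ring_hom_mpoly_eval[OF comm_ring_hom_mconst_comp])

lemma base_subst_mvar:
  assumes "comm_ring_hom c" "i < n"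
  shows "base_subst c n B (mvar i) = linear_form n (\<lambda>j. B $$ (i, j))"
proof -
  interpret c: comm_ring_hom "\<lambda>a. mconst (c a)" by (rule comm_ring_hom_mconst_comp[OF assms(1)])
  show ?thesis
    using assms(2) c.hom_one c.hom_zero unfolding base_subst_def mvar_def
    by (subst mpoly_eval_single) simp_all
qed

lemma base_subst_mvar_ge:
  assumes "comm_ring_hom c" "i \<ge> n"
  shows "base_subst c n B (mvar i) = mvar i"
proof -
  interpret c: comm_ring_hom "\<lambda>a. mconst (c a)" by (rule comm_ring_hom_mconst_comp[OF assms(1)])
  show ?thesis
    using assms(2) c.hom_one c.hom_zero unfolding base_subst_def mvar_def[of i]
    by (subst mpoly_eval_single) (simp_all add: mvar_def)
qed

lemma base_subst_mconst:
  assumes "comm_ring_hom c"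
  shows "base_subst c n B (mconst a) = mconst (c a)"
proof -
  interpret c: comm_ring_hom "\<lambda>a. mconst (c a)" by (rule comm_ring_hom_mconst_comp[OF assms(1)])
  show ?thesis
    unfolding base_subst_def using c.hom_zero
    by (subst (2) mconst_def, subst mpoly_eval_single) simp_all
qed

lemma base_subst_linear_form:
  assumes "comm_ring_hom c"
  shows "base_subst c n B (linear_form n a) = linear_form n (\<lambda>k. \<Sum>j<n. c (a j) * B $$ (j, k))"
proof -
  interpret s: comm_ring_hom "base_subst c n B" by (rule comm_ring_hom_base_subst[OF assms])
  show ?thesis
    by (simp add: linear_form_def[of n a] s.hom_sum s.hom_mult base_subst_mconst[OF assms]
        base_subst_mvar[OF assms] mconst_mult_linear_form sum_linear_form)
qed

lemma base_subst_comp: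
  assumes c: "comm_ring_hom c" and A: "A \<in> carrier_mat n n" and B: "B \<in> carrier_mat n n"
  shows "base_subst c n B (base_subst (\<lambda>a. a) n A p) = base_subst c n (map_mat c A * B) p"
proof -
  interpret s: comm_ring_hom "base_subst c n B" by (rule comm_ring_hom_base_subst[OF c])
  have "base_subst c n B (if i < n then linear_form n (\<lambda>j. A $$ (i, j)) else mvar i) =
      (if i < n then linear_form n (\<lambda>j. (map_mat c A * B) $$ (i, j)) else mvar i)" for i
    using A B
    by (auto simp: base_subst_linear_form[OF c] base_subst_mvar_ge[OF c] scalar_prod_def
        atLeast0LessThan intro!: linear_form_cong)
  then show ?thesis
    by (subst base_subst_def) (simp add: s.hom_mpoly_eval base_subst_mconst[OF c], simp add: base_subst_def)
qed

lemma base_subst_one: "base_subst c n (1\<^sub>m n) = mpoly_eval (\<lambda>a. mconst (c a)) mvar"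
proof -
  have "(if i < n then linear_form n (\<lambda>j. 1\<^sub>m n $$ (i, j)) else mvar i) = (mvar i :: 'b mpol)" for i
  proof (cases "i < n")
    case True
    then have "linear_form n (\<lambda>j. 1\<^sub>m n $$ (i, j)) = (mvar i :: 'b mpol)"
      by (subst linear_form_unit[OF True, symmetric], intro linear_form_cong) auto
    with True show ?thesis
      by simp
  qed simp
  then show ?thesis
    unfolding base_subst_def by simp
qed

lemma comm_ring_hom_id: "comm_ring_hom (\<lambda>a. a)"
  by standard simp_all

text \<open>Substituting the inverse matrix afterwards leaves only the change of coefficients.\<close>

lemma inj_base_subst:
  fixes c :: "'k::field \<Rightarrow> 'K::field"
  assumes c: "comm_ring_hom c" "inj c" and B: "B \<in> carrier_mat n n" "B' \<in> carrier_mat n n" "B * B' = 1\<^sub>m n"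
  shows "inj (base_subst c n B)"
proof (rule injI)
  interpret c: comm_ring_hom c by (rule c)
  interpret s: comm_ring_hom "base_subst (\<lambda>a. a) n B'" by (rule comm_ring_hom_base_subst[OF comm_ring_hom_id])
  fix p q assume eq: "base_subst c n B p = base_subst c n B q"
  have *: "base_subst (\<lambda>a. a) n B' (base_subst c n B p) = mpoly_eval (\<lambda>a. mconst (c a)) mvar p" for p
  proof -
    have "base_subst (\<lambda>a. a) n B' (if i < n then linear_form n (\<lambda>j. B $$ (i, j)) else mvar i) =
        (if i < n then linear_form n (\<lambda>j. (B * B') $$ (i, j)) else mvar i)" for i
      using B(1,2)
      by (auto simp: base_subst_linear_form[OF comm_ring_hom_id] base_subst_mvar_ge[OF comm_ring_hom_id]
          scalar_prod_def atLeast0LessThan intro!: linear_form_cong)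
    then have "base_subst (\<lambda>a. a) n B' (base_subst c n B p) = base_subst c n (1\<^sub>m n) p"
      unfolding B(3)
      by (subst (2) base_subst_def)
        (simp add: s.hom_mpoly_eval base_subst_mconst[OF comm_ring_hom_id], simp add: base_subst_def)
    then show ?thesis
      by (simp add: base_subst_one)
  qed
  have "Poly_Mapping.lookup p m = Poly_Mapping.lookup q m" for m
    using lookup_mpoly_eval_mvar[of c p m] lookup_mpoly_eval_mvar[of c q m] *[of p] *[of q] eq c(2)
    by (auto simp: inj_def)
  then show "p = q"
    by (intro poly_mapping_eqI)
qed

lemma mpoly_eval_mem_poly_ring:
  fixes x :: "nat \<Rightarrow> 'K::field mpol"
  assumes "\<And>i. i \<in> mpoly_vars p \<Longrightarrow> x i \<in> poly_ring n"
  shows "mpoly_eval (\<lambda>a. mconst (c a)) x p \<in> poly_ring n"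
  unfolding mpoly_eval_def
  by (intro mem_poly_ring_sum mem_poly_ring_mult mem_poly_ring_prod mem_poly_ring_power
      mem_poly_ring_mconst assms) (auto simp: mpoly_vars_def)

lemma base_subst_mem_poly_ring:
  assumes "p \<in> poly_ring n"
  shows "base_subst c n B p \<in> poly_ring n"
  unfolding base_subst_def
proof (rule mpoly_eval_mem_poly_ring)
  fix i assume "i \<in> mpoly_vars p"
  with assms have "i < n"
    by (auto simp: poly_ring_def)
  then show "(if i < n then linear_form n (\<lambda>j. B $$ (i, j)) else mvar i) \<in> poly_ring n"
    by simp
qed

lemma lin_subst_eq_base_subst:
  assumes "A \<in> carrier_mat n n" "p \<in> poly_ring n"
  shows "lin_subst A p = base_subst (\<lambda>a. a) n A p"
  unfolding lin_subst_def base_subst_def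
  by (rule mpoly_eval_cong) (use assms in \<open>auto simp: poly_ring_def linear_form_def\<close>)

lemma total_degree_mult_le: "total_degree (p * q) \<le> total_degree p + total_degree (q :: 'k::field mpol)"
proof (cases "p = 0 \<or> q = 0")
  case True
  then show ?thesis
    by (auto simp: total_degree_def)
qed (simp add: total_degree_mult)

lemma total_degree_sum_le:
  assumes "\<And>j. j \<in> J \<Longrightarrow> total_degree (f j) \<le> d"
  shows "total_degree (\<Sum>j\<in>J. f j :: 'k::field mpol) \<le> d"
  unfolding total_degree_le_iff
proof
  fix m assume "m \<in> Poly_Mapping.keys (\<Sum>j\<in>J. f j)"
  then obtain j where "j \<in> J" "m \<in> Poly_Mapping.keys (f j)"
    by (metis (no_types, lifting) in_keys_iff lookup_sum sum.neutral)
  with assms[of j] show "(\<Sum>i\<in>Poly_Mapping.keys m. Poly_Mapping.lookup m i) \<le> d"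
    by (auto simp: total_degree_le_iff)
qed

lemma total_degree_mconst [simp]: "total_degree (mconst a) = 0"
  by (simp add: total_degree_def mconst_def)

lemma total_degree_mvar: "total_degree (mvar i :: 'k::field mpol) \<le> 1"
  by (simp add: total_degree_le_iff mvar_def)

lemma total_degree_linear_form: "total_degree (linear_form n a) \<le> 1"
  unfolding linear_form_def
  by (intro total_degree_sum_le order_trans[OF total_degree_mult_le])
    (use total_degree_mvar in \<open>simp add: total_degree_mvar\<close>)

lemma total_degree_monom_eval_le:
  fixes x :: "nat \<Rightarrow> 'k::field mpol"
  assumes "\<And>i. total_degree (x i) \<le> 1"
  shows "total_degree (monom_eval x m) \<le> (\<Sum>i\<in>Poly_Mapping.keys m. Poly_Mapping.lookup m i)"
proof -
  have pow: "total_degree (x i ^ e) \<le> e" for i e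
    using total_degree_power_le[of "x i" e] mult_le_mono2[OF assms[of i], of e] by linarith
  have "total_degree (\<Prod>i\<in>I. x i ^ e i) \<le> sum e I" if "finite I" for I e
    using that
  proof (induction I rule: finite_induct)
    case (insert i I)
    then show ?case
      using total_degree_mult_le[of "x i ^ e i" "\<Prod>i\<in>I. x i ^ e i"] pow[of i "e i"] by simp
  qed (simp add: total_degree_def)
  then show ?thesis
    by (simp add: monom_eval_def)
qed

lemma total_degree_base_subst: "total_degree (base_subst c n B p) \<le> total_degree p"
  unfolding base_subst_def mpoly_eval_monom_eval
proof (rule total_degree_sum_le)
  let ?x = "\<lambda>i. if i < n then linear_form n (\<lambda>j. B $$ (i, j)) else mvar i"
  fix m assume m: "m \<in> Poly_Mapping.keys p"
  have "total_degree (mconst (c (Poly_Mapping.lookup p m)) * monom_eval ?x m) \<le> total_degree (monom_eval ?x m)"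
    using total_degree_mult_le[of "mconst (c (Poly_Mapping.lookup p m))"] by fastforce
  also have "\<dots> \<le> (\<Sum>i\<in>Poly_Mapping.keys m. Poly_Mapping.lookup m i)"
    by (rule total_degree_monom_eval_le)
      (use total_degree_linear_form total_degree_mvar in \<open>auto simp del: One_nat_def\<close>)
  also have "\<dots> \<le> total_degree p"
    using m total_degree_le_iff[of p "total_degree p"] by auto
  finally show "total_degree (mconst (c (Poly_Mapping.lookup p m)) * monom_eval ?x m) \<le> total_degree p" .
qed


section \<open>Homomorphisms of fraction fields\<close>

text \<open>For an injective homomorphism the choice of a representation as a fraction does not matter.\<close>

definition fract_map :: "('a::idom \<Rightarrow> 'b::idom) \<Rightarrow> 'a fract \<Rightarrow> 'b fract" where
  "fract_map \<phi> f = (case SOME (a, b). b \<noteq> 0 \<and> f = Fract a b of (a, b) \<Rightarrow> Fract (\<phi> a) (\<phi> b))"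

context
  fixes \<phi> :: "'a::idom \<Rightarrow> 'b::idom"
  assumes hom: "comm_ring_hom \<phi>" and inj: "inj \<phi>"
begin

interpretation \<phi>: comm_ring_hom \<phi> by (rule hom)

lemma inj_hom_eq_0_iff: "\<phi> a = 0 \<longleftrightarrow> a = 0"
  using inj \<phi>.hom_zero by (metis injD)

lemma fract_map_Fract:
  assumes "b \<noteq> 0"
  shows "fract_map \<phi> (Fract a b) = Fract (\<phi> a) (\<phi> b)"
proof -
  define R where "R = (\<lambda>(a', b'). b' \<noteq> 0 \<and> Fract a b = Fract a' b')"
  have "R (a, b)"
    using assms by (simp add: R_def)
  then have "R (Eps R)"
    by (rule someI)
  then obtain a' b' where ab: "Eps R = (a', b')" "b' \<noteq> 0" "Fract a b = Fract a' b'"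
    by (auto simp: R_def split: prod.splits)
  then have "\<phi> a * \<phi> b' = \<phi> a' * \<phi> b"
    using assms by (simp add: eq_fract flip: \<phi>.hom_mult)
  then show ?thesis
    using ab assms by (simp add: fract_map_def eq_fract inj_hom_eq_0_iff flip: R_def)
qed

lemma comm_ring_hom_fract_map: "comm_ring_hom (fract_map \<phi>)"
proof
  show "fract_map \<phi> 0 = 0" "fract_map \<phi> 1 = 1"
    by (simp_all add: Zero_fract_def One_fract_def fract_map_Fract)
  fix f g
  show "fract_map \<phi> (f + g) = fract_map \<phi> f + fract_map \<phi> g"
    by (cases f, cases g) (simp add: fract_map_Fract inj_hom_eq_0_iff \<phi>.hom_add \<phi>.hom_mult)
  show "fract_map \<phi> (f * g) = fract_map \<phi> f * fract_map \<phi> g"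
    by (cases f, cases g) (simp add: fract_map_Fract inj_hom_eq_0_iff \<phi>.hom_mult)
qed

lemma fract_map_inverse: "fract_map \<phi> (inverse f) = inverse (fract_map \<phi> f)"
proof (cases "f = 0")
  case True
  interpret fm: comm_ring_hom "fract_map \<phi>" by (rule comm_ring_hom_fract_map)
  from True show ?thesis
    by simp
next
  case False
  then show ?thesis
    by (cases f) (auto simp: fract_map_Fract Zero_fract_def eq_fract)
qed

end

lemma comm_ring_hom_Fract_1: "comm_ring_hom (\<lambda>a. Fract a 1 :: 'a::idom fract)"
  by standard (simp_all add: Zero_fract_def One_fract_def)

lemma inj_Fract_1: "Fract a 1 = Fract b 1 \<longleftrightarrow> a = (b :: 'a::idom)"
  by (simp add: eq_fract)

lemma comm_ring_hom_ratfun_const: "comm_ring_hom (ratfun_const :: 'k::field \<Rightarrow> _)"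
proof -
  interpret m: comm_ring_hom "mconst :: 'k \<Rightarrow> _" by (rule comm_ring_hom_mconst)
  interpret F: comm_ring_hom "\<lambda>a. Fract a 1 :: 'k mpol fract" by (rule comm_ring_hom_Fract_1)
  show ?thesis
    by standard (simp_all only: ratfun_const_def m.hom_add F.hom_add m.hom_mult F.hom_mult
        m.hom_zero F.hom_zero m.hom_one F.hom_one)
qed


lemma map_poly_prod_linear:
  assumes "comm_ring_hom h"
  shows "map_poly h (\<Prod>i\<in>I. [:- a i, 1:]) = (\<Prod>i\<in>I. [:- h (a i), 1:])"
proof -
  interpret h: comm_ring_hom h by (rule assms)
  interpret hm: map_poly_comm_ring_hom h ..
  have "map_poly h [:- a i, 1:] = [:- h (a i), 1:]" for i
    by (simp add: h.hom_uminus map_poly_pCons)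
  then show ?thesis
    by (simp only: hm.hom_prod)
qed


section \<open>Coordinates and the action on rational functions\<close>

locale abelian_rep = comm_group G
  for G :: "('g, 'm) monoid_scheme" (structure) +
  fixes scale :: "'k::field \<Rightarrow> 'v::ab_group_add \<Rightarrow> 'v"
    and bs :: "'v list"
    and \<rho> :: "'g \<Rightarrow> 'v \<Rightarrow> 'v"
  assumes finite_G: "finite (carrier G)"
    and basis: "ordered_basis scale bs"
    and rep: "is_representation G scale \<rho>"
begin

abbreviation n :: nat where "n \<equiv> length bs"

definition mat_of :: "'g \<Rightarrow> 'k mat" where
  "mat_of g = coord_mat scale bs (\<rho> g)"

sublocale V: finite_dimensional_vector_space scale "set bs"
  using basis by (simp add: ordered_basis_def)

sublocale act: group_action G UNIV \<rho>
  using rep by (simp add: is_representation_def)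

lemma distinct_bs: "distinct bs"
  using basis by (simp add: ordered_basis_def)

lemma linear_rho: "g \<in> carrier G \<Longrightarrow> Vector_Spaces.linear scale scale (\<rho> g)"
  using rep by (simp add: is_representation_def)

lemma sum_set_bs: "sum f (set bs) = (\<Sum>i<n. f (bs ! i))"
  by (rule sum.reindex_bij_betw[OF bij_betw_nth[OF distinct_bs refl refl], symmetric])

lemma mat_of_carrier [simp]: "mat_of g \<in> carrier_mat n n"
  by (simp add: mat_of_def coord_mat_def)

lemma mat_of_dim [simp]: "dim_row (mat_of g) = n" "dim_col (mat_of g) = n"
  by (simp_all add: mat_of_def coord_mat_def)

lemma mat_of_index: "i < n \<Longrightarrow> j < n \<Longrightarrow> mat_of g $$ (i, j) = V.representation (set bs) (\<rho> g (bs ! j)) (bs ! i)"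
  by (simp add: mat_of_def coord_mat_def)

lemma rho_basis: "j < n \<Longrightarrow> \<rho> g (bs ! j) = (\<Sum>i<n. scale (mat_of g $$ (i, j)) (bs ! i))"
  using V.sum_representation_eq[OF V.independent_Basis, of "\<rho> g (bs ! j)" "set bs"] V.span_Basis
  by (simp add: mat_of_index sum_set_bs)

lemma rho_sum:
  assumes "g \<in> carrier G"
  shows "\<rho> g (\<Sum>i\<in>I. scale (c i) (f i)) = (\<Sum>i\<in>I. scale (c i) (\<rho> g (f i)))"
proof -
  have l: "module_hom scale scale (\<rho> g)"
    using linear_rho[OF assms] by (simp add: module_hom_iff_linear)
  show ?thesis
    by (simp only: module_hom.sum[OF l] module_hom.scale[OF l])
qed

lemma mat_of_mult:
  assumes g: "g \<in> carrier G" and h: "h \<in> carrier G"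
  shows "mat_of (g \<otimes> h) = mat_of g * mat_of h"
proof (rule eq_matI)
  fix i j assume "i < dim_row (mat_of g * mat_of h)" "j < dim_col (mat_of g * mat_of h)"
  then have ij: "i < n" "j < n"
    by simp_all
  have "\<rho> (g \<otimes> h) (bs ! j) = \<rho> g (\<Sum>k<n. scale (mat_of h $$ (k, j)) (bs ! k))"
    using act.composition_rule[of "bs ! j" g h] g h rho_basis[OF ij(2), of h] by simp
  also have "\<dots> = (\<Sum>k<n. scale (mat_of h $$ (k, j)) (\<rho> g (bs ! k)))"
    by (rule rho_sum[OF g])
  finally have "mat_of (g \<otimes> h) $$ (i, j) =
      V.representation (set bs) (\<Sum>k<n. scale (mat_of h $$ (k, j)) (\<rho> g (bs ! k))) (bs ! i)"
    using ij by (simp only: mat_of_index)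
  also have "\<dots> = (\<Sum>k<n. mat_of h $$ (k, j) * V.representation (set bs) (\<rho> g (bs ! k)) (bs ! i))"
    by (simp add: V.representation_sum V.representation_scale V.independent_Basis V.span_Basis)
  also have "\<dots> = (\<Sum>k<n. mat_of g $$ (i, k) * mat_of h $$ (k, j))"
    using ij by (intro sum.cong) (simp_all add: mat_of_index mult.commute)
  also have "\<dots> = (mat_of g * mat_of h) $$ (i, j)"
    using ij by (simp add: scalar_prod_def atLeast0LessThan)
  finally show "mat_of (g \<otimes> h) $$ (i, j) = (mat_of g * mat_of h) $$ (i, j)" .
qed simp_all

lemma mat_of_one: "mat_of \<one> = 1\<^sub>m n"
proof (rule eq_matI)
  fix i j assume "i < dim_row (1\<^sub>m n :: 'k mat)" "j < dim_col (1\<^sub>m n :: 'k mat)"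
  moreover have "\<rho> \<one> x = x" for x
    using act.id_eq_one by (metis UNIV_I restrict_apply)
  ultimately show "mat_of \<one> $$ (i, j) = 1\<^sub>m n $$ (i, j)"
    using distinct_bs
    by (auto simp: mat_of_index V.representation_basis V.independent_Basis nth_eq_iff_index_eq)
qed simp_all

lemma rho_eq_id_if_mat_of_one:
  assumes g: "g \<in> carrier G" and "mat_of g = 1\<^sub>m n"
  shows "\<rho> g v = v"
proof -
  have fixes_basis: "\<rho> g b = b" if "b \<in> set bs" for b
  proof -
    obtain j where j: "j < n" "b = bs ! j"
      using \<open>b \<in> set bs\<close> by (auto simp: in_set_conv_nth)
    have "(\<Sum>i<n. scale (1\<^sub>m n $$ (i, j)) (bs ! i)) = (\<Sum>i<n. if i = j then bs ! j else 0)"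
      by (rule sum.cong) (use j in auto)
    then show ?thesis
      using rho_basis[of j g] j assms by simp
  qed
  define c where "c = V.representation (set bs) v"
  have v: "(\<Sum>b\<in>set bs. scale (c b) b) = v"
    unfolding c_def using V.span_Basis
    by (intro V.sum_representation_eq[OF V.independent_Basis]) simp_all
  have "\<rho> g (\<Sum>b\<in>set bs. scale (c b) b) = (\<Sum>b\<in>set bs. scale (c b) (\<rho> g b))"
    by (rule rho_sum[OF g])
  also have "\<dots> = (\<Sum>b\<in>set bs. scale (c b) b)"
    by (rule sum.cong) (simp_all add: fixes_basis)
  finally show ?thesis
    by (simp only: v)
qed

abbreviation act_poly :: "'g \<Rightarrow> 'k mpol \<Rightarrow> 'k mpol" where
  "act_poly \<equiv> poly_act G scale bs \<rho>"

lemma comm_ring_hom_act_poly: "comm_ring_hom (act_poly g)"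
  using comm_ring_hom.comm_ring_hom_mpoly_eval[OF comm_ring_hom_mconst]
  by (simp add: poly_act_def[abs_def] lin_subst_def[abs_def])

lemma act_poly_eq:
  "p \<in> poly_ring n \<Longrightarrow> act_poly g p = base_subst (\<lambda>a. a) n (mat_of (inv g)) p"
  by (simp add: poly_act_def lin_subst_eq_base_subst flip: mat_of_def)

lemma act_poly_mem: "p \<in> poly_ring n \<Longrightarrow> act_poly g p \<in> poly_ring n"
  by (simp add: act_poly_eq base_subst_mem_poly_ring)

lemma act_poly_mult:
  assumes "g \<in> carrier G" "h \<in> carrier G" "p \<in> poly_ring n"
  shows "act_poly g (act_poly h p) = act_poly (g \<otimes> h) p"
proof -
  have "map_mat (\<lambda>a. a) (mat_of k) = mat_of k" for k
    by (rule eq_matI) simp_all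
  then show ?thesis
    using assms
    by (simp add: act_poly_eq base_subst_mem_poly_ring base_subst_comp[OF comm_ring_hom_id]
        inv_mult_group mat_of_mult)
qed

lemma act_poly_one: "p \<in> poly_ring n \<Longrightarrow> act_poly \<one> p = p"
  by (simp add: act_poly_eq mat_of_one base_subst_one mpoly_eval_mconst_mvar)

lemma act_poly_eq_0_iff:
  assumes "g \<in> carrier G" "p \<in> poly_ring n"
  shows "act_poly g p = 0 \<longleftrightarrow> p = 0"
proof
  interpret a: comm_ring_hom "act_poly h" for h by (rule comm_ring_hom_act_poly)
  assume "act_poly g p = 0"
  then have "act_poly (inv g) (act_poly g p) = 0"
    by simp
  then show "p = 0"
    using assms by (simp add: act_poly_mult act_poly_one)
next
  interpret a: comm_ring_hom "act_poly h" for h by (rule comm_ring_hom_act_poly)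
  assume "p = 0"
  then show "act_poly g p = 0"
    by simp
qed

lemma ratfun_act_Fract:
  assumes g: "g \<in> carrier G" and p: "p \<in> poly_ring n" and q: "q \<in> poly_ring n" "q \<noteq> 0"
  shows "ratfun_act G scale bs \<rho> g (Fract p q) = Fract (act_poly g p) (act_poly g q)"
  unfolding ratfun_act_def
proof (rule the_equality)
  interpret a: comm_ring_hom "act_poly g" by (rule comm_ring_hom_act_poly)
  show "\<exists>p'\<in>poly_ring n. \<exists>q'\<in>poly_ring n. q' \<noteq> 0 \<and> Fract p q = Fract p' q' \<and>
      Fract (act_poly g p) (act_poly g q) = Fract (act_poly g p') (act_poly g q')"
    using p q by blast
  fix f assume "\<exists>p'\<in>poly_ring n. \<exists>q'\<in>poly_ring n. q' \<noteq> 0 \<and> Fract p q = Fract p' q' \<and>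
      f = Fract (act_poly g p') (act_poly g q')"
  then obtain p' q' where *: "p' \<in> poly_ring n" "q' \<in> poly_ring n" "q' \<noteq> 0" "Fract p q = Fract p' q'"
      "f = Fract (act_poly g p') (act_poly g q')"
    by blast
  then have "p * q' = p' * q"
    using q by (simp add: eq_fract)
  then have "act_poly g p * act_poly g q' = act_poly g p' * act_poly g q"
    by (simp flip: a.hom_mult)
  then show "f = Fract (act_poly g p) (act_poly g q)"
    using * q g by (simp add: eq_fract act_poly_eq_0_iff)
qed

lemma invariant_Fract_iff:
  assumes p: "p \<in> poly_ring n" and q: "q \<in> poly_ring n" "q \<noteq> 0"
  shows "Fract p q \<in> invariant_ratfuns G scale bs \<rho> \<longleftrightarrow>
    (\<forall>g\<in>carrier G. act_poly g p * q = p * act_poly g q)"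
  using assms
  by (auto simp: invariant_ratfuns_def ratfuns_def ratfun_act_Fract eq_fract act_poly_eq_0_iff)

lemma invariant_polynomial:
  assumes "p \<in> poly_ring n" "\<And>g. g \<in> carrier G \<Longrightarrow> act_poly g p = p"
  shows "Fract p 1 \<in> invariant_ratfuns G scale bs \<rho>"
proof -
  interpret a: comm_ring_hom "act_poly g" for g by (rule comm_ring_hom_act_poly)
  show ?thesis
    using assms by (subst invariant_Fract_iff) simp_all
qed

text \<open>In the orbit polynomial, whose roots are the images of the variable, the action of a group
  element permutes the linear factors and therefore fixes the coefficients.\<close>

lemma mvar_root_of_invariant_polynomial:
  assumes i: "i < n"
  obtains Q where "Q \<noteq> 0" "poly Q (Fract (mvar i) 1) = 0"
    "\<And>j. Polynomial.coeff Q j \<in> invariant_ratfuns G scale bs \<rho>"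
proof -
  define x :: "'k mpol" where "x = mvar i"
  have x: "x \<in> poly_ring n"
    using i by (simp add: x_def)
  define P where "P = (\<Prod>h\<in>carrier G. [:- act_poly h x, 1:])"
  have inv: "map_poly (act_poly g) P = P" if g: "g \<in> carrier G" for g
  proof -
    have "map_poly (act_poly g) P = (\<Prod>h\<in>carrier G. [:- act_poly g (act_poly h x), 1:])"
      unfolding P_def by (rule map_poly_prod_linear[OF comm_ring_hom_act_poly])
    also have "\<dots> = (\<Prod>h\<in>carrier G. [:- act_poly (g \<otimes> h) x, 1:])"
      by (rule prod.cong) (use g x in \<open>simp_all add: act_poly_mult\<close>)
    also have "\<dots> = P"
      unfolding P_def
    proof (rule prod.reindex_bij_betw[where h = "\<lambda>h. g \<otimes> h"])
      show "bij_betw ((\<otimes>) g) (carrier G) (carrier G)"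
        using g by (intro bij_betwI[where g = "\<lambda>h. inv g \<otimes> h"]) (auto simp flip: m_assoc)
    qed
    finally show ?thesis .
  qed
  have coeff_mem: "Polynomial.coeff (\<Prod>h\<in>H. [:- act_poly h x, 1:]) j \<in> poly_ring n" for H j
  proof (induction H arbitrary: j rule: infinite_finite_induct)
    case (insert h H)
    then show ?case
      by (auto simp: coeff_mult coeff_pCons act_poly_mem x
          intro!: mem_poly_ring_sum mem_poly_ring_mult mem_poly_ring_uminus mem_poly_ring_diff split: nat.split)
  qed (auto simp: coeff_pCons one_pCons split: nat.split)
  show thesis
  proof (rule that[of "map_poly (\<lambda>a. Fract a 1) P"])
    have P: "map_poly (\<lambda>a. Fract a 1) P = (\<Prod>h\<in>carrier G. [:- Fract (act_poly h x) 1, 1:])"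
      unfolding P_def by (rule map_poly_prod_linear[OF comm_ring_hom_Fract_1])
    show "map_poly (\<lambda>a. Fract a 1) P \<noteq> 0"
      unfolding P using finite_G by (simp add: prod_zero_iff)
    have "poly [:- Fract (act_poly \<one> x) 1, 1:] (Fract x 1) = 0"
      by (simp add: act_poly_one[OF x]) (simp flip: Zero_fract_def)
    then show "poly (map_poly (\<lambda>a. Fract a 1) P) (Fract (mvar i) 1) = 0"
      unfolding P poly_prod x_def[symmetric]
      by (intro prod_zero[OF finite_G] bexI[of _ \<one>]) simp_all
    show "Polynomial.coeff (map_poly (\<lambda>a. Fract a 1) P) j \<in> invariant_ratfuns G scale bs \<rho>" for j
    proof -
      interpret a: comm_ring_hom "act_poly g" for g by (rule comm_ring_hom_act_poly)
      have "act_poly g (Polynomial.coeff P j) = Polynomial.coeff P j" if "g \<in> carrier G" for g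
        using inv[OF that] by (metis coeff_map_poly a.hom_zero)
      then have "Fract (Polynomial.coeff P j) 1 \<in> invariant_ratfuns G scale bs \<rho>"
        using coeff_mem[of "carrier G" j] by (intro invariant_polynomial) (simp_all add: P_def)
      then show ?thesis
        by (subst coeff_map_poly) (simp_all only: Zero_fract_def)
    qed
  qed
qed

end


section \<open>Diagonal substitutions\<close>

definition scaling :: "(nat \<Rightarrow> 'K::field) \<Rightarrow> 'K mpol \<Rightarrow> 'K mpol" where
  "scaling u = mpoly_eval mconst (\<lambda>k. mconst (u k) * mvar k)"

lemma comm_ring_hom_scaling: "comm_ring_hom (scaling u)"
  unfolding scaling_def by (rule comm_ring_hom.comm_ring_hom_mpoly_eval[OF comm_ring_hom_mconst])

lemma monom_eval_scaling:
  "monom_eval (\<lambda>k. mconst (u k) * mvar k :: 'K::field mpol) m = Poly_Mapping.single m (monom_eval u m)"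
proof -
  interpret m: comm_ring_hom "mconst :: 'K \<Rightarrow> _" by (rule comm_ring_hom_mconst)
  have "monom_eval (\<lambda>k. mconst (u k) * mvar k) m = mconst (monom_eval u m) * monom_eval mvar m"
    by (simp add: monom_eval_def power_mult_distrib prod.distrib m.hom_prod m.hom_power)
  then show ?thesis
    by (simp add: monom_eval_mvar mconst_def mult_single)
qed

lemma lookup_scaling:
  "Poly_Mapping.lookup (scaling u p) m = monom_eval u m * Poly_Mapping.lookup p m"
proof -
  have "scaling u p = (\<Sum>m\<in>Poly_Mapping.keys p.
      Poly_Mapping.single m (Poly_Mapping.lookup p m * monom_eval u m))"
    unfolding scaling_def mpoly_eval_monom_eval monom_eval_scaling
    by (simp add: mconst_def mult_single)
  then show ?thesis
    by (simp add: lookup_sum lookup_single when_def sum.delta in_keys_iff)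
qed

lemma inj_scaling:
  assumes "\<And>k. u k \<noteq> 0"
  shows "inj (scaling u)"
proof (rule injI)
  fix p q assume eq: "scaling u p = scaling u q"
  have "monom_eval u m \<noteq> 0" for m
    using assms by (simp add: monom_eval_def)
  then have "Poly_Mapping.lookup p m = Poly_Mapping.lookup q m" for m
    using arg_cong[OF eq, of "\<lambda>r. Poly_Mapping.lookup r m"] by (simp add: lookup_scaling)
  then show "p = q"
    by (intro poly_mapping_eqI)
qed

lemma scaling_mconst: "scaling u (mconst a) = mconst a"
  by (rule poly_mapping_eqI) (auto simp: lookup_scaling mconst_def lookup_single when_def)

lemma scaling_linear_form: "scaling u (linear_form n a) = linear_form n (\<lambda>k. u k * a k)"
proof -
  interpret s: comm_ring_hom "scaling u" by (rule comm_ring_hom_scaling)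
  have "scaling u (mvar k) = mconst (u k) * mvar k" for k
    unfolding mconst_mult_mvar
    by (rule poly_mapping_eqI) (auto simp: lookup_scaling mvar_def lookup_single when_def)
  then show ?thesis
    by (simp add: linear_form_def s.hom_sum s.hom_mult scaling_mconst)
      (simp add: mconst_def mvar_def mult_single mult.commute)
qed

lemma scaling_eq_self_if:
  assumes "\<And>m. m \<in> Poly_Mapping.keys p \<Longrightarrow> monom_eval u m = 1"
  shows "scaling u p = p"
  by (rule poly_mapping_eqI) (use assms in \<open>auto simp: lookup_scaling in_keys_iff\<close>)

lemma scaling_eq_selfD:
  assumes "scaling u p = p" "m \<in> Poly_Mapping.keys p"
  shows "monom_eval u m = 1"
  using lookup_scaling[of u p m] assms by (auto simp: in_keys_iff)

lemma scaling_degree_0: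
  assumes "total_degree p = 0"
  shows "scaling u p = p"
proof (rule scaling_eq_self_if)
  fix m assume m: "m \<in> Poly_Mapping.keys p"
  then have "(\<Sum>i\<in>Poly_Mapping.keys m. Poly_Mapping.lookup m i) = 0"
    using total_degree_le_iff[of p 0] assms by simp
  then have "Poly_Mapping.lookup m i = Poly_Mapping.lookup 0 i" for i
    by (cases "i \<in> Poly_Mapping.keys m") (simp_all add: in_keys_iff)
  then have "m = 0"
    by (intro poly_mapping_eqI)
  then show "monom_eval u m = 1"
    by simp
qed

text \<open>Counting the constant monomial as one more variable, with the number \<open>0\<close>, makes affine polynomials
  homogeneous.\<close>

definition affine_monom :: "nat \<Rightarrow> nat \<Rightarrow>\<^sub>0 nat" where
  "affine_monom i = (case i of 0 \<Rightarrow> 0 | Suc k \<Rightarrow> Poly_Mapping.single k 1)"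

lemma lookup_affine_monom: "Poly_Mapping.lookup (affine_monom i) x = (if i = Suc x then 1 else 0)"
  by (auto simp: affine_monom_def lookup_single when_def split: nat.split)

lemma affine_monom_add_eq:
  assumes "affine_monom i + affine_monom j = affine_monom k + affine_monom l"
  shows "(i = k \<and> j = l) \<or> (i = l \<and> j = k)"
proof -
  have *: "(if i = y then 1 else 0) + (if j = y then 1 else 0) =
      (if k = y then 1 else 0) + (if l = y then 1 else (0::nat))" if "y \<noteq> 0" for y
    using arg_cong[OF assms, of "\<lambda>m. Poly_Mapping.lookup m (y - 1)"] that
    by (simp add: lookup_add lookup_affine_monom)
  have "i \<noteq> 0 \<Longrightarrow> i = k \<or> i = l" "i \<noteq> 0 \<Longrightarrow> i = j \<Longrightarrow> k = i \<and> l = i"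
    using *[of i] by (simp_all split: if_splits)
  moreover have "j \<noteq> 0 \<Longrightarrow> j = k \<or> j = l"
    using *[of j] by (simp split: if_splits)
  moreover have "k \<noteq> 0 \<Longrightarrow> k = i \<or> k = j" "k \<noteq> 0 \<Longrightarrow> k = l \<Longrightarrow> i = k \<and> j = k"
    using *[of k] by (simp_all split: if_splits)
  moreover have "l \<noteq> 0 \<Longrightarrow> l = i \<or> l = j"
    using *[of l] by (simp split: if_splits)
  ultimately show ?thesis
    by metis
qed

lemma inj_affine_monom: "affine_monom i = affine_monom j \<longleftrightarrow> i = j"
  using affine_monom_add_eq[of i i j j] by auto

lemma affine_eq_sum:
  assumes "p \<in> poly_ring n" "total_degree p \<le> 1"
  shows "p = (\<Sum>i<Suc n. Poly_Mapping.single (affine_monom i) (Poly_Mapping.lookup p (affine_monom i)))"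
proof -
  have *: "\<exists>i<Suc n. m = affine_monom i" if m: "m \<in> Poly_Mapping.keys p" for m
  proof (cases "m = 0")
    case True
    then show ?thesis
      by (intro exI[of _ 0]) (simp add: affine_monom_def)
  next
    case False
    then obtain k where k: "k \<in> Poly_Mapping.keys m"
      by (metis all_not_in_conv keys_eq_empty)
    have "(\<Sum>i\<in>Poly_Mapping.keys m. Poly_Mapping.lookup m i) \<le> 1"
      using m assms(2) total_degree_le_iff[of p 1] by blast
    moreover have "(\<Sum>i\<in>Poly_Mapping.keys m. Poly_Mapping.lookup m i) =
        Poly_Mapping.lookup m k + (\<Sum>i\<in>Poly_Mapping.keys m - {k}. Poly_Mapping.lookup m i)"
      using k by (simp add: sum.remove)
    moreover have "Poly_Mapping.lookup m k \<noteq> 0"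
      using k by (simp add: in_keys_iff)
    ultimately have 1: "Poly_Mapping.lookup m k = 1"
        and "(\<Sum>i\<in>Poly_Mapping.keys m - {k}. Poly_Mapping.lookup m i) = 0"
      by linarith+
    then have 0: "Poly_Mapping.lookup m i = 0" if "i \<noteq> k" for i
      using that by (metis DiffI finite_Diff finite_keys in_keys_iff singletonD sum_eq_0_iff)
    have "m = affine_monom (Suc k)"
      by (rule poly_mapping_eqI) (use 0 1 in \<open>auto simp: lookup_affine_monom\<close>)
    moreover have "k < n"
      using assms(1) m k by (auto simp: poly_ring_def mpoly_vars_def)
    ultimately show ?thesis
      by blast
  qed
  then have sub: "Poly_Mapping.keys p \<subseteq> affine_monom ` {..<Suc n}"
    by blast
  have "p = (\<Sum>m\<in>affine_monom ` {..<Suc n}. Poly_Mapping.single m (Poly_Mapping.lookup p m))"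
    by (subst poly_mapping_eq_sum_single, rule sum.mono_neutral_left) (use sub in \<open>auto simp: in_keys_iff\<close>)
  then show ?thesis
    by (subst (asm) sum.reindex) (auto simp: inj_on_def inj_affine_monom)
qed

lemma sum_delta_pair:
  fixes c :: "'a::comm_monoid_add"
  assumes "k < (N::nat)" "l < (M::nat)"
  shows "(\<Sum>i<N. \<Sum>j<M. if i = k then if j = l then c else 0 else 0) = c"
proof -
  have "(\<Sum>j<M. if i = k then if j = l then c else 0 else 0) = (if i = k then c else 0)" for i
    using assms(2) by (cases "i = k") simp_all
  then show ?thesis
    using assms(1) by simp
qed

lemma sum_antisymmetric:
  fixes f :: "nat \<Rightarrow> nat \<Rightarrow> 'a::ab_group_add"
  assumes "\<And>i j. i \<noteq> j \<Longrightarrow> f i j + f j i = 0" "\<And>i. f i i = 0"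
  shows "(\<Sum>i<n. \<Sum>j<n. f i j) = 0"
proof (induction n)
  case (Suc n)
  have "(\<Sum>i<Suc n. \<Sum>j<Suc n. f i j) = (\<Sum>i<n. \<Sum>j<n. f i j) + (\<Sum>i<n. f i n + f n i) + f n n"
    by (simp add: sum.distrib algebra_simps)
  also have "(\<Sum>i<n. f i n + f n i) = 0"
    using assms(1) by (intro sum.neutral) auto
  finally show ?case
    using Suc assms(2) by simp
qed simp

text \<open>Let \<open>a\<close> and \<open>b\<close> be the coefficients of \<open>p\<close> and \<open>q\<close>, and write \<open>v i\<close> for the factor by which the
  \<open>i\<close>-th affine monomial is scaled. For \<open>i \<noteq> j\<close>, the product of the \<open>i\<close>-th and the \<open>j\<close>-th affine
  monomial has the coefficient \<open>(v i - v j) * (a i * b j - a j * b i)\<close> in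
  \<open>scaling v p * q - p * scaling v q\<close>. So the invariance of \<open>p / q\<close> only depends on which affine
  monomials are scaled by the same factor.\<close>

lemma scaling_affine_quotient:
  fixes p q :: "'K::field mpol"
  assumes p: "p \<in> poly_ring n" "total_degree p \<le> 1" and q: "q \<in> poly_ring n" "total_degree q \<le> 1"
    and inv: "\<And>v. v \<in> S \<Longrightarrow> scaling v p * q = p * scaling v q"
    and u: "\<And>i j. i \<le> n \<Longrightarrow> j \<le> n \<Longrightarrow>
      (\<And>v. v \<in> S \<Longrightarrow> monom_eval v (affine_monom i) = monom_eval v (affine_monom j)) \<Longrightarrow>
      monom_eval u (affine_monom i) = monom_eval u (affine_monom j)"
  shows "scaling u p * q = p * scaling u q"
proof -
  let ?e = affine_monom
  define a where "a i = (if i \<le> n then Poly_Mapping.lookup p (?e i) else 0)" for i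
  define b where "b i = (if i \<le> n then Poly_Mapping.lookup q (?e i) else 0)" for i
  define f where "f v i j = (monom_eval v (?e i) - monom_eval v (?e j)) * (a i * b j)" for v i j
  have p_eq: "p = (\<Sum>i<Suc n. Poly_Mapping.single (?e i) (a i))"
    unfolding a_def by (subst affine_eq_sum[OF p], rule sum.cong) auto
  have q_eq: "q = (\<Sum>i<Suc n. Poly_Mapping.single (?e i) (b i))"
    unfolding b_def by (subst affine_eq_sum[OF q], rule sum.cong) auto
  have scaling_sum: "scaling v (\<Sum>i<Suc n. Poly_Mapping.single (?e i) (c i)) =
      (\<Sum>i<Suc n. Poly_Mapping.single (?e i) (monom_eval v (?e i) * c i))" for v :: "nat \<Rightarrow> 'K" and c
    by (rule poly_mapping_eqI)
      (auto simp: lookup_scaling lookup_sum lookup_single when_def sum_distrib_left intro!: sum.cong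
        simp del: sum.lessThan_Suc)
  have diff: "scaling v p * q - p * scaling v q =
      (\<Sum>i<Suc n. \<Sum>j<Suc n. Poly_Mapping.single (?e i + ?e j) (f v i j))" for v
  proof -
    have "scaling v p * q = (\<Sum>i<Suc n. \<Sum>j<Suc n.
        Poly_Mapping.single (?e i + ?e j) (monom_eval v (?e i) * a i * b j))"
      by (subst p_eq, subst q_eq) (simp only: scaling_sum sum_product mult_single)
    moreover have "p * scaling v q = (\<Sum>i<Suc n. \<Sum>j<Suc n.
        Poly_Mapping.single (?e i + ?e j) (a i * (monom_eval v (?e j) * b j)))"
      by (subst p_eq, subst q_eq) (simp only: scaling_sum sum_product mult_single)
    moreover have "f v i j = monom_eval v (?e i) * a i * b j - a i * (monom_eval v (?e j) * b j)" for i j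
      by (simp add: f_def algebra_simps)
    ultimately show ?thesis
      by (simp only: single_diff sum_subtractf)
  qed
  have anti: "f u k l + f u l k = 0" if "k \<noteq> l" for k l
  proof (cases "k \<le> n \<and> l \<le> n \<and> (\<exists>v\<in>S. monom_eval v (?e k) \<noteq> monom_eval v (?e l))")
    case True
    then obtain v where v: "v \<in> S" "monom_eval v (?e k) \<noteq> monom_eval v (?e l)"
      by blast
    have *: "?e i + ?e j = ?e k + ?e l \<longleftrightarrow> (i = k \<and> j = l) \<or> (i = l \<and> j = k)" for i j
      using affine_monom_add_eq[of i j k l] by (auto simp: add.commute)
    have "0 = Poly_Mapping.lookup (scaling v p * q - p * scaling v q) (?e k + ?e l)"
      using inv[OF v(1)] by simp
    also have "\<dots> = (\<Sum>i<Suc n. \<Sum>j<Suc n. (if i = k then if j = l then f v k l else 0 else 0) +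
        (if i = l then if j = k then f v l k else 0 else 0))"
      unfolding diff lookup_sum lookup_single when_def *
      by (intro sum.cong refl) (use that in auto)
    also have "\<dots> = f v k l + f v l k"
      using True unfolding sum.distrib by (simp only: sum_delta_pair less_Suc_eq_le)
    also have "\<dots> = (monom_eval v (?e k) - monom_eval v (?e l)) * (a k * b l - a l * b k)"
      by (simp add: f_def algebra_simps)
    finally have "a k * b l = a l * b k"
      using v(2) by simp
    then show ?thesis
      by (simp add: f_def algebra_simps)
  next
    case False
    then consider "k > n" | "l > n" | "monom_eval u (?e k) = monom_eval u (?e l)"
      using u by (metis not_le)
    then show ?thesis
      by cases (simp_all add: f_def a_def b_def)
  qed
  have "scaling u p * q - p * scaling u q = 0"
    unfolding diff
    by (rule sum_antisymmetric) (use anti in \<open>auto simp: add.commute f_def simp flip: single_add\<close>)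
  then show ?thesis
    by simp
qed

text \<open>Such a quotient is, up to constants, a polynomial, the inverse of a polynomial, or a quotient of
  affine polynomials. In the first two cases each single monomial must be fixed.\<close>

lemma scaling_quotient_of_small_degree:
  fixes p q :: "'K::field mpol"
  assumes p: "p \<in> poly_ring n" and q: "q \<in> poly_ring n" "q \<noteq> 0"
    and deg: "total_degree p + total_degree q \<le> d" "d \<le> 2"
    and inv: "\<And>v. v \<in> S \<Longrightarrow> scaling v p * q = p * scaling v q"
    and u1: "\<And>m. Poly_Mapping.keys m \<subseteq> {..<n} \<Longrightarrow>
      (\<Sum>i\<in>Poly_Mapping.keys m. Poly_Mapping.lookup m i) \<le> d \<Longrightarrow>
      (\<And>v. v \<in> S \<Longrightarrow> monom_eval v m = 1) \<Longrightarrow> monom_eval u m = 1"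
    and u2: "\<And>i j. d = 2 \<Longrightarrow> i < n \<Longrightarrow> j < n \<Longrightarrow> (\<And>v. v \<in> S \<Longrightarrow> v i = v j) \<Longrightarrow> u i = u j"
  shows "scaling u p * q = p * scaling u q"
proof -
  have poly_case: "scaling u r = r"
    if r: "r \<in> poly_ring n" "total_degree r \<le> d" "\<And>v. v \<in> S \<Longrightarrow> scaling v r = r" for r
  proof (rule scaling_eq_self_if)
    fix m assume m: "m \<in> Poly_Mapping.keys r"
    show "monom_eval u m = 1"
    proof (rule u1)
      show "Poly_Mapping.keys m \<subseteq> {..<n}"
        using r(1) m by (auto simp: poly_ring_def mpoly_vars_def)
      show "(\<Sum>i\<in>Poly_Mapping.keys m. Poly_Mapping.lookup m i) \<le> d"
        using r(2) m by (simp add: total_degree_le_iff)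
      show "monom_eval v m = 1" if "v \<in> S" for v
        using scaling_eq_selfD[OF r(3)[OF that] m] .
    qed
  qed
  consider "total_degree q = 0" | "total_degree p = 0" | "total_degree p \<le> 1" "total_degree q \<le> 1" "d = 2"
    using deg by linarith
  then show ?thesis
  proof cases
    case 1
    have "scaling v p = p" if "v \<in> S" for v
      using inv[OF that] q(2) by (simp add: scaling_degree_0[OF 1])
    then have "scaling u p = p"
      using poly_case[OF p] deg by simp
    then show ?thesis
      by (simp add: scaling_degree_0[OF 1])
  next
    case 2
    show ?thesis
    proof (cases "p = 0")
      case True
      then show ?thesis
        using scaling_degree_0[OF 2] by simp
    next
      case False
      have "scaling v q = q" if "v \<in> S" for v
        using inv[OF that] False by (simp add: scaling_degree_0[OF 2])
      then have "scaling u q = q"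
        using poly_case[OF q(1)] deg by simp
      then show ?thesis
        by (simp add: scaling_degree_0[OF 2])
    qed
  next
    case 3
    have single: "u i = 1" if "i < n" "\<And>v. v \<in> S \<Longrightarrow> v i = 1" for i
      using u1[of "Poly_Mapping.single i 1"] that 3(3) by simp
    show ?thesis
    proof (rule scaling_affine_quotient[OF p 3(1) q(1) 3(2) inv])
      fix i j assume ij: "i \<le> n" "j \<le> n"
        "\<And>v. v \<in> S \<Longrightarrow> monom_eval v (affine_monom i) = monom_eval v (affine_monom j)"
      show "monom_eval u (affine_monom i) = monom_eval u (affine_monom j)"
      proof (cases i)
        case 0
        then show ?thesis
          using ij(2,3) single[of "j - 1"] by (cases j) (simp_all add: affine_monom_def)
      next
        case (Suc k)
        note i = this
        show ?thesis
        proof (cases j)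
          case 0
          then show ?thesis
            using ij(1,3) single[of k] i by (simp add: affine_monom_def)
        next
          case (Suc l)
          then show ?thesis
            using ij u2[OF 3(3), of k l] i by (simp add: affine_monom_def)
        qed
      qed
    qed
  qed
qed

lemma infinite_UNIV_alg_closed: "infinite (UNIV :: 'a::alg_closed_field set)"
proof
  assume fin: "finite (UNIV :: 'a set)"
  define p :: "'a poly" where "p = 1 + (\<Prod>a\<in>UNIV. [:- a, 1:])"
  have "poly p x = 1" for x
  proof -
    have "\<exists>a\<in>UNIV. poly [:- a, 1:] x = 0"
      by (intro bexI[of _ x]) simp_all
    then have "(\<Prod>a\<in>UNIV. poly [:- a, 1:] x) = 0"
      by (rule prod_zero[OF fin])
    then show ?thesis
      by (simp add: p_def poly_prod)
  qed
  moreover have "Polynomial.degree p > 0"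
  proof -
    have "Polynomial.degree (\<Prod>a\<in>UNIV. [:- a, 1:] :: 'a poly) = card (UNIV :: 'a set)"
      by (subst degree_prod_eq_sum_degree) simp_all
    moreover have "card (UNIV :: 'a set) > 0"
      using fin by (simp add: card_gt_0_iff)
    ultimately show ?thesis
      unfolding p_def by (subst degree_add_eq_right) simp_all
  qed
  ultimately show False
    using alg_closed_imp_poly_has_root[of p] by simp
qed


section \<open>The torus obstruction\<close>

lemma comm_ring_hom_compose:
  assumes "comm_ring_hom f" "comm_ring_hom g"
  shows "comm_ring_hom (\<lambda>x. f (g x))"
proof -
  interpret f: comm_ring_hom f by (rule assms)
  interpret g: comm_ring_hom g by (rule assms)
  show ?thesis
    by standard (simp_all add: f.hom_add g.hom_add f.hom_mult g.hom_mult)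
qed

lemma comm_ring_hom_to_ac: "comm_ring_hom (to_ac :: 'k::field \<Rightarrow> _)"
  by standard simp_all

lemma fract_map_Fract_1:
  assumes "comm_ring_hom h" "inj h"
  shows "fract_map h (Fract p 1) = Fract (h p) 1"
proof -
  interpret h: comm_ring_hom h by (rule assms)
  show ?thesis
    by (simp add: fract_map_Fract[OF assms])
qed

lemma agreement_is_subfield:
  assumes "\<And>t. t \<in> T \<Longrightarrow> comm_ring_hom (\<psi> t) \<and> inj (\<psi> t)" "comm_ring_hom \<phi>" "inj \<phi>"
  shows "is_subfield {f :: 'a::idom fract. \<forall>t\<in>T. fract_map (\<psi> t) f = fract_map \<phi> f}"
proof -
  interpret f: comm_ring_hom "fract_map \<phi>" by (rule comm_ring_hom_fract_map[OF assms(2,3)])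
  have h: "comm_ring_hom (fract_map (\<psi> t))" if "t \<in> T" for t
    using assms(1)[OF that] comm_ring_hom_fract_map by blast
  have inverse: "fract_map (\<psi> t) (inverse x) = inverse (fract_map (\<psi> t) x)" if "t \<in> T" for t x
    using assms(1)[OF that] fract_map_inverse by blast
  show ?thesis
  proof (rule is_subfieldI; unfold mem_Collect_eq; intro ballI)
    fix t assume t: "t \<in> T"
    interpret g: comm_ring_hom "fract_map (\<psi> t)" by (rule h[OF t])
    show "fract_map (\<psi> t) 0 = fract_map \<phi> 0" "fract_map (\<psi> t) 1 = fract_map \<phi> 1"
      by simp_all
    fix x assume x: "\<forall>t\<in>T. fract_map (\<psi> t) x = fract_map \<phi> x"
    show "fract_map (\<psi> t) (- x) = fract_map \<phi> (- x)"
      using x t by (simp add: g.hom_uminus f.hom_uminus)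
    show "fract_map (\<psi> t) (inverse x) = fract_map \<phi> (inverse x)"
      using x t by (simp add: inverse fract_map_inverse[OF assms(2,3)])
    fix y assume y: "\<forall>t\<in>T. fract_map (\<psi> t) y = fract_map \<phi> y"
    show "fract_map (\<psi> t) (x + y) = fract_map \<phi> (x + y)"
      using x y t by (simp add: g.hom_add f.hom_add)
    show "fract_map (\<psi> t) (x * y) = fract_map \<phi> (x * y)"
      using x y t by (simp add: g.hom_mult f.hom_mult)
  qed
qed

text \<open>As the homomorphisms agree on the coefficients of a polynomial with the root \<open>x\<close>, they send \<open>x\<close> to
  roots of one and the same polynomial.\<close>

lemma finite_images_of_algebraic:
  assumes K: "is_subfield K" and x: "algebraic_over K (x :: 'a::field)"
    and \<psi>: "\<And>t. t \<in> T \<Longrightarrow> comm_ring_hom (\<psi> t)" "comm_ring_hom \<phi>"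
    and agree: "\<And>t y. t \<in> T \<Longrightarrow> y \<in> K \<Longrightarrow> \<psi> t y = \<phi> y"
    and inj: "\<And>y. \<phi> y = 0 \<Longrightarrow> y = 0"
  shows "finite ((\<lambda>t. \<psi> t x :: 'b::field) ` T)"
proof -
  obtain R where R: "R \<noteq> 0" "\<And>i. Polynomial.coeff R i \<in> K" "poly R x = 0"
    using algebraic_over_iff[OF K] x by blast
  interpret f: comm_ring_hom \<phi> by (rule \<psi>(2))
  have "map_poly \<phi> R \<noteq> 0"
    using R(1) inj by (metis coeff_map_poly coeff_0 f.hom_zero poly_eqI)
  moreover have "poly (map_poly \<phi> R) (\<psi> t x) = 0" if "t \<in> T" for t
  proof -
    interpret g: comm_ring_hom "\<psi> t" by (rule \<psi>(1)[OF that])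
    have "map_poly \<phi> R = map_poly (\<psi> t) R"
      by (rule poly_eqI) (simp add: coeff_map_poly agree that R(2))
    then show ?thesis
      by (simp only: g.poly_map_poly R(3) g.hom_zero)
  qed
  ultimately show ?thesis
    by (intro finite_subset[OF _ poly_roots_finite]) auto
qed

lemma invertible_matE:
  assumes "P \<in> carrier_mat n n" "invertible_mat P"
  obtains P' where "P' \<in> carrier_mat n n" "P * P' = 1\<^sub>m n" "P' * P = 1\<^sub>m n"
proof -
  obtain P' where P': "P * P' = 1\<^sub>m (dim_row P)" "P' * P = 1\<^sub>m (dim_row P')"
    using assms(2) by (auto simp: invertible_mat_def inverts_mat_def)
  have "dim_col (P * P') = n" "dim_col (P' * P) = dim_row P'"
    using assms(1) by (simp_all only: P') simp_all
  then have "P' \<in> carrier_mat n n"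
    using assms(1) by auto
  then show thesis
    using that P' assms(1) by simp
qed

context abelian_rep
begin

text \<open>The columns of \<open>P\<close> are common eigenvectors, so the action becomes diagonal in the coordinates
  that \<open>P\<close> defines. The inverse of \<open>g\<close> appears because the action on functions is contragredient.\<close>

lemma base_subst_act_poly:
  assumes P: "char_decomposition G scale bs \<rho> P \<chi>s" and g: "g \<in> carrier G" and p: "p \<in> poly_ring n"
  shows "base_subst to_ac n P (act_poly g p) =
    scaling (\<lambda>i. (\<chi>s ! i) (inv g)) (base_subst to_ac n P p)"
proof -
  let ?A = "map_mat to_ac (mat_of (inv g))" and ?v = "\<lambda>i. (\<chi>s ! i) (inv g)"
  interpret s: comm_ring_hom "scaling ?v" by (rule comm_ring_hom_scaling)
  have Pc: "P \<in> carrier_mat n n"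
    using P by (simp add: char_decomposition_def)
  have eigen: "(?A * P) $$ (i, k) = ?v k * P $$ (i, k)" if ik: "i < n" "k < n" for i k
  proof -
    have "?A *\<^sub>v col P k = ?v k \<cdot>\<^sub>v col P k"
      using P ik g by (simp add: char_decomposition_def mat_of_def)
    then have "(?A *\<^sub>v col P k) $ i = (?v k \<cdot>\<^sub>v col P k) $ i"
      by simp
    then show ?thesis
      using ik Pc by simp
  qed
  have "base_subst to_ac n P (act_poly g p) = base_subst to_ac n (?A * P) p"
    using p by (simp add: act_poly_eq base_subst_comp[OF comm_ring_hom_to_ac _ Pc])
  also have "\<dots> = mpoly_eval (\<lambda>a. mconst (to_ac a))
      (\<lambda>i. scaling ?v (if i < n then linear_form n (\<lambda>j. P $$ (i, j)) else mvar i)) p"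
    unfolding base_subst_def
  proof (rule mpoly_eval_cong)
    fix i assume "i \<in> mpoly_vars p"
    then have i: "i < n"
      using p by (auto simp: poly_ring_def)
    have "linear_form n (\<lambda>j. (?A * P) $$ (i, j)) = linear_form n (\<lambda>k. ?v k * P $$ (i, k))"
      by (rule linear_form_cong) (rule eigen[OF i])
    then show "(if i < n then linear_form n (\<lambda>j. (?A * P) $$ (i, j)) else mvar i) =
        scaling ?v (if i < n then linear_form n (\<lambda>j. P $$ (i, j)) else mvar i)"
      using i by (simp only: scaling_linear_form if_True)
  qed
  also have "\<dots> = scaling ?v (base_subst to_ac n P p)"
    by (simp add: base_subst_def s.hom_mpoly_eval scaling_mconst)
  finally show ?thesis .
qed

text \<open>The field of all rational functions is algebraic over the invariants, which are algebraic over
  the transcendence basis.\<close>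

lemma algebraic_over_transcendence_basis:
  assumes B: "transcendence_basis ratfun_const (invariant_ratfuns G scale bs \<rho>) B" and i: "i < n"
  shows "algebraic_over (adjoin ratfun_const B) (Fract (mvar i) 1)"
proof -
  obtain Q where Q: "Q \<noteq> 0" "poly Q (Fract (mvar i) 1) = 0"
      "\<And>j. Polynomial.coeff Q j \<in> invariant_ratfuns G scale bs \<rho>"
    using mvar_root_of_invariant_polynomial[OF i] by blast
  show ?thesis
    by (rule algebraic_over_root[OF is_subfield_adjoin Q(1) _ Q(2)])
      (use B Q(3) in \<open>auto simp: transcendence_basis_def\<close>)
qed

text \<open>The scalings \<open>u t\<close> form an infinite family that fixes every invariant of degree at most \<open>d\<close>: the
  hypotheses on \<open>u\<close> say that a monomial of degree at most \<open>d\<close> with trivial character is fixed, and, for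
  \<open>d = 2\<close>, that variables with the same character are scaled alike. If such invariants contained a
  transcendence basis, then every coordinate function would be algebraic over a field on which all
  scalings agree, and would have only finitely many images. But a coordinate function in which the
  eigencoordinate \<open>k0\<close> occurs has infinitely many, because \<open>k0\<close> is scaled by \<open>t\<close> itself.\<close>

lemma no_transcendence_basis_of_small_degree:
  assumes P: "char_decomposition G scale bs \<rho> P \<chi>s" and "d \<le> 2"
    and u0: "\<And>t k. t \<noteq> 0 \<Longrightarrow> u t k \<noteq> (0 :: 'k alg_closure)"
    and u1: "\<And>t m. t \<noteq> 0 \<Longrightarrow> Poly_Mapping.keys m \<subseteq> {..<n} \<Longrightarrow>
      (\<Sum>i\<in>Poly_Mapping.keys m. Poly_Mapping.lookup m i) \<le> d \<Longrightarrow>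
      (\<And>g. g \<in> carrier G \<Longrightarrow> monom_eval (\<lambda>i. (\<chi>s ! i) g) m = 1) \<Longrightarrow> monom_eval (u t) m = 1"
    and u2: "\<And>t i j. t \<noteq> 0 \<Longrightarrow> d = 2 \<Longrightarrow> i < n \<Longrightarrow> j < n \<Longrightarrow>
      (\<And>g. g \<in> carrier G \<Longrightarrow> (\<chi>s ! i) g = (\<chi>s ! j) g) \<Longrightarrow> u t i = u t j"
    and k0: "k0 < n" "\<And>t. t \<noteq> 0 \<Longrightarrow> u t k0 = t"
    and B: "B \<subseteq> invariant_ratfuns_le G scale bs \<rho> d"
      "transcendence_basis ratfun_const (invariant_ratfuns G scale bs \<rho>) B"
  shows False
proof -
  have Pc: "P \<in> carrier_mat n n" and "invertible_mat P"
    using P by (simp_all add: char_decomposition_def)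
  then obtain P' where P': "P' \<in> carrier_mat n n" "P * P' = 1\<^sub>m n" "P' * P = 1\<^sub>m n"
    by (rule invertible_matE)
  note P'c = P'(1) and PP' = P'(2) and P'P = P'(3)
  define \<phi> where "\<phi> = base_subst to_ac n P"
  define \<psi> where "\<psi> t p = scaling (u t) (\<phi> p)" for t p
  have \<phi>: "comm_ring_hom \<phi>" "inj \<phi>"
    unfolding \<phi>_def
    by (rule comm_ring_hom_base_subst[OF comm_ring_hom_to_ac],
        rule inj_base_subst[OF comm_ring_hom_to_ac inj_to_ac Pc P'c PP'])
  have \<psi>: "comm_ring_hom (\<psi> t)" "inj (\<psi> t)" if "t \<noteq> 0" for t
    unfolding \<psi>_def[abs_def] using comm_ring_hom_compose[OF comm_ring_hom_scaling \<phi>(1)]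
      inj_compose[OF inj_scaling \<phi>(2)] u0[OF that] by (auto simp: comp_def)
  define T :: "'k alg_closure set" where "T = - {0}"
  define K where "K = {f. \<forall>t\<in>T. fract_map (\<psi> t) f = fract_map \<phi> f}"
  have "is_subfield K"
    unfolding K_def by (rule agreement_is_subfield) (use \<phi> \<psi> in \<open>auto simp: T_def\<close>)
  moreover have "range ratfun_const \<subseteq> K"
  proof -
    have "\<psi> t (mconst a) = \<phi> (mconst a)" for t a
      by (simp add: \<psi>_def \<phi>_def scaling_mconst base_subst_mconst[OF comm_ring_hom_to_ac])
    then have "fract_map (\<psi> t) (ratfun_const a) = fract_map \<phi> (ratfun_const a)" if "t \<noteq> 0" for t a
      unfolding ratfun_const_def fract_map_Fract_1[OF \<phi>] fract_map_Fract_1[OF \<psi>[OF that]] by simp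
    then show ?thesis
      by (auto simp: K_def T_def)
  qed
  moreover have "B \<subseteq> K"
  proof
    fix f assume "f \<in> B"
    then have f: "f \<in> invariant_ratfuns G scale bs \<rho>" "f \<in> ratfuns n" "ratfun_degree n f \<le> d"
      using B(1) by (auto simp: invariant_ratfuns_le_def invariant_ratfuns_def)
    obtain p q where pq: "p \<in> poly_ring n" "q \<in> poly_ring n" "q \<noteq> 0" "f = Fract p q"
        "total_degree p + total_degree q \<le> d"
      using ratfun_degree_leE[OF f(2,3)] by blast
    have "scaling (u t) (\<phi> p) * \<phi> q = \<phi> p * scaling (u t) (\<phi> q)" if t: "t \<noteq> 0" for t
    proof (rule scaling_quotient_of_small_degree)
      show "\<phi> p \<in> poly_ring n" "\<phi> q \<in> poly_ring n"
        using pq by (simp_all add: \<phi>_def base_subst_mem_poly_ring)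
      show "\<phi> q \<noteq> 0"
        using pq(3) inj_hom_eq_0_iff[OF \<phi>] by simp
      show "total_degree (\<phi> p) + total_degree (\<phi> q) \<le> d"
        using pq(5) total_degree_base_subst[of to_ac n P p] total_degree_base_subst[of to_ac n P q]
        by (simp add: \<phi>_def)
      fix v assume "v \<in> (\<lambda>g i. (\<chi>s ! i) g) ` carrier G"
      then obtain g where g: "g \<in> carrier G" "v = (\<lambda>i. (\<chi>s ! i) g)"
        by blast
      have eq: "\<phi> (act_poly (inv g) r) = scaling v (\<phi> r)" if "r \<in> poly_ring n" for r
        using base_subst_act_poly[OF P, of "inv g" r] g that by (simp add: \<phi>_def)
      interpret \<phi>: comm_ring_hom \<phi> by (rule \<phi>(1))
      have "act_poly (inv g) p * q = p * act_poly (inv g) q"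
        using f(1) pq g invariant_Fract_iff[OF pq(1-3)] by simp
      then have "\<phi> (act_poly (inv g) p) * \<phi> q = \<phi> p * \<phi> (act_poly (inv g) q)"
        by (simp flip: \<phi>.hom_mult)
      then show "scaling v (\<phi> p) * \<phi> q = \<phi> p * scaling v (\<phi> q)"
        by (simp only: eq pq)
    next
      fix m assume "Poly_Mapping.keys m \<subseteq> {..<n}"
        "(\<Sum>i\<in>Poly_Mapping.keys m. Poly_Mapping.lookup m i) \<le> d"
        "\<And>v. v \<in> (\<lambda>g i. (\<chi>s ! i) g) ` carrier G \<Longrightarrow> monom_eval v m = 1"
      then show "monom_eval (u t) m = 1"
        by (intro u1[OF t]) auto
    next
      fix i j assume "d = 2" "i < n" "j < n"
        "\<And>v. v \<in> (\<lambda>g i. (\<chi>s ! i) g) ` carrier G \<Longrightarrow> v i = v j"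
      then show "u t i = u t j"
        by (intro u2[OF t]) auto
    qed fact
    then have "fract_map (\<psi> t) f = fract_map \<phi> f" if "t \<noteq> 0" for t
      using that pq(3) inj_hom_eq_0_iff[OF \<phi>] inj_hom_eq_0_iff[OF \<psi>[OF that]]
      unfolding pq(4) fract_map_Fract[OF \<phi> pq(3)] fract_map_Fract[OF \<psi>[OF that] pq(3)]
      by (simp add: eq_fract flip: \<psi>_def)
    then show "f \<in> K"
      by (simp add: K_def T_def)
  qed
  ultimately have K: "adjoin ratfun_const B \<subseteq> K"
    by (rule adjoin_subset)
  obtain i where i: "i < n" "P $$ (i, k0) \<noteq> 0"
  proof (rule ccontr)
    assume "\<not> thesis"
    then have "\<forall>i<n. P $$ (i, k0) = 0"
      using that by blast
    then have "(P' * P) $$ (k0, k0) = 0"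
      using k0(1) Pc P'c by (simp add: scalar_prod_def)
    then show False
      using k0(1) by (simp add: P'P)
  qed
  let ?x = "Fract (mvar i) 1 :: 'k mpol fract"
  have "finite ((\<lambda>t. fract_map (\<psi> t) ?x) ` T)"
  proof (rule finite_images_of_algebraic[where \<phi> = "fract_map \<phi>"])
    show "is_subfield (adjoin ratfun_const B)"
      by (rule is_subfield_adjoin)
    show "algebraic_over (adjoin ratfun_const B) ?x"
      by (rule algebraic_over_transcendence_basis[OF B(2) i(1)])
    show "comm_ring_hom (fract_map \<phi>)"
      by (rule comm_ring_hom_fract_map[OF \<phi>])
    show "y = 0" if "fract_map \<phi> y = 0" for y
    proof (cases y)
      case (Fract a b)
      have "\<phi> a = 0"
        using that Fract inj_hom_eq_0_iff[OF \<phi>]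
        by (simp add: fract_map_Fract[OF \<phi>] Zero_fract_def eq_fract)
      then show ?thesis
        using Fract inj_hom_eq_0_iff[OF \<phi>] by (simp add: Zero_fract_def eq_fract)
    qed
  next
    fix t assume t: "t \<in> T"
    then show "comm_ring_hom (fract_map (\<psi> t))"
      using \<psi> by (intro comm_ring_hom_fract_map) (auto simp: T_def)
    fix y assume "y \<in> adjoin ratfun_const B"
    with K t show "fract_map (\<psi> t) y = fract_map \<phi> y"
      by (auto simp: K_def)
  qed
  moreover have "inj_on (\<lambda>t. fract_map (\<psi> t) ?x) T"
  proof (rule inj_onI)
    fix s t assume st: "s \<in> T" "t \<in> T" "fract_map (\<psi> s) ?x = fract_map (\<psi> t) ?x"
    have \<psi>_mvar: "\<psi> r (mvar i) = linear_form n (\<lambda>k. u r k * P $$ (i, k))" for r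
      by (simp add: \<psi>_def \<phi>_def base_subst_mvar[OF comm_ring_hom_to_ac i(1)] scaling_linear_form)
    have "fract_map (\<psi> r) ?x = Fract (\<psi> r (mvar i)) 1" if "r \<in> T" for r
      by (rule fract_map_Fract_1) (use that \<psi> in \<open>auto simp: T_def\<close>)
    then have "\<psi> s (mvar i) = \<psi> t (mvar i)"
      using st by (simp add: inj_Fract_1)
    then have "u s k0 * P $$ (i, k0) = u t k0 * P $$ (i, k0)"
      using lookup_linear_form[OF k0(1)] by (metis \<psi>_mvar)
    then show "s = t"
      using i(2) k0(2) st by (simp add: T_def)
  qed
  moreover have "infinite T"
    unfolding T_def Compl_eq_Diff_UNIV using infinite_UNIV_alg_closed by (simp add: infinite_remove)
  ultimately show False
    using finite_imageD by blast
qed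

end


section \<open>Common eigenforms of commuting operators of finite order\<close>

text \<open>Some root of unity \<open>\<zeta>\<close> satisfies \<open>\<zeta> ^ k \<noteq> 1\<close>, because \<open>X ^ k - 1\<close> has at most \<open>k\<close> roots, and
  multiplication by \<open>\<zeta>\<close> permutes the summands.\<close>

lemma sum_powers_of_roots_of_unity:
  fixes N :: nat
  assumes roots: "card {z :: 'K::field. z ^ N = 1} = N" and k: "0 < k" "k < N"
  shows "(\<Sum>z | z ^ N = 1. inverse z ^ k) = (0 :: 'K)"
proof -
  let ?R = "{z :: 'K. z ^ N = 1}"
  have fin: "finite ?R"
    using roots k by (metis card.infinite not_less_zero)
  have "\<exists>\<zeta>\<in>?R. \<zeta> ^ k \<noteq> 1"
  proof (rule ccontr)
    assume "\<not> ?thesis"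
    then have sub: "?R \<subseteq> {z. poly (Polynomial.monom 1 k - 1) z = 0}"
      by (auto simp: poly_monom)
    have coeff: "Polynomial.coeff (Polynomial.monom 1 k - 1 :: 'K poly) k = 1"
      using k by simp
    then have nz: "Polynomial.monom 1 k - 1 \<noteq> (0 :: 'K poly)"
      by (metis coeff_0 zero_neq_one)
    have "card ?R \<le> card {z. poly (Polynomial.monom 1 k - 1 :: 'K poly) z = 0}"
      by (rule card_mono[OF poly_roots_finite[OF nz] sub])
    also have "\<dots> \<le> Polynomial.degree (Polynomial.monom 1 k - 1 :: 'K poly)"
      by (rule card_poly_roots_bound[OF nz])
    also have "\<dots> \<le> k"
      by (intro degree_diff_le degree_monom_le) simp
    finally show False
      using roots k by simp
  qed
  then obtain \<zeta> :: 'K where \<zeta>: "\<zeta> ^ N = 1" "\<zeta> ^ k \<noteq> 1"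
    by blast
  have "\<zeta> \<noteq> 0"
    using \<zeta>(1) k by (auto simp: power_0_left)
  have inv_k: "inverse \<zeta> ^ k \<noteq> 1"
    using \<zeta>(2) by (metis inverse_1 inverse_inverse_eq power_inverse)
  have "inverse \<zeta> ^ k * (\<Sum>z\<in>?R. inverse z ^ k) = (\<Sum>z\<in>?R. inverse (\<zeta> * z) ^ k)"
    by (simp add: sum_distrib_left power_mult_distrib)
  also have "\<dots> = (\<Sum>z\<in>?R. inverse z ^ k)"
  proof (rule sum.reindex_bij_betw[where h = "\<lambda>z. \<zeta> * z"])
    show "bij_betw ((*) \<zeta>) ?R ?R"
      using \<zeta>(1) \<open>\<zeta> \<noteq> 0\<close>
      by (intro bij_betwI[where g = "\<lambda>z. inverse \<zeta> * z"])
        (auto simp: power_mult_distrib power_inverse field_simps)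
  qed
  finally have "(inverse \<zeta> ^ k - 1) * (\<Sum>z\<in>?R. inverse z ^ k) = 0"
    by (simp add: left_diff_distrib)
  then show ?thesis
    using inv_k by simp
qed

text \<open>The projection to the eigenspace for the eigenvalue \<open>z\<close>, for an operator whose \<open>N\<close>-th power is the
  identity.\<close>

definition eigen_part :: "('K::field mpol \<Rightarrow> 'K mpol) \<Rightarrow> nat \<Rightarrow> 'K \<Rightarrow> 'K mpol \<Rightarrow> 'K mpol" where
  "eigen_part \<alpha> N z l = (\<Sum>k<N. mconst (inverse z ^ k / of_nat N) * (\<alpha> ^^ k) l)"

lemma sum_eigen_part:
  fixes l :: "'K::field mpol"
  assumes roots: "card {z :: 'K. z ^ N = 1} = N" and N: "N > 0" "of_nat N \<noteq> (0 :: 'K)"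
  shows "(\<Sum>z | z ^ N = 1. eigen_part \<alpha> N z l) = l"
proof -
  interpret m: comm_ring_hom "mconst :: 'K \<Rightarrow> _" by (rule comm_ring_hom_mconst)
  have "(\<Sum>z | z ^ N = 1. eigen_part \<alpha> N z l) =
      (\<Sum>k<N. mconst ((\<Sum>z | z ^ N = 1. inverse z ^ k) / of_nat N) * (\<alpha> ^^ k) l)"
    unfolding eigen_part_def
    by (subst sum.swap) (simp add: sum_distrib_right m.hom_sum sum_divide_distrib)
  also have "\<dots> = (\<Sum>k<N. if k = 0 then l else 0)"
  proof (rule sum.cong)
    fix k assume "k \<in> {..<N}"
    then show "mconst ((\<Sum>z | z ^ N = 1. inverse z ^ k) / of_nat N) * (\<alpha> ^^ k) l = (if k = 0 then l else 0)"
      using sum_powers_of_roots_of_unity[OF roots, of k] roots N by (cases "k = 0") simp_all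
  qed simp
  also have "\<dots> = l"
    using N by simp
  finally show ?thesis .
qed

context
  fixes \<alpha> :: "'K::field mpol \<Rightarrow> 'K mpol"
  assumes hom: "comm_ring_hom \<alpha>" and const: "\<And>c. \<alpha> (mconst c) = mconst c"
begin

interpretation \<alpha>: comm_ring_hom \<alpha> by (rule hom)
interpretation m: comm_ring_hom "mconst :: 'K \<Rightarrow> _" by (rule comm_ring_hom_mconst)

lemma eigen_part_is_eigen:
  assumes l: "(\<alpha> ^^ N) l = l" and z: "z ^ N = 1" and N: "N > 0"
  shows "\<alpha> (eigen_part \<alpha> N z l) = mconst z * eigen_part \<alpha> N z l"
proof -
  have z0: "z \<noteq> 0"
    using z N by (auto simp: power_0_left)
  let ?f = "\<lambda>k. mconst (inverse z ^ k / of_nat N) * (\<alpha> ^^ k) l"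
  obtain M where M: "N = Suc M"
    using N by (cases N) auto
  have "\<alpha> (eigen_part \<alpha> N z l) = (\<Sum>k<N. mconst z * ?f (Suc k))"
    unfolding eigen_part_def \<alpha>.hom_sum \<alpha>.hom_mult const
    by (rule sum.cong) (use z0 in \<open>simp_all add: mult.assoc[symmetric] flip: m.hom_mult\<close>)
  also have "\<dots> = mconst z * (\<Sum>k<N. ?f (Suc k))"
    by (simp add: sum_distrib_left)
  also have "(\<Sum>k<N. ?f (Suc k)) = (\<Sum>k<M. ?f (Suc k)) + ?f N"
    by (simp add: M)
  also have "?f N = ?f 0"
    using l z by (simp add: power_inverse)
  also have "(\<Sum>k<M. ?f (Suc k)) + ?f 0 = (\<Sum>k<N. ?f k)"
    unfolding M sum.lessThan_Suc_shift by (simp add: add.commute)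
  finally show ?thesis
    by (simp add: eigen_part_def)
qed

lemma eigen_part_keeps_eigen:
  assumes comm: "\<And>k. \<alpha> ((\<beta> ^^ k) l) = (\<beta> ^^ k) (\<alpha> l)" and l: "\<alpha> l = mconst c * l"
    and \<beta>: "\<And>x. \<beta> (mconst c * x) = mconst c * \<beta> x"
  shows "\<alpha> (eigen_part \<beta> N z l) = mconst c * eigen_part \<beta> N z l"
proof -
  have pow: "(\<beta> ^^ k) (mconst c * l) = mconst c * (\<beta> ^^ k) l" for k
    by (induction k) (simp_all add: \<beta>)
  show ?thesis
    unfolding eigen_part_def \<alpha>.hom_sum \<alpha>.hom_mult const comm l pow
    by (simp add: sum_distrib_left mult_ac)
qed

end

text \<open>The projections to the eigenspaces of one operator after the other split a form into common
  eigenforms, so that an additive property of forms can be checked on these.\<close>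

lemma eigenform_induct:
  fixes \<alpha> :: "'i \<Rightarrow> 'K::field mpol \<Rightarrow> 'K mpol" and L :: "'K mpol set"
  assumes fin: "finite I"
    and \<alpha>: "\<And>i. i \<in> I \<Longrightarrow> comm_ring_hom (\<alpha> i)" "\<And>i c. i \<in> I \<Longrightarrow> \<alpha> i (mconst c) = mconst c"
    and L: "0 \<in> L" "\<And>x y. x \<in> L \<Longrightarrow> y \<in> L \<Longrightarrow> x + y \<in> L" "\<And>c x. x \<in> L \<Longrightarrow> mconst c * x \<in> L"
      "\<And>i x. i \<in> I \<Longrightarrow> x \<in> L \<Longrightarrow> \<alpha> i x \<in> L"
    and comm: "\<And>i j x. i \<in> I \<Longrightarrow> j \<in> I \<Longrightarrow> x \<in> L \<Longrightarrow> \<alpha> i (\<alpha> j x) = \<alpha> j (\<alpha> i x)"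
    and ord: "\<And>i x. i \<in> I \<Longrightarrow> x \<in> L \<Longrightarrow> (\<alpha> i ^^ N) x = x"
    and roots: "card {z :: 'K. z ^ N = 1} = N" and N: "N > 0" "of_nat N \<noteq> (0 :: 'K)"
    and Q: "Q 0" "\<And>x y. x \<in> L \<Longrightarrow> y \<in> L \<Longrightarrow> Q x \<Longrightarrow> Q y \<Longrightarrow> Q (x + y)"
      "\<And>x. x \<in> L \<Longrightarrow> (\<And>i. i \<in> I \<Longrightarrow> \<exists>c. c ^ N = 1 \<and> \<alpha> i x = mconst c * x) \<Longrightarrow> Q x"
    and l: "l \<in> L"
  shows "Q l"
proof -
  have sum_L: "sum f A \<in> L" if "\<And>a. a \<in> A \<Longrightarrow> f a \<in> L" for f and A :: "'b set"
    using that by (induction A rule: infinite_finite_induct) (auto intro: L)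
  have pow_L: "(\<alpha> i ^^ k) x \<in> L" if "i \<in> I" "x \<in> L" for i k x
    by (induction k) (use that L(4) in auto)
  have part_L: "eigen_part (\<alpha> i) N z x \<in> L" if "i \<in> I" "x \<in> L" for i z x
    unfolding eigen_part_def
    by (induction rule: infinite_finite_induct[of _ "{..<N}"]) (auto intro: L pow_L that)
  have *: "Q x" if "finite J" "J \<subseteq> I" "x \<in> L"
    "\<And>i. i \<in> I - J \<Longrightarrow> \<exists>c. c ^ N = 1 \<and> \<alpha> i x = mconst c * x" for J x
    using that
  proof (induction J arbitrary: x rule: finite_induct)
    case empty
    then show ?case
      by (intro Q(3)) auto
  next
    case (insert j J)
    have j: "j \<in> I"
      using insert.prems by auto
    have part: "Q (eigen_part (\<alpha> j) N z x)" if z: "z ^ N = 1" for z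
    proof (rule insert.IH)
      show "J \<subseteq> I" "eigen_part (\<alpha> j) N z x \<in> L"
        using insert.prems part_L j by auto
      fix i assume i: "i \<in> I - J"
      show "\<exists>c. c ^ N = 1 \<and> \<alpha> i (eigen_part (\<alpha> j) N z x) = mconst c * eigen_part (\<alpha> j) N z x"
      proof (cases "i = j")
        case True
        then show ?thesis
          using eigen_part_is_eigen[OF \<alpha>(1,2)[OF j] ord[OF j insert.prems(2)] z N(1)] z by blast
      next
        case False
        then obtain c where c: "c ^ N = 1" "\<alpha> i x = mconst c * x"
          using insert.prems(3)[of i] i by auto
        have "\<alpha> i ((\<alpha> j ^^ k) x) = (\<alpha> j ^^ k) (\<alpha> i x)" for k
          using i j comm[of i j] pow_L[OF j insert.prems(2)] by (induction k) simp_all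
        moreover have "\<alpha> j (mconst c * y) = mconst c * \<alpha> j y" for y
        proof -
          interpret a: comm_ring_hom "\<alpha> j" by (rule \<alpha>(1)[OF j])
          show ?thesis
            by (simp add: a.hom_mult \<alpha>(2)[OF j])
        qed
        ultimately have "\<alpha> i (eigen_part (\<alpha> j) N z x) = mconst c * eigen_part (\<alpha> j) N z x"
          using i by (intro eigen_part_keeps_eigen \<alpha> c(2)) auto
        with c(1) show ?thesis
          by blast
      qed
    qed
    have "Q (\<Sum>z\<in>R. eigen_part (\<alpha> j) N z x) \<and> (\<Sum>z\<in>R. eigen_part (\<alpha> j) N z x) \<in> L"
      if "finite R" "R \<subseteq> {z. z ^ N = 1}" for R
      using that
    proof (induction R rule: finite_induct)
      case (insert z R)
      then show ?case
        using part[of z] part_L[OF j \<open>x \<in> L\<close>, of z] Q(2) L(2) by simp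
    qed (use Q L in simp)
    moreover have "finite {z :: 'K. z ^ N = 1}"
      using roots N by (metis card.infinite not_less_zero)
    ultimately show ?case
      using sum_eigen_part[OF roots N, of "\<alpha> j" x] by (metis order_refl)
  qed
  show ?thesis
    using *[OF fin order_refl l] by simp
qed


section \<open>Transcendence bases of invariants\<close>

lemma linear_form_range_closed:
  shows "0 \<in> range (linear_form n :: _ \<Rightarrow> 'K::field mpol)"
    "x \<in> range (linear_form n) \<Longrightarrow> y \<in> range (linear_form n) \<Longrightarrow> x + y \<in> range (linear_form n :: _ \<Rightarrow> 'K::field mpol)"
    "x \<in> range (linear_form n) \<Longrightarrow> mconst a * x \<in> range (linear_form n :: _ \<Rightarrow> 'K::field mpol)"
    "x \<in> range (linear_form n) \<Longrightarrow> base_subst (\<lambda>a. a) n A x \<in> range (linear_form n :: _ \<Rightarrow> 'K::field mpol)"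
proof -
  have "linear_form n (\<lambda>_. 0) = (0 :: 'K::field mpol)"
    by (simp add: linear_form_def mconst_def)
  then show "0 \<in> range (linear_form n :: _ \<Rightarrow> 'K::field mpol)"
    by (metis rangeI)
qed (auto simp: linear_form_add mconst_mult_linear_form base_subst_linear_form[OF comm_ring_hom_id])

context abelian_rep
begin

lemma ratfuns_subset_subfield:
  assumes K: "is_subfield K" "range ratfun_const \<subseteq> K" "\<And>i. i < n \<Longrightarrow> Fract (mvar i) 1 \<in> K"
  shows "ratfuns n \<subseteq> (K :: 'k mpol fract set)"
proof -
  interpret F: comm_ring_hom "\<lambda>a. Fract a 1 :: 'k mpol fract" by (rule comm_ring_hom_Fract_1)
  note S = is_subfieldD[OF K(1)]
  have poly: "Fract p 1 \<in> K" if p: "p \<in> poly_ring n" for p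
  proof -
    have "Fract p 1 = Fract (mpoly_eval mconst mvar p) 1"
      by (simp only: mpoly_eval_mconst_mvar)
    also have "\<dots> = mpoly_eval ratfun_const (\<lambda>i. Fract (mvar i) 1) p"
      by (simp only: F.hom_mpoly_eval ratfun_const_def[abs_def])
    also have "\<dots> \<in> K"
      unfolding mpoly_eval_def
    proof (intro S(7) S(4) S(6) S(5) finite_keys)
      show "ratfun_const (Poly_Mapping.lookup p m) \<in> K" for m
        using K(2) by blast
      fix m i assume "m \<in> Poly_Mapping.keys p" "i \<in> Poly_Mapping.keys m"
      then have "i < n"
        using p by (auto simp: poly_ring_def mpoly_vars_def)
      then show "Fract (mvar i) 1 \<in> K"
        by (rule K(3))
    qed
    finally show ?thesis .
  qed
  show ?thesis
  proof
    fix f :: "'k mpol fract" assume "f \<in> ratfuns n"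
    then obtain p q where pq: "f = Fract p q" "p \<in> poly_ring n" "q \<in> poly_ring n"
      by (auto simp: ratfuns_def)
    have "f = Fract p 1 * inverse (Fract q 1)"
      by (simp add: pq(1))
    then show "f \<in> K"
      using S(4)[OF poly[OF pq(2)] S(9)[OF poly[OF pq(3)]]] by simp
  qed
qed

text \<open>Finiteness of \<open>S\<close> provides a maximal independent subset, over which all variables, hence all
  rational functions, are algebraic.\<close>

lemma transcendence_basis_from_finite_set:
  assumes S: "finite S" "S \<subseteq> invariant_ratfuns_le G scale bs \<rho> d"
    and alg: "\<And>K i. is_subfield K \<Longrightarrow> \<forall>s\<in>S. algebraic_over K s \<Longrightarrow> i < n \<Longrightarrow>
      algebraic_over K (Fract (mvar i) 1)"
  shows "\<exists>B\<subseteq>invariant_ratfuns_le G scale bs \<rho> d.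
    transcendence_basis ratfun_const (invariant_ratfuns G scale bs \<rho>) B"
proof -
  obtain B where B: "B \<subseteq> S" "alg_independent ratfun_const B"
      "\<And>s. s \<in> S \<Longrightarrow> algebraic_over (adjoin ratfun_const B) s"
    using exists_transcendence_basis_subset[OF comm_ring_hom_ratfun_const S(1)] by blast
  let ?K = "adjoin ratfun_const B"
  have K: "is_subfield ?K"
    by (rule is_subfield_adjoin)
  have "ratfuns n \<subseteq> {f. algebraic_over ?K f}"
  proof (rule ratfuns_subset_subfield[OF is_subfield_algebraic_over[OF K]])
    show "range ratfun_const \<subseteq> {f. algebraic_over ?K f}"
      using algebraic_over_self[OF K] generate_field.incl[of _ "range ratfun_const \<union> B"] by blast
    show "Fract (mvar i) 1 \<in> {f. algebraic_over ?K f}" if "i < n" for i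
      using alg[OF K _ that] B(3) by simp
  qed
  then have "transcendence_basis ratfun_const (invariant_ratfuns G scale bs \<rho>) B"
    using B(1,2) S(2) unfolding transcendence_basis_def
    by (auto simp: invariant_ratfuns_le_def invariant_ratfuns_def)
  then show ?thesis
    using B(1) S(2) by blast
qed

text \<open>The coefficients of the orbit polynomials of the variables form a finite set of invariants over
  which the variables are algebraic. This makes the minimum in the definition of \<^const>\<open>gamma_rfield\<close>
  range over a nonempty set.\<close>

lemma exists_transcendence_basis_of_bounded_degree:
  "\<exists>d>0. \<exists>B\<subseteq>invariant_ratfuns_le G scale bs \<rho> d.
    transcendence_basis ratfun_const (invariant_ratfuns G scale bs \<rho>) B"
proof -
  have "\<forall>i. \<exists>Q. i < n \<longrightarrow> Q \<noteq> 0 \<and> poly Q (Fract (mvar i) 1) = 0 \<and>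
      (\<forall>j. Polynomial.coeff Q j \<in> invariant_ratfuns G scale bs \<rho>)"
    using mvar_root_of_invariant_polynomial by metis
  then obtain Q where Q: "\<And>i. i < n \<Longrightarrow> Q i \<noteq> 0" "\<And>i. i < n \<Longrightarrow> poly (Q i) (Fract (mvar i) 1) = 0"
      "\<And>i j. i < n \<Longrightarrow> Polynomial.coeff (Q i) j \<in> invariant_ratfuns G scale bs \<rho>"
    by metis
  define S where "S = (\<Union>i<n. Polynomial.coeff (Q i) ` {..Polynomial.degree (Q i)})"
  define d where "d = Suc (Max (insert 0 (ratfun_degree n ` S)))"
  have "finite S"
    by (simp add: S_def)
  have "ratfun_degree n s \<le> d" if "s \<in> S" for s
    unfolding d_def using that \<open>finite S\<close> by (intro le_SucI Max_ge) auto
  then have "S \<subseteq> invariant_ratfuns_le G scale bs \<rho> d"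
    using Q(3) by (auto simp: invariant_ratfuns_le_def S_def)
  moreover have "algebraic_over K (Fract (mvar i) 1)"
    if K: "is_subfield K" "\<forall>s\<in>S. algebraic_over K s" and i: "i < n" for K i
  proof (rule algebraic_over_root[OF K(1) Q(1)[OF i] _ Q(2)[OF i]])
    show "algebraic_over K (Polynomial.coeff (Q i) j)" for j
    proof (cases "j \<le> Polynomial.degree (Q i)")
      case True
      then show ?thesis
        using K(2) i by (auto simp: S_def)
    next
      case False
      then show ?thesis
        using algebraic_over_self[OF K(1) is_subfieldD(1)[OF K(1)]] by (simp add: coeff_eq_0)
    qed
  qed
  ultimately show ?thesis
    using transcendence_basis_from_finite_set[OF \<open>finite S\<close>] by (intro exI[of _ d]) (auto simp: d_def)
qed

text \<open>The eigenvalues of operators with square one are \<open>1\<close> and \<open>- 1\<close>, so squares of common eigenforms are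
  invariant. As these two eigenvalues are different, the common eigenforms span.\<close>

lemma quadratic_transcendence_basis:
  assumes two: "(2 :: 'k) \<noteq> 0" and invol: "\<And>g. g \<in> carrier G \<Longrightarrow> mat_of g * mat_of g = 1\<^sub>m n"
  shows "\<exists>B\<subseteq>invariant_ratfuns_le G scale bs \<rho> 2.
    transcendence_basis ratfun_const (invariant_ratfuns G scale bs \<rho>) B"
proof -
  define L where "L = range (linear_form n :: _ \<Rightarrow> 'k mpol)"
  define \<alpha> where "\<alpha> g = base_subst (\<lambda>a. a) n (mat_of g)" for g
  define Q where "Q l \<longleftrightarrow> (\<exists>S. finite S \<and> S \<subseteq> invariant_ratfuns_le G scale bs \<rho> 2 \<and>
    (\<forall>K. is_subfield K \<longrightarrow> (\<forall>s\<in>S. algebraic_over K s) \<longrightarrow> algebraic_over K (Fract l 1)))" for l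
  have \<alpha>_comp: "\<alpha> g (\<alpha> h p) = base_subst (\<lambda>a. a) n (mat_of h * mat_of g) p" for g h p
  proof -
    have "map_mat (\<lambda>a. a) (mat_of k) = mat_of k" for k
      by (rule eq_matI) simp_all
    then show ?thesis
      by (simp add: \<alpha>_def base_subst_comp[OF comm_ring_hom_id])
  qed
  have Q: "Q l" if "l \<in> L" for l
  proof (rule eigenform_induct[where \<alpha> = \<alpha> and I = "carrier G" and N = 2 and L = L])
    show "finite (carrier G)" "l \<in> L"
      by (fact finite_G that)+
    fix g assume g: "g \<in> carrier G"
    show "comm_ring_hom (\<alpha> g)" "\<And>c. \<alpha> g (mconst c) = mconst c"
      by (simp_all add: \<alpha>_def comm_ring_hom_base_subst[OF comm_ring_hom_id]
          base_subst_mconst[OF comm_ring_hom_id])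
    show "(\<alpha> g ^^ 2) x = x" for x
      using invol[OF g] by (simp add: numeral_2_eq_2 \<alpha>_comp base_subst_one mpoly_eval_mconst_mvar)
    show "\<alpha> g (\<alpha> h x) = \<alpha> h (\<alpha> g x)" if "h \<in> carrier G" for h x
      using g that by (simp add: \<alpha>_comp m_comm flip: mat_of_mult)
    show "\<alpha> g x \<in> L" if "x \<in> L" for x
      using that unfolding \<alpha>_def L_def by (rule linear_form_range_closed(4))
  next
    show "0 \<in> L" "\<And>x y. x \<in> L \<Longrightarrow> y \<in> L \<Longrightarrow> x + y \<in> L" "\<And>c x. x \<in> L \<Longrightarrow> mconst c * x \<in> L"
      unfolding L_def by (fact linear_form_range_closed)+
    have "{z :: 'k. z ^ 2 = 1} = {1, - 1}"
      by (auto simp: power2_eq_1_iff)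
    moreover have "(1 :: 'k) \<noteq> - 1"
      using two by (metis add.right_inverse one_add_one)
    ultimately show "card {z :: 'k. z ^ 2 = 1} = 2"
      by simp
    show "of_nat 2 \<noteq> (0 :: 'k)"
      using two by simp
  next
    show "Q 0"
      unfolding Q_def using algebraic_over_self is_subfieldD(1)
      by (intro exI[of _ "{}"]) (auto simp flip: Zero_fract_def)
  next
    fix x y assume "Q x" "Q y"
    then obtain S S' where S: "finite S" "S \<subseteq> invariant_ratfuns_le G scale bs \<rho> 2"
        "\<And>K. is_subfield K \<Longrightarrow> \<forall>s\<in>S. algebraic_over K s \<Longrightarrow> algebraic_over K (Fract x 1)"
      and S': "finite S'" "S' \<subseteq> invariant_ratfuns_le G scale bs \<rho> 2"
        "\<And>K. is_subfield K \<Longrightarrow> \<forall>s\<in>S'. algebraic_over K s \<Longrightarrow> algebraic_over K (Fract y 1)"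
      unfolding Q_def by metis
    have "algebraic_over K (Fract (x + y) 1)"
      if K: "is_subfield K" "\<forall>s\<in>S \<union> S'. algebraic_over K s" for K
    proof -
      have "Fract x 1 + Fract y 1 \<in> {z. algebraic_over K z}"
        using S(3)[OF K(1)] S'(3)[OF K(1)] K(2)
        by (intro is_subfieldD(3)[OF is_subfield_algebraic_over[OF K(1)]]) auto
      then show ?thesis
        by simp
    qed
    then show "Q (x + y)"
      unfolding Q_def using S(1,2) S'(1,2) by (intro exI[of _ "S \<union> S'"]) auto
  next
    fix x assume x: "x \<in> L" and eig: "\<And>g. g \<in> carrier G \<Longrightarrow> \<exists>c. c ^ 2 = 1 \<and> \<alpha> g x = mconst c * x"
    have xr: "x \<in> poly_ring n"
      using x by (auto simp: L_def)
    have "Fract (x ^ 2) 1 \<in> invariant_ratfuns G scale bs \<rho>"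
    proof (rule invariant_polynomial)
      show "x ^ 2 \<in> poly_ring n"
        by (rule mem_poly_ring_power[OF xr])
      fix g assume g: "g \<in> carrier G"
      interpret a: comm_ring_hom "act_poly g" by (rule comm_ring_hom_act_poly)
      obtain c where c: "c ^ 2 = 1" "\<alpha> (inv g) x = mconst c * x"
        using eig[of "inv g"] g by auto
      have "act_poly g (x ^ 2) = (mconst c * x) ^ 2"
        using c(2) by (simp add: a.hom_power act_poly_eq[OF xr] \<alpha>_def)
      also have "\<dots> = mconst (c ^ 2) * x ^ 2"
        by (simp add: power_mult_distrib comm_ring_hom_mconst[THEN comm_ring_hom.axioms(1)]
            mconst_def mult_single power2_eq_square mult_ac)
      also have "\<dots> = x ^ 2"
        by (simp add: c(1) mconst_def)
      finally show "act_poly g (x ^ 2) = x ^ 2" .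
    qed
    moreover have "total_degree x \<le> 1"
      using x total_degree_linear_form by (auto simp: L_def)
    then have "ratfun_degree n (Fract (x ^ 2) 1) \<le> 2"
      using ratfun_degree_polynomial_le[OF mem_poly_ring_power[OF xr], of 2] total_degree_power_le[of x 2]
      by simp
    moreover have "algebraic_over K (Fract x 1)" if "is_subfield K" "algebraic_over K (Fract (x ^ 2) 1)" for K
      by (rule algebraic_over_if_power[OF that(1), of 2]) (use that(2) in \<open>simp_all add: power2_eq_square\<close>)
    ultimately show "Q x"
      unfolding Q_def by (intro exI[of _ "{Fract (x ^ 2) 1}"]) (auto simp: invariant_ratfuns_le_def)
  qed simp_all
  define R where "R l S \<longleftrightarrow> finite S \<and> S \<subseteq> invariant_ratfuns_le G scale bs \<rho> 2 \<and>
    (\<forall>K. is_subfield K \<longrightarrow> (\<forall>s\<in>S. algebraic_over K s) \<longrightarrow> algebraic_over K (Fract l 1))" for l S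
  define S where "S i = (SOME S. R (mvar i) S)" for i
  have S: "R (mvar i) (S i)" if "i < n" for i
  proof -
    have "mvar i \<in> L"
      unfolding L_def using linear_form_unit[OF that] by (metis rangeI)
    then have "\<exists>S. R (mvar i) S"
      using Q[of "mvar i"] by (simp only: Q_def R_def)
    then show ?thesis
      unfolding S_def by (rule someI_ex)
  qed
  show ?thesis
    by (rule transcendence_basis_from_finite_set[of "\<Union>i<n. S i"])
      (use S in \<open>auto simp: R_def\<close>)
qed

end


section \<open>Decomposition into characters\<close>

text \<open>The polynomial \<open>X ^ N - 1\<close> splits, and its roots are simple because its derivative vanishes
  nowhere except possibly at \<open>0\<close>.\<close>

lemma card_roots_of_unity:
  assumes N: "N > 0" "of_nat N \<noteq> (0 :: 'a::alg_closed_field)"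
  shows "card {z :: 'a. z ^ N = 1} = N"
proof -
  define p :: "'a poly" where "p = Polynomial.monom 1 N - 1"
  have coeff: "Polynomial.coeff p i = (if i = N then 1 else if i = 0 then - 1 else 0)" for i
    using N(1) by (simp add: p_def)
  have "p \<noteq> 0"
  proof
    assume "p = 0"
    then show False
      using coeff[of N] by simp
  qed
  have deg: "Polynomial.degree p = N"
    by (rule antisym[OF degree_le le_degree]) (simp_all add: coeff)
  obtain A where A: "size A = N" "p = smult (Polynomial.lead_coeff p) (\<Prod>x\<in>#A. [:- x, 1:])"
    using alg_closed_imp_factorization[OF \<open>p \<noteq> 0\<close>] deg by auto
  have lead: "Polynomial.lead_coeff p = 1"
    by (simp add: deg coeff)
  have A': "p = (\<Prod>x\<in>#A. [:- x, 1:])"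
    using A(2) lead by simp
  have "poly p z = 0 \<longleftrightarrow> z \<in># A" for z
    unfolding A' by (induction A) auto
  then have roots: "{z. z ^ N = 1} = set_mset A"
    by (auto simp: p_def poly_monom)
  have "count A x = 1" if x: "x \<in># A" for x
  proof (rule ccontr)
    assume "count A x \<noteq> 1"
    have "count A x > 0"
      using x by simp
    with \<open>count A x \<noteq> 1\<close> have "count A x \<ge> 2"
      by linarith
    then obtain B where "A = add_mset x (add_mset x B)"
      by (metis (no_types, lifting) One_nat_def Suc_1 add_mset_remove_trivial_If count_greater_eq_one_iff
          count_single diff_le_mono diff_Suc_1 insert_DiffM count_diff x)
    then obtain q where p_eq: "p = [:- x, 1:] * ([:- x, 1:] * q)"
      using A' by simp
    have "poly (pderiv (a * b)) x = 0" if "poly a x = 0" "poly b x = 0" for a b :: "'a poly"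
      using that by (simp add: pderiv_mult)
    from this[of "[:- x, 1:]" "[:- x, 1:] * q"] have "poly (pderiv p) x = 0"
      unfolding p_eq by (simp only: poly_mult) simp
    moreover have "pderiv p = Polynomial.monom (of_nat N) (N - 1)"
      by (simp add: p_def pderiv_diff pderiv_monom)
    moreover have "x \<noteq> 0"
    proof -
      have "x ^ N = 1"
        using roots x by blast
      then show ?thesis
        using N(1) by (auto simp: power_0_left)
    qed
    ultimately show False
      using N(2) by (simp add: poly_monom)
  qed
  then have "size A = card (set_mset A)"
    by (simp add: size_multiset_overloaded_eq)
  then show ?thesis
    using A(1) roots by simp
qed

text \<open>An exchange argument: take an invertible matrix with as many rows as possible in \<open>E\<close>. If the row
  \<open>j\<close> is not among them, then some element of \<open>E\<close> has a nonzero \<open>j\<close>-th coordinate with respect to the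
  rows, since otherwise the \<open>j\<close>-th coordinate would vanish on the whole space, and that element
  can replace the row \<open>j\<close>.\<close>

lemma invertible_matrix_of_spanning_forms:
  fixes E :: "'K::field mpol set"
  assumes E: "E \<subseteq> range (linear_form n)"
    and span: "\<And>Q l. Q 0 \<Longrightarrow> (\<And>x y. Q x \<Longrightarrow> Q y \<Longrightarrow> Q (x + y)) \<Longrightarrow> (\<And>x. x \<in> E \<Longrightarrow> Q x) \<Longrightarrow>
      l \<in> range (linear_form n) \<Longrightarrow> Q l"
  obtains R R' where "R \<in> carrier_mat n n" "R' \<in> carrier_mat n n" "R * R' = 1\<^sub>m n" "R' * R = 1\<^sub>m n"
    "\<And>j. j < n \<Longrightarrow> linear_form n (\<lambda>k. R $$ (j, k)) \<in> E"
proof -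
  define form where "form R j = linear_form n (\<lambda>k. R $$ (j, k))" for R :: "'K mat" and j
  define count where "count R = card {j. j < n \<and> form R j \<in> E}" for R
  define regular where "regular R \<longleftrightarrow> R \<in> carrier_mat n n \<and> (\<exists>R'\<in>carrier_mat n n. R * R' = 1\<^sub>m n)" for R :: "'K mat"
  have "regular (1\<^sub>m n)"
    unfolding regular_def by (intro conjI bexI[of _ "1\<^sub>m n"]) simp_all
  moreover have "count R < Suc n" for R
    unfolding count_def using card_mono[of "{..<n}" "{j. j < n \<and> form R j \<in> E}"] by (auto simp: less_Suc_eq_le)
  ultimately obtain R where R: "regular R" "\<And>R1. regular R1 \<Longrightarrow> count R1 \<le> count R"
    using ex_has_greatest_nat[of regular "1\<^sub>m n" count "Suc n"] by blast
  then obtain R' where Rc: "R \<in> carrier_mat n n" "R' \<in> carrier_mat n n" and RR': "R * R' = 1\<^sub>m n"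
    by (auto simp: regular_def)
  have R'R: "R' * R = 1\<^sub>m n"
    by (rule mat_mult_left_right_inverse[OF Rc RR'])
  have "form R j \<in> E" if j: "j < n" for j
  proof (rule ccontr)
    assume nE: "form R j \<notin> E"
    define Q where "Q x \<longleftrightarrow> (\<Sum>i<n. Poly_Mapping.lookup x (Poly_Mapping.single i 1) * R' $$ (i, j)) = 0"
      for x :: "'K mpol"
    have "\<exists>e\<in>E. \<not> Q e"
    proof (rule ccontr)
      assume "\<not> (\<exists>e\<in>E. \<not> Q e)"
      have "Q (form R j)"
      proof (rule span)
        show "Q 0"
          by (simp add: Q_def)
        show "Q (x + y)" if "Q x" "Q y" for x y
          using that by (simp add: Q_def lookup_add distrib_right sum.distrib)
        show "Q x" if "x \<in> E" for x
          using that \<open>\<not> (\<exists>e\<in>E. \<not> Q e)\<close> by blast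
        show "form R j \<in> range (linear_form n)"
          by (simp add: form_def)
      qed
      then have "(\<Sum>i<n. R $$ (j, i) * R' $$ (i, j)) = 0"
        by (simp add: Q_def form_def lookup_linear_form del: One_nat_def)
      moreover have "(R * R') $$ (j, j) = (\<Sum>i<n. R $$ (j, i) * R' $$ (i, j))"
        using Rc j by (simp add: scalar_prod_def atLeast0LessThan)
      ultimately show False
        using j by (simp add: RR')
    qed
    then obtain e where e: "e \<in> E" "\<not> Q e"
      by blast
    then obtain a where a: "e = linear_form n a"
      using E by blast
    define s where "s = (\<Sum>i<n. a i * R' $$ (i, j))"
    have s: "s \<noteq> 0"
      using e(2) by (simp add: Q_def a lookup_linear_form s_def del: One_nat_def)
    define R1 where "R1 = mat n n (\<lambda>(i, k). if i = j then a k else R $$ (i, k))"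
    have R1c: "R1 \<in> carrier_mat n n"
      by (simp add: R1_def)
    have "det R1 \<noteq> 0"
    proof
      assume "det R1 = 0"
      then obtain v where v: "v \<in> carrier_vec n" "v \<noteq> 0\<^sub>v n" "R1 *\<^sub>v v = 0\<^sub>v n"
        using det_0_iff_vec_prod_zero_field[OF R1c] by blast
      define w where "w = R *\<^sub>v v"
      have wc: "w \<in> carrier_vec n"
        using Rc v(1) by (simp add: w_def)
      have w0: "w $ i = 0" if "i < n" "i \<noteq> j" for i
      proof -
        have "w $ i = (R1 *\<^sub>v v) $ i"
          using that Rc v(1) by (simp add: w_def R1_def scalar_prod_def)
        then show ?thesis
          using that v(3) by simp
      qed
      have v_eq: "v = R' *\<^sub>v w"
        using Rc v(1) by (simp add: w_def R'R flip: assoc_mult_mat_vec)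
      have v_k: "v $ k = R' $$ (k, j) * w $ j" if "k < n" for k
      proof -
        have "v $ k = (\<Sum>i<n. R' $$ (k, i) * w $ i)"
          using that Rc wc by (subst v_eq) (simp add: scalar_prod_def atLeast0LessThan)
        also have "\<dots> = (\<Sum>i<n. if i = j then R' $$ (k, j) * w $ j else 0)"
          by (rule sum.cong) (use w0 in auto)
        finally show ?thesis
          using j by simp
      qed
      have "0 = (R1 *\<^sub>v v) $ j"
        using v(3) j by simp
      also have "\<dots> = (\<Sum>k<n. a k * v $ k)"
        using j v(1) by (simp add: R1_def scalar_prod_def atLeast0LessThan)
      also have "\<dots> = s * w $ j"
        by (simp add: s_def v_k sum_distrib_right mult.assoc)
      finally have "w $ j = 0"
        using s by simp
      then have "w = 0\<^sub>v n"
        using wc w0 by (intro eq_vecI) auto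
      moreover have "R' *\<^sub>v 0\<^sub>v n = 0\<^sub>v n"
        using Rc by (intro eq_vecI) (auto simp: scalar_prod_def)
      ultimately show False
        using v(2) v_eq by simp
    qed
    then have "R1 \<in> Units (ring_mat TYPE('K) n ())"
      by (rule det_non_zero_imp_unit[OF R1c])
    then have "regular R1"
      using R1c by (auto simp: Units_def ring_mat_def regular_def)
    moreover have "count R < count R1"
    proof -
      have row: "form R1 i = (if i = j then e else form R i)" if "i < n" for i
        using that j by (auto simp: form_def R1_def a intro!: linear_form_cong)
      have "{i. i < n \<and> form R1 i \<in> E} = insert j {i. i < n \<and> form R i \<in> E}"
        using row e(1) j by (auto split: if_splits)
      then show ?thesis
        using nE by (simp add: count_def)
    qed
    ultimately show False
      using R(2)[of R1] by simp
  qed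
  then show thesis
    using that Rc RR' R'R by (simp add: form_def)
qed

context abelian_rep
begin

text \<open>Every operator satisfies \<open>X ^ N = 1\<close> for the order \<open>N\<close> of the group, so common eigenforms span and
  there is an invertible matrix \<open>R\<close> whose rows are eigenforms. Then \<open>R * M g = D * R\<close> with \<open>D\<close> diagonal,
  and the columns of the inverse of \<open>R\<close> are eigenvectors.\<close>

lemma exists_char_decomposition:
  assumes char: "of_nat (card (carrier G)) \<noteq> (0 :: 'k)"
  obtains P \<chi>s where "char_decomposition G scale bs \<rho> P \<chi>s"
proof -
  let ?N = "card (carrier G)"
  define M where "M g = map_mat to_ac (mat_of g)" for g
  define \<alpha> where "\<alpha> g = base_subst (\<lambda>a. a) n (M g)" for g
  define E where "E = {x \<in> range (linear_form n). \<forall>g\<in>carrier G. \<exists>c. c ^ ?N = 1 \<and> \<alpha> g x = mconst c * x}"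
  have Mc [simp]: "M g \<in> carrier_mat n n" for g
    by (simp add: M_def)
  have M_dim [simp]: "dim_row (M g) = n" "dim_col (M g) = n" for g
    by (simp_all add: M_def)
  have M_mult: "M (g \<otimes> h) = M g * M h" if "g \<in> carrier G" "h \<in> carrier G" for g h
    unfolding M_def mat_of_mult[OF that]
    by (rule eq_matI) (simp_all add: scalar_prod_def to_ac_sum)
  have M_one: "M \<one> = 1\<^sub>m n"
    unfolding M_def mat_of_one by (rule eq_matI) simp_all
  have \<alpha>_comp: "\<alpha> g (\<alpha> h p) = \<alpha> (h \<otimes> g) p" if "g \<in> carrier G" "h \<in> carrier G" for g h p
  proof -
    have "map_mat (\<lambda>a. a) (M k) = M k" for k
      by (rule eq_matI) simp_all
    then show ?thesis
      using that by (simp add: \<alpha>_def base_subst_comp[OF comm_ring_hom_id] M_mult)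
  qed
  have \<alpha>_pow: "(\<alpha> g ^^ k) x = \<alpha> (g [^] k) x" if "g \<in> carrier G" for g k x
  proof (induction k)
    case 0
    show ?case
      by (simp add: \<alpha>_def M_one base_subst_one mpoly_eval_mconst_mvar)
  next
    case (Suc k)
    then show ?case
      using that by (simp add: \<alpha>_comp)
  qed
  have N: "?N > 0"
    using finite_G by (auto simp: card_gt_0_iff)
  have N': "of_nat ?N \<noteq> (0 :: 'k alg_closure)"
    using char by (metis to_ac_eq_0_iff to_ac_of_nat)
  have E_sub: "E \<subseteq> range (linear_form n)"
    by (auto simp: E_def)
  have E_span: "Q l" if Q: "Q 0" "\<And>x y. Q x \<Longrightarrow> Q y \<Longrightarrow> Q (x + y)" "\<And>x. x \<in> E \<Longrightarrow> Q x"
      and l: "l \<in> range (linear_form n)" for Q l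
  proof (rule eigenform_induct[where \<alpha> = \<alpha> and I = "carrier G" and N = ?N and L = "range (linear_form n)"])
    show "finite (carrier G)" "card {z :: 'k alg_closure. z ^ ?N = 1} = ?N" "?N > 0" "l \<in> range (linear_form n)"
      "of_nat ?N \<noteq> (0 :: 'k alg_closure)" "Q 0"
      by (fact finite_G card_roots_of_unity[OF N N'] N l N' Q(1))+
    fix g assume g: "g \<in> carrier G"
    show "comm_ring_hom (\<alpha> g)" "\<And>c. \<alpha> g (mconst c) = mconst c"
      by (simp_all add: \<alpha>_def comm_ring_hom_base_subst[OF comm_ring_hom_id]
          base_subst_mconst[OF comm_ring_hom_id])
    show "(\<alpha> g ^^ ?N) x = x" for x
      unfolding \<alpha>_pow[OF g] using pow_order_eq_1[OF g, unfolded Coset.order_def]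
      by (simp add: \<alpha>_def M_one base_subst_one mpoly_eval_mconst_mvar)
    show "\<alpha> g (\<alpha> h x) = \<alpha> h (\<alpha> g x)" if "h \<in> carrier G" for h x
      using g that by (simp add: \<alpha>_comp m_comm)
    show "\<alpha> g x \<in> range (linear_form n)" if "x \<in> range (linear_form n)" for x
      using that unfolding \<alpha>_def by (rule linear_form_range_closed(4))
  next
    show "0 \<in> range (linear_form n)"
      "\<And>x y. x \<in> range (linear_form n) \<Longrightarrow> y \<in> range (linear_form n) \<Longrightarrow> x + y \<in> range (linear_form n)"
      "\<And>c x. x \<in> range (linear_form n) \<Longrightarrow> mconst c * x \<in> range (linear_form n)"
      by (fact linear_form_range_closed)+
    show "Q (x + y)" if "Q x" "Q y" for x y
      using that by (rule Q(2))
    show "Q x" if "x \<in> range (linear_form n)"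
        "\<And>g. g \<in> carrier G \<Longrightarrow> \<exists>c. c ^ ?N = 1 \<and> \<alpha> g x = mconst c * x" for x
      using that by (intro Q(3)) (auto simp: E_def)
  qed
  obtain R R' :: "'k alg_closure mat" where R: "R \<in> carrier_mat n n" "R' \<in> carrier_mat n n"
      "R * R' = 1\<^sub>m n" "R' * R = 1\<^sub>m n" "\<And>j. j < n \<Longrightarrow> linear_form n (\<lambda>k. R $$ (j, k)) \<in> E"
  proof (rule invertible_matrix_of_spanning_forms[OF E_sub])
    show "Q l" if "Q 0" "\<And>x y. Q x \<Longrightarrow> Q y \<Longrightarrow> Q (x + y)" "\<And>x. x \<in> E \<Longrightarrow> Q x"
        "l \<in> range (linear_form n)" for Q l
      by (rule E_span[of Q]) (fact that)+
  qed (rule that)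
  have ex: "\<exists>c. c ^ ?N = 1 \<and> (\<forall>k<n. (\<Sum>i<n. R $$ (j, i) * M g $$ (i, k)) = c * R $$ (j, k))"
    if j: "j < n" and g: "g \<in> carrier G" for j g
  proof -
    obtain c where c: "c ^ ?N = 1"
        "\<alpha> g (linear_form n (\<lambda>k. R $$ (j, k))) = mconst c * linear_form n (\<lambda>k. R $$ (j, k))"
      using R(5)[OF j] g by (auto simp: E_def)
    then have eq: "linear_form n (\<lambda>k. \<Sum>i<n. R $$ (j, i) * M g $$ (i, k)) = linear_form n (\<lambda>k. c * R $$ (j, k))"
      by (simp add: \<alpha>_def base_subst_linear_form[OF comm_ring_hom_id] mconst_mult_linear_form)
    have "(\<Sum>i<n. R $$ (j, i) * M g $$ (i, k)) = c * R $$ (j, k)" if "k < n" for k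
      using arg_cong[OF eq, of "\<lambda>x. Poly_Mapping.lookup x (Poly_Mapping.single k 1)"]
      by (simp only: lookup_linear_form[OF that])
    with c(1) show ?thesis
      by blast
  qed
  define c where "c j g = (SOME c. c ^ ?N = 1 \<and>
    (\<forall>k<n. (\<Sum>i<n. R $$ (j, i) * M g $$ (i, k)) = c * R $$ (j, k)))" for j g
  have c_props: "c j g ^ ?N = 1 \<and> (\<forall>k<n. (\<Sum>i<n. R $$ (j, i) * M g $$ (i, k)) = c j g * R $$ (j, k))"
    if "j < n" "g \<in> carrier G" for j g
    unfolding c_def by (rule someI_ex[OF ex[OF that]])
  then have c: "\<And>j g. j < n \<Longrightarrow> g \<in> carrier G \<Longrightarrow> c j g ^ ?N = 1"
      "\<And>j g k. j < n \<Longrightarrow> g \<in> carrier G \<Longrightarrow> k < n \<Longrightarrow>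
        (\<Sum>i<n. R $$ (j, i) * M g $$ (i, k)) = c j g * R $$ (j, k)"
    by blast+
  define \<chi> where "\<chi> j = (\<lambda>g\<in>carrier G. c j g)" for j
  have \<chi>: "\<chi> j \<in> carrier (char_group G)" if j: "j < n" for j
  proof -
    have "\<exists>k<n. R $$ (j, k) \<noteq> 0"
    proof (rule ccontr)
      assume "\<not> ?thesis"
      then have "(R * R') $$ (j, j) = 0"
        using R(1,2) j by (simp add: scalar_prod_def)
      then show False
        using j by (simp add: R(3))
    qed
    then obtain k where k: "k < n" "R $$ (j, k) \<noteq> 0"
      by blast
    have "c j (g \<otimes> h) = c j g * c j h" if g: "g \<in> carrier G" and h: "h \<in> carrier G" for g h
    proof -
      have "c j (g \<otimes> h) * R $$ (j, k) = (\<Sum>i<n. R $$ (j, i) * (\<Sum>l<n. M g $$ (i, l) * M h $$ (l, k)))"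
        using c(2)[OF j _ k(1), of "g \<otimes> h"] g h k(1) Mc[of g] Mc[of h]
        by (simp add: M_mult scalar_prod_def atLeast0LessThan)
      also have "\<dots> = (\<Sum>l<n. (\<Sum>i<n. R $$ (j, i) * M g $$ (i, l)) * M h $$ (l, k))"
        by (simp add: sum_distrib_left sum_distrib_right mult.assoc) (rule sum.swap)
      also have "\<dots> = c j g * (\<Sum>l<n. R $$ (j, l) * M h $$ (l, k))"
        by (simp add: c(2)[OF j g] sum_distrib_left mult.assoc)
      also have "\<dots> = c j g * c j h * R $$ (j, k)"
        by (simp add: c(2)[OF j h k(1)])
      finally show ?thesis
        using k(2) by simp
    qed
    moreover have "c j g \<noteq> 0" if "g \<in> carrier G" for g
      using c(1)[OF j that] N by (auto simp: power_0_left)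
    ultimately show ?thesis
      by (auto simp: char_group_def \<chi>_def hom_def ring_of_type_algebra_simps)
  qed
  have "char_decomposition G scale bs \<rho> R' (map \<chi> [0..<n])"
    unfolding char_decomposition_def
  proof (intro conjI allI impI ballI)
    show "R' \<in> carrier_mat n n" "length (map \<chi> [0..<n]) = n" "set (map \<chi> [0..<n]) \<subseteq> carrier (char_group G)"
      using R(2) \<chi> by auto
    show "invertible_mat R'"
      unfolding invertible_mat_def inverts_mat_def using R by (intro conjI exI[of _ R]) auto
    fix i g assume i: "i < n" and g: "g \<in> carrier G"
    define D where "D = mat n n (\<lambda>(a, b). if a = b then c a g else 0)"
    have Dc: "D \<in> carrier_mat n n"
      by (simp add: D_def)
    have RM: "R * M g = D * R"
    proof (rule eq_matI)
      fix j k assume "j < dim_row (D * R)" "k < dim_col (D * R)"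
      then have jk: "j < n" "k < n"
        using Dc R(1) by auto
      have "(D * R) $$ (j, k) = (\<Sum>l<n. (if j = l then c j g else 0) * R $$ (l, k))"
        using jk R(1) by (simp add: D_def scalar_prod_def atLeast0LessThan)
      also have "\<dots> = (\<Sum>l<n. if l = j then c j g * R $$ (j, k) else 0)"
        by (rule sum.cong) auto
      also have "\<dots> = (R * M g) $$ (j, k)"
        using jk R(1) Mc[of g] c(2)[OF jk(1) g jk(2)] by (simp add: scalar_prod_def atLeast0LessThan)
      finally show "(R * M g) $$ (j, k) = (D * R) $$ (j, k)"
        by simp
    qed (use R(1) Dc Mc[of g] in auto)
    have "M g * R' = (R' * R) * (M g * R')"
      unfolding R(4) using mult_carrier_mat[OF Mc[of g] R(2)] by simp
    also have "\<dots> = R' * ((R * M g) * R')"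
      using assoc_mult_mat[OF R(2,1) mult_carrier_mat[OF Mc[of g] R(2)]]
        assoc_mult_mat[OF R(1) Mc[of g] R(2)] by simp
    also have "\<dots> = R' * (D * (R * R'))"
      unfolding RM by (simp only: assoc_mult_mat[OF Dc R(1,2)])
    also have "\<dots> = R' * D"
      unfolding R(3) right_mult_one_mat[OF Dc] ..
    finally have MR': "M g * R' = R' * D" .
    show "map_mat to_ac (coord_mat scale bs (\<rho> g)) *\<^sub>v col R' i = (map \<chi> [0..<n] ! i) g \<cdot>\<^sub>v col R' i"
    proof (rule eq_vecI)
      fix k assume "k < dim_vec ((map \<chi> [0..<n] ! i) g \<cdot>\<^sub>v col R' i)"
      then have k: "k < n"
        using R(2) by simp
      have "(M g *\<^sub>v col R' i) $ k = (M g * R') $$ (k, i)"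
        using k i R(2) Mc[of g] by simp
      also have "\<dots> = (\<Sum>l<n. R' $$ (k, l) * (if l = i then c l g else 0))"
        unfolding MR' using k i R(2) by (simp add: D_def scalar_prod_def atLeast0LessThan)
      also have "\<dots> = (\<Sum>l<n. if l = i then R' $$ (k, i) * c i g else 0)"
        by (rule sum.cong) auto
      also have "\<dots> = ((map \<chi> [0..<n] ! i) g \<cdot>\<^sub>v col R' i) $ k"
        using k i g R(2) by (simp add: \<chi>_def)
      finally show "(map_mat to_ac (coord_mat scale bs (\<rho> g)) *\<^sub>v col R' i) $ k =
          ((map \<chi> [0..<n] ! i) g \<cdot>\<^sub>v col R' i) $ k"
        by (simp add: M_def mat_of_def)
    qed (use R(2) Mc[of g] in \<open>simp add: M_def mat_of_def\<close>)
  qed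
  then show thesis
    by (rule that)
qed

end


section \<open>The character group\<close>

lemma carrier_char_group_iff:
  "\<chi> \<in> carrier (char_group G) \<longleftrightarrow> \<chi> \<in> extensional (carrier G) \<and> (\<forall>g\<in>carrier G. \<chi> g \<noteq> 0) \<and>
    (\<forall>g\<in>carrier G. \<forall>h\<in>carrier G. \<chi> (g \<otimes>\<^bsub>G\<^esub> h) = \<chi> g * \<chi> h)"
  by (auto simp: char_group_def hom_def ring_of_type_algebra_simps)

lemma char_group_mult: "g \<in> carrier G \<Longrightarrow> (\<chi> \<otimes>\<^bsub>char_group G\<^esub> \<psi>) g = \<chi> g * \<psi> g"
  by (simp add: char_group_def)

lemma char_group_one: "g \<in> carrier G \<Longrightarrow> \<one>\<^bsub>char_group G\<^esub> g = 1"
  by (simp add: char_group_def)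

lemma char_group_eqI:
  assumes "\<chi> \<in> carrier (char_group G)" "\<psi> \<in> carrier (char_group G)" "\<And>g. g \<in> carrier G \<Longrightarrow> \<chi> g = \<psi> g"
  shows "\<chi> = \<psi>"
  using assms by (intro extensionalityI[of _ "carrier G"]) (auto simp: carrier_char_group_iff)

lemma comm_group_char_group:
  fixes G :: "('g, 'm) monoid_scheme"
  assumes "comm_group G"
  shows "comm_group (char_group G :: ('g \<Rightarrow> 'k::field alg_closure) monoid)"
proof -
  interpret comm_group G by (rule assms)
  let ?C = "char_group G :: ('g \<Rightarrow> 'k alg_closure) monoid"
  have closed: "\<chi> \<otimes>\<^bsub>?C\<^esub> \<psi> \<in> carrier ?C" if "\<chi> \<in> carrier ?C" "\<psi> \<in> carrier ?C" for \<chi> \<psi>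
    using that by (auto simp: carrier_char_group_iff char_group_mult) (simp add: char_group_def)
  have one: "\<one>\<^bsub>?C\<^esub> \<in> carrier ?C"
    by (auto simp: carrier_char_group_iff char_group_one) (simp add: char_group_def)
  show ?thesis
  proof (rule comm_groupI)
    fix \<chi> \<psi> \<eta> :: "'g \<Rightarrow> 'k alg_closure"
    assume c: "\<chi> \<in> carrier ?C" "\<psi> \<in> carrier ?C"
    show "\<chi> \<otimes>\<^bsub>?C\<^esub> \<psi> = \<psi> \<otimes>\<^bsub>?C\<^esub> \<chi>"
      by (rule char_group_eqI[where G = G]) (simp_all add: c closed char_group_mult mult.commute)
    assume "\<eta> \<in> carrier ?C"
    with c show "\<chi> \<otimes>\<^bsub>?C\<^esub> \<psi> \<otimes>\<^bsub>?C\<^esub> \<eta> = \<chi> \<otimes>\<^bsub>?C\<^esub> (\<psi> \<otimes>\<^bsub>?C\<^esub> \<eta>)"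
      by (intro char_group_eqI[where G = G]) (simp_all add: closed char_group_mult mult.assoc)
  next
    fix \<chi> :: "'g \<Rightarrow> 'k alg_closure" assume c: "\<chi> \<in> carrier ?C"
    show "\<one>\<^bsub>?C\<^esub> \<otimes>\<^bsub>?C\<^esub> \<chi> = \<chi>"
      by (rule char_group_eqI[where G = G]) (simp_all add: c closed one char_group_mult char_group_one)
    have inv: "(\<lambda>g\<in>carrier G. inverse (\<chi> g)) \<in> carrier ?C"
      using c by (auto simp: carrier_char_group_iff)
    show "\<exists>\<psi>\<in>carrier ?C. \<psi> \<otimes>\<^bsub>?C\<^esub> \<chi> = \<one>\<^bsub>?C\<^esub>"
    proof (rule bexI[OF _ inv], rule char_group_eqI[where G = G])
      fix g assume "g \<in> carrier G"
      then show "((\<lambda>g\<in>carrier G. inverse (\<chi> g)) \<otimes>\<^bsub>?C\<^esub> \<chi>) g = \<one>\<^bsub>?C\<^esub> g"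
        using c by (auto simp: carrier_char_group_iff char_group_mult char_group_one)
    qed (simp_all add: closed inv c one)
  qed (simp_all add: closed one)
qed

lemma involutions_iff:
  assumes "group H"
  shows "x \<in> involutions H \<longleftrightarrow> x \<in> carrier H \<and> x \<noteq> \<one>\<^bsub>H\<^esub> \<and> x \<otimes>\<^bsub>H\<^esub> x = \<one>\<^bsub>H\<^esub>"
proof -
  interpret H: group H by (rule assms)
  have "H.ord x = 2 \<longleftrightarrow> x \<noteq> \<one>\<^bsub>H\<^esub> \<and> x \<otimes>\<^bsub>H\<^esub> x = \<one>\<^bsub>H\<^esub>" if x: "x \<in> carrier H"
  proof -
    have sq: "x [^]\<^bsub>H\<^esub> (2::nat) = x \<otimes>\<^bsub>H\<^esub> x"
      using x by (simp add: numeral_2_eq_2)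
    have "x \<otimes>\<^bsub>H\<^esub> x = \<one>\<^bsub>H\<^esub> \<longleftrightarrow> H.ord x dvd 2"
      using H.pow_eq_id[OF x, of 2] sq by simp
    also have "\<dots> \<longleftrightarrow> H.ord x = 1 \<or> H.ord x = 2"
      using two_is_prime_nat prime_nat_iff by auto
    finally show ?thesis
      using H.ord_eq_1[OF x] by auto
  qed
  then show ?thesis
    by (auto simp: involutions_def)
qed

text \<open>Counting through \<open>\<Sum>g. (\<Sum>\<epsilon>. \<epsilon> g)\<^sup>2\<close>. By orthogonality the sum is \<open>card S * card G\<close>, while each
  square element contributes \<open>(card S)\<^sup>2\<close>; and the number of squares is the index of the subgroup
  of elements with trivial square.\<close>

lemma (in comm_group) card_sign_characters_le:
  fixes S :: "('a \<Rightarrow> int) set"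
  assumes fin: "finite (carrier G)" "finite S"
    and sign: "\<And>\<epsilon> g. \<epsilon> \<in> S \<Longrightarrow> g \<in> carrier G \<Longrightarrow> \<epsilon> g = 1 \<or> \<epsilon> g = - 1"
    and mult: "\<And>\<epsilon> g h. \<epsilon> \<in> S \<Longrightarrow> g \<in> carrier G \<Longrightarrow> h \<in> carrier G \<Longrightarrow> \<epsilon> (g \<otimes> h) = \<epsilon> g * \<epsilon> h"
    and dist: "\<And>\<epsilon> \<delta>. \<epsilon> \<in> S \<Longrightarrow> \<delta> \<in> S \<Longrightarrow> (\<And>g. g \<in> carrier G \<Longrightarrow> \<epsilon> g = \<delta> g) \<Longrightarrow> \<epsilon> = \<delta>"
  shows "card S \<le> card {g \<in> carrier G. g \<otimes> g = \<one>}"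
proof (cases "S = {}")
  case False
  let ?G = "carrier G" and ?T = "{g \<in> carrier G. g \<otimes> g = \<one>}"
  define Sq where "Sq = (\<lambda>g. g \<otimes> g) ` ?G"
  define s where "s g = (\<Sum>\<epsilon>\<in>S. \<epsilon> g)" for g
  \<comment> \<open>Translation by some \<open>h\<close> with \<open>\<epsilon> h * \<delta> h = - 1\<close> changes the sign of the sum.\<close>
  have orth: "(\<Sum>g\<in>?G. \<epsilon> g * \<delta> g) = (if \<epsilon> = \<delta> then int (card ?G) else 0)" if S: "\<epsilon> \<in> S" "\<delta> \<in> S" for \<epsilon> \<delta>
  proof (cases "\<epsilon> = \<delta>")
    case True
    have "(\<Sum>g\<in>?G. \<epsilon> g * \<delta> g) = (\<Sum>g\<in>?G. 1)"
    proof (rule sum.cong)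
      fix g assume "g \<in> ?G"
      then show "\<epsilon> g * \<delta> g = 1"
        using sign[OF S(1), of g] True by auto
    qed simp
    then show ?thesis
      using True by simp
  next
    case False
    then obtain h where h: "h \<in> ?G" "\<epsilon> h \<noteq> \<delta> h"
      using dist[OF S] by blast
    then have eh: "\<epsilon> h * \<delta> h = - 1"
      using sign[OF S(1) h(1)] sign[OF S(2) h(1)] by auto
    have "(\<Sum>g\<in>?G. \<epsilon> g * \<delta> g) = (\<Sum>g\<in>?G. \<epsilon> (h \<otimes> g) * \<delta> (h \<otimes> g))"
    proof (rule sum.reindex_bij_betw[where h = "\<lambda>g. h \<otimes> g", symmetric])
      show "bij_betw ((\<otimes>) h) ?G ?G"
        using h by (intro bij_betwI[where g = "\<lambda>g. inv h \<otimes> g"]) (auto simp flip: m_assoc)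
    qed
    also have "\<dots> = (\<Sum>g\<in>?G. (\<epsilon> h * \<delta> h) * (\<epsilon> g * \<delta> g))"
      by (rule sum.cong) (use mult[OF S(1) h(1)] mult[OF S(2) h(1)] in \<open>auto simp: mult_ac\<close>)
    also have "\<dots> = - (\<Sum>g\<in>?G. \<epsilon> g * \<delta> g)"
      unfolding eh by (simp add: sum_negf)
    finally show ?thesis
      using False by simp
  qed
  have "(\<Sum>g\<in>?G. s g * s g) = (\<Sum>\<epsilon>\<in>S. \<Sum>\<delta>\<in>S. \<Sum>g\<in>?G. \<epsilon> g * \<delta> g)"
    unfolding s_def sum_product by (subst sum.swap, rule sum.cong[OF refl], rule sum.swap)
  also have "\<dots> = (\<Sum>\<epsilon>\<in>S. \<Sum>\<delta>\<in>S. if \<epsilon> = \<delta> then int (card ?G) else 0)"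
    by (intro sum.cong refl orth)
  also have "\<dots> = int (card S) * int (card ?G)"
    using fin(2) by simp
  finally have total: "(\<Sum>g\<in>?G. s g * s g) = int (card S) * int (card ?G)" .
  have "s y = int (card S)" if y: "y \<in> Sq" for y
  proof -
    obtain g where g: "g \<in> ?G" "y = g \<otimes> g"
      using y by (auto simp: Sq_def)
    have "s y = (\<Sum>\<epsilon>\<in>S. 1)"
      unfolding s_def by (rule sum.cong) (use sign g mult in force)+
    then show ?thesis
      by simp
  qed
  then have "int (card Sq) * (int (card S) * int (card S)) = (\<Sum>y\<in>Sq. s y * s y)"
    by simp
  also have "\<dots> \<le> (\<Sum>g\<in>?G. s g * s g)"
    by (rule sum_mono2) (auto simp: fin Sq_def)
  finally have le: "int (card Sq) * (int (card S) * int (card S)) \<le> int (card S) * int (card ?G)"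
    using total by simp
  \<comment> \<open>The fibres of the squaring map are the cosets of \<open>?T\<close>.\<close>
  have fiber: "card {g \<in> ?G. g \<otimes> g = y} = card ?T" if y: "y \<in> Sq" for y
  proof -
    obtain a where a: "a \<in> ?G" "y = a \<otimes> a"
      using y by (auto simp: Sq_def)
    have sq: "(b \<otimes> g) \<otimes> (b \<otimes> g) = (b \<otimes> b) \<otimes> (g \<otimes> g)" if "b \<in> ?G" "g \<in> ?G" for b g
      using that by (simp add: m_ac)
    have "bij_betw (\<lambda>g. a \<otimes> g) ?T {g \<in> ?G. g \<otimes> g = y}"
    proof (rule bij_betwI[where g = "\<lambda>g. inv a \<otimes> g"])
      show "(\<lambda>g. a \<otimes> g) \<in> ?T \<rightarrow> {g \<in> ?G. g \<otimes> g = y}"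
      proof (intro funcsetI CollectI conjI)
        fix g assume g: "g \<in> ?T"
        then show "a \<otimes> g \<in> ?G"
          using a by simp
        have "(a \<otimes> g) \<otimes> (a \<otimes> g) = (a \<otimes> a) \<otimes> (g \<otimes> g)"
          using g by (intro sq a) simp
        then show "(a \<otimes> g) \<otimes> (a \<otimes> g) = y"
          using g a by simp
      qed
      show "(\<lambda>g. inv a \<otimes> g) \<in> {g \<in> ?G. g \<otimes> g = y} \<rightarrow> ?T"
      proof (intro funcsetI CollectI conjI)
        fix g assume g: "g \<in> {g \<in> ?G. g \<otimes> g = y}"
        then show "inv a \<otimes> g \<in> ?G"
          using a by simp
        have "(inv a \<otimes> g) \<otimes> (inv a \<otimes> g) = (inv a \<otimes> inv a) \<otimes> (g \<otimes> g)"
          using g a by (intro sq) simp_all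
        also have "inv a \<otimes> inv a = inv (a \<otimes> a)"
          using a by (simp add: inv_mult)
        finally show "(inv a \<otimes> g) \<otimes> (inv a \<otimes> g) = \<one>"
          using g a by simp
      qed
    qed (use a in \<open>auto simp flip: m_assoc\<close>)
    then show ?thesis
      by (rule bij_betw_same_card[symmetric])
  qed
  have "card ?G = (\<Sum>y\<in>Sq. \<Sum>g\<in>{g \<in> ?G. g \<otimes> g = y}. 1)"
    using sum.group[of ?G Sq "\<lambda>g. g \<otimes> g" "\<lambda>_. 1::nat"] fin by (simp add: Sq_def)
  also have "\<dots> = card Sq * card ?T"
    by (simp add: fiber)
  finally have "int (card ?G) = int (card Sq) * int (card ?T)"
    by simp
  with le have "(int (card Sq) * int (card S)) * int (card S) \<le> (int (card Sq) * int (card S)) * int (card ?T)"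
    by (simp add: mult_ac)
  moreover have "card Sq > 0" "card S > 0"
    using fin False by (auto simp: Sq_def card_gt_0_iff)
  ultimately show ?thesis
    by (simp add: mult_le_cancel_left)
qed simp

text \<open>A character with trivial square takes only the values \<open>1\<close> and \<open>- 1\<close>. Read as integers, these make it
  a sign character, to which the counting argument applies.\<close>

lemma card_char_involutions_le:
  fixes G :: "('g, 'm) monoid_scheme" (structure)
  assumes "comm_group G" "finite (carrier G)"
  shows "finite (involutions (char_group G :: ('g \<Rightarrow> 'k::field alg_closure) monoid))"
    and "card (involutions (char_group G :: ('g \<Rightarrow> 'k::field alg_closure) monoid)) \<le> card (involutions G)"
proof -
  interpret comm_group G by (rule assms)
  let ?C = "char_group G :: ('g \<Rightarrow> 'k alg_closure) monoid"
  interpret C: comm_group ?C by (rule comm_group_char_group[OF assms(1)])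
  define S where "S = {\<chi> \<in> carrier ?C. \<chi> \<otimes>\<^bsub>?C\<^esub> \<chi> = \<one>\<^bsub>?C\<^esub>}"
  define sign where "sign \<chi> g = (if \<chi> g = 1 then 1 else - 1 :: int)" for \<chi> :: "'g \<Rightarrow> 'k alg_closure" and g
  have val: "\<chi> g = 1 \<or> \<chi> g = - 1" if "\<chi> \<in> S" "g \<in> carrier G" for \<chi> g
  proof -
    have "\<chi> g * \<chi> g = (\<chi> \<otimes>\<^bsub>?C\<^esub> \<chi>) g"
      using that by (simp add: char_group_mult)
    also have "\<dots> = 1"
      using that by (simp add: S_def char_group_one)
    finally show ?thesis
      by (simp add: square_eq_1_iff)
  qed
  have "S \<subseteq> carrier G \<rightarrow>\<^sub>E {1, - 1}"
    using val by (auto simp: S_def carrier_char_group_iff PiE_def)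
  then have finX: "finite S"
    by (rule finite_subset) (intro finite_PiE assms(2), simp)
  have sign_eq: "\<chi> = \<psi>" if "\<chi> \<in> S" "\<psi> \<in> S" "\<And>g. g \<in> carrier G \<Longrightarrow> sign \<chi> g = sign \<psi> g" for \<chi> \<psi>
  proof (rule char_group_eqI[where G = G])
    show "\<chi> \<in> carrier ?C" "\<psi> \<in> carrier ?C"
      using that by (auto simp: S_def)
    fix g assume g: "g \<in> carrier G"
    show "\<chi> g = \<psi> g"
      using val[OF that(1) g] val[OF that(2) g] that(3)[OF g] by (auto simp: sign_def split: if_splits)
  qed
  have "card S = card (sign ` S)"
    by (rule card_image[symmetric]) (auto intro!: inj_onI sign_eq)
  also have "\<dots> \<le> card {g \<in> carrier G. g \<otimes> g = \<one>}"
  proof (rule card_sign_characters_le[OF assms(2)])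
    show "finite (sign ` S)"
      using finX by simp
    fix \<epsilon> assume "\<epsilon> \<in> sign ` S"
    then obtain \<chi> where \<chi>: "\<chi> \<in> S" "\<epsilon> = sign \<chi>"
      by blast
    show "\<epsilon> g = 1 \<or> \<epsilon> g = - 1" for g
      by (simp add: \<chi>(2) sign_def)
    show "\<epsilon> (g \<otimes> h) = \<epsilon> g * \<epsilon> h" if "g \<in> carrier G" "h \<in> carrier G" for g h
    proof -
      have "\<chi> (g \<otimes> h) = \<chi> g * \<chi> h"
        using \<chi>(1) that by (simp add: S_def carrier_char_group_iff)
      then show ?thesis
        using val[OF \<chi>(1) that(1)] val[OF \<chi>(1) that(2)] by (auto simp: \<chi>(2) sign_def)
    qed
    fix \<delta> assume "\<delta> \<in> sign ` S" "\<And>g. g \<in> carrier G \<Longrightarrow> \<epsilon> g = \<delta> g"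
    then show "\<epsilon> = \<delta>"
      using sign_eq[OF \<chi>(1)] \<chi>(2) by blast
  qed
  finally have le: "card S \<le> card {g \<in> carrier G. g \<otimes> g = \<one>}" .
  have S: "S = insert \<one>\<^bsub>?C\<^esub> (involutions ?C)"
  proof (rule Set.set_eqI)
    show "\<chi> \<in> S \<longleftrightarrow> \<chi> \<in> insert \<one>\<^bsub>?C\<^esub> (involutions ?C)" for \<chi>
      unfolding S_def insert_iff mem_Collect_eq involutions_iff[OF C.is_group]
      by (cases "\<chi> = \<one>\<^bsub>?C\<^esub>") simp_all
  qed
  have T: "{g \<in> carrier G. g \<otimes> g = \<one>} = insert \<one> (involutions G)"
  proof (rule Set.set_eqI)
    show "g \<in> {g \<in> carrier G. g \<otimes> g = \<one>} \<longleftrightarrow> g \<in> insert \<one> (involutions G)" for g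
      unfolding insert_iff mem_Collect_eq involutions_iff[OF is_group] by (cases "g = \<one>") simp_all
  qed
  have fT: "finite (involutions G)"
    using assms(2) by (rule finite_subset[rotated]) (auto simp: involutions_def)
  show fin: "finite (involutions ?C)"
    using finX unfolding S by simp
  have "\<one>\<^bsub>?C\<^esub> \<notin> involutions ?C" "\<one> \<notin> involutions G"
    by (simp_all add: involutions_iff[OF C.is_group] involutions_iff[OF is_group])
  then show "card (involutions ?C) \<le> card (involutions G)"
    using le fin fT unfolding S T by simp
qed


section \<open>Characters and small degrees\<close>

context abelian_rep
begin

lemma characters_of_decomposition:
  assumes "char_decomposition G scale bs \<rho> P \<chi>s" "i < n"
  shows "\<chi>s ! i \<in> carrier (char_group G)" "\<chi>s ! i \<in> characters_in G scale bs \<rho>"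
proof -
  have "\<chi>s ! i \<in> set \<chi>s" "set \<chi>s \<subseteq> carrier (char_group G)"
    using assms by (simp_all add: char_decomposition_def)
  then show "\<chi>s ! i \<in> carrier (char_group G)" "\<chi>s ! i \<in> characters_in G scale bs \<rho>"
    using assms(1) unfolding characters_in_def by blast+
qed

text \<open>When these characters have the value \<open>1\<close> at \<open>g\<close>, all columns of the invertible matrix \<open>P\<close> are fixed.\<close>

lemma mat_of_eq_one_if_characters_trivial:
  assumes P: "char_decomposition G scale bs \<rho> P \<chi>s" and g: "g \<in> carrier G"
    and triv: "\<And>i. i < n \<Longrightarrow> (\<chi>s ! i) g = 1"
  shows "mat_of g = 1\<^sub>m n"
proof -
  let ?M = "map_mat to_ac (mat_of g)"
  have Mc: "?M \<in> carrier_mat n n"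
    by simp
  have Pc: "P \<in> carrier_mat n n" and "invertible_mat P"
    using P by (simp_all add: char_decomposition_def)
  then obtain P' where P': "P' \<in> carrier_mat n n" "P * P' = 1\<^sub>m n"
    using invertible_matE by blast
  have "?M * P = P"
  proof (rule eq_matI)
    fix i k assume "i < dim_row P" "k < dim_col P"
    then have ik: "i < n" "k < n"
      using Pc by auto
    have "?M *\<^sub>v col P k = (\<chi>s ! k) g \<cdot>\<^sub>v col P k"
      using P ik g by (simp add: char_decomposition_def mat_of_def)
    then have "(?M *\<^sub>v col P k) $ i = ((\<chi>s ! k) g \<cdot>\<^sub>v col P k) $ i"
      by simp
    then show "(?M * P) $$ (i, k) = P $$ (i, k)"
      using ik Pc triv by simp
  qed (use Pc in simp_all)
  then have "?M * (P * P') = P * P'"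
    using assoc_mult_mat[OF Mc Pc P'(1)] by simp
  then have "?M = 1\<^sub>m n"
    using Mc by (simp add: P'(2))
  show ?thesis
  proof (rule eq_matI)
    fix i j assume "i < dim_row (1\<^sub>m n :: 'k mat)" "j < dim_col (1\<^sub>m n :: 'k mat)"
    then have "to_ac (mat_of g $$ (i, j)) = ?M $$ (i, j)" "i < n" "j < n"
      by simp_all
    then have "to_ac (mat_of g $$ (i, j)) = to_ac (1\<^sub>m n $$ (i, j))"
      unfolding \<open>?M = 1\<^sub>m n\<close> by auto
    then show "mat_of g $$ (i, j) = 1\<^sub>m n $$ (i, j)"
      by simp
  qed simp_all
qed

lemma exists_nontrivial_character:
  assumes P: "char_decomposition G scale bs \<rho> P \<chi>s" and nontriv: "acts_nontrivially G \<rho>"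
  obtains i where "i < n" "\<chi>s ! i \<noteq> \<one>\<^bsub>char_group G\<^esub>"
proof -
  obtain g v where g: "g \<in> carrier G" "\<rho> g v \<noteq> v"
    using nontriv by (auto simp: acts_nontrivially_def)
  then have "mat_of g \<noteq> 1\<^sub>m n"
    using rho_eq_id_if_mat_of_one by blast
  then obtain i where i: "i < n" "(\<chi>s ! i) g \<noteq> 1"
    using mat_of_eq_one_if_characters_trivial[OF P g(1)] by blast
  then have "\<chi>s ! i \<noteq> \<one>\<^bsub>char_group G\<^esub>"
    by (auto simp: char_group_one[OF g(1)])
  with i(1) show thesis
    by (rule that)
qed

text \<open>Scale the eigencoordinates with the nontrivial character \<open>\<chi>s ! k0\<close> by \<open>t\<close> and fix the others. An
  eigencoordinate that occurs in an invariant of degree one has the trivial character and is fixed.\<close>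

lemma no_transcendence_basis_of_degree_1:
  assumes P: "char_decomposition G scale bs \<rho> P \<chi>s" and k0: "k0 < n" "\<chi>s ! k0 \<noteq> \<one>\<^bsub>char_group G\<^esub>"
    and B: "B \<subseteq> invariant_ratfuns_le G scale bs \<rho> 1"
      "transcendence_basis ratfun_const (invariant_ratfuns G scale bs \<rho>) B"
  shows False
proof (rule no_transcendence_basis_of_small_degree[OF P _ _ _ _ k0(1) _ B,
      where u = "\<lambda>t i. if i < n \<and> \<chi>s ! i = \<chi>s ! k0 then t else 1"])
  interpret C: comm_group "char_group G :: ('g \<Rightarrow> 'k alg_closure) monoid"
    by (rule comm_group_char_group[OF comm_group_axioms])
  fix t :: "'k alg_closure" and m :: "nat \<Rightarrow>\<^sub>0 nat"
  assume t: "t \<noteq> 0" and m: "Poly_Mapping.keys m \<subseteq> {..<n}"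
    "(\<Sum>i\<in>Poly_Mapping.keys m. Poly_Mapping.lookup m i) \<le> 1"
    "\<And>g. g \<in> carrier G \<Longrightarrow> monom_eval (\<lambda>i. (\<chi>s ! i) g) m = 1"
  have "weight (\<lambda>_. 1) m \<le> 1"
    using m(2) by (simp add: weight_def)
  then have "weight (\<lambda>_. 1) m \<le> 2"
    by simp
  then show "monom_eval (\<lambda>i. if i < n \<and> \<chi>s ! i = \<chi>s ! k0 then t else 1) m = 1"
  proof (cases rule: monomial_degree_le_2_cases)
    case (2 i)
    then have "i < n"
      using m(1) by simp
    then have "\<chi>s ! i = \<one>\<^bsub>char_group G\<^esub>"
      using m(3) 2 characters_of_decomposition[OF P]
      by (intro char_group_eqI[where G = G]) (simp_all add: char_group_one)
    then show ?thesis
      using 2 k0(2) by simp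
  next
    case (3 i j)
    then show ?thesis
      using \<open>weight (\<lambda>_. 1) m \<le> 1\<close> by (simp add: weight_add)
  qed simp
qed (use k0 in auto)

text \<open>Scale the eigencoordinates with the character \<open>\<chi>s ! k0\<close> by \<open>t\<close>, those with the inverse character by
  \<open>1 / t\<close>, and fix the others. The two characters are different, as the square of \<open>\<chi>s ! k0\<close> is
  nontrivial, and products of two eigencoordinates with inverse characters are fixed.\<close>

lemma no_transcendence_basis_of_degree_2:
  assumes P: "char_decomposition G scale bs \<rho> P \<chi>s" and k0: "k0 < n" "\<chi>s ! k0 \<noteq> \<one>\<^bsub>char_group G\<^esub>"
    "\<chi>s ! k0 \<otimes>\<^bsub>char_group G\<^esub> \<chi>s ! k0 \<noteq> \<one>\<^bsub>char_group G\<^esub>"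
    and B: "B \<subseteq> invariant_ratfuns_le G scale bs \<rho> 2"
      "transcendence_basis ratfun_const (invariant_ratfuns G scale bs \<rho>) B"
  shows False
proof -
  let ?C = "char_group G :: ('g \<Rightarrow> 'k alg_closure) monoid"
  interpret C: comm_group ?C
    by (rule comm_group_char_group[OF comm_group_axioms])
  \<comment> \<open>The guards \<open>i < n\<close> keep clear of unspecified list entries.\<close>
  define u where "u t i = (if i < n \<and> \<chi>s ! i = \<chi>s ! k0 then t
    else if i < n \<and> \<chi>s ! i \<otimes>\<^bsub>?C\<^esub> \<chi>s ! k0 = \<one>\<^bsub>?C\<^esub> then inverse t else 1)" for t :: "'k alg_closure" and i
  note \<chi> = characters_of_decomposition(1)[OF P]
  show False
  proof (rule no_transcendence_basis_of_small_degree[OF P _ _ _ _ k0(1) _ B, where u = u])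
    fix t :: "'k alg_closure" and m :: "nat \<Rightarrow>\<^sub>0 nat"
    assume t: "t \<noteq> 0" and m: "Poly_Mapping.keys m \<subseteq> {..<n}"
      "(\<Sum>i\<in>Poly_Mapping.keys m. Poly_Mapping.lookup m i) \<le> 2"
      "\<And>g. g \<in> carrier G \<Longrightarrow> monom_eval (\<lambda>i. (\<chi>s ! i) g) m = 1"
    have "weight (\<lambda>_. 1) m \<le> 2"
      using m(2) by (simp add: weight_def)
    then show "monom_eval (u t) m = 1"
    proof (cases rule: monomial_degree_le_2_cases)
      case (2 i)
      then have i: "i < n"
        using m(1) by simp
      have "\<chi>s ! i = \<one>\<^bsub>?C\<^esub>"
        using m(3) 2 \<chi>[OF i] by (intro char_group_eqI[where G = G]) (simp_all add: char_group_one)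
      then show ?thesis
        using 2 k0 \<chi>[OF k0(1)] by (simp add: u_def)
    next
      case (3 i j)
      have "i \<in> Poly_Mapping.keys m" "j \<in> Poly_Mapping.keys m"
        by (auto simp: 3 in_keys_iff lookup_add)
      then have ij: "i < n" "j < n"
        using m(1) by auto
      have prod: "\<chi>s ! i \<otimes>\<^bsub>?C\<^esub> \<chi>s ! j = \<one>\<^bsub>?C\<^esub>"
        using m(3) 3 \<chi>[OF ij(1)] \<chi>[OF ij(2)]
        by (intro char_group_eqI[where G = G]) (simp_all add: char_group_one char_group_mult monom_eval_add)
      have prod': "\<chi>s ! j \<otimes>\<^bsub>?C\<^esub> \<chi>s ! i = \<one>\<^bsub>?C\<^esub>"
        using prod C.m_comm[OF \<chi>[OF ij(1)] \<chi>[OF ij(2)]] by simp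
      have inverse_iff: "\<chi>s ! a \<otimes>\<^bsub>?C\<^esub> \<chi>s ! k0 = \<one>\<^bsub>?C\<^esub> \<longleftrightarrow> \<chi>s ! b = \<chi>s ! k0"
        if "a < n" "b < n" "\<chi>s ! a \<otimes>\<^bsub>?C\<^esub> \<chi>s ! b = \<one>\<^bsub>?C\<^esub>" for a b
        using C.l_cancel[of "\<chi>s ! a" "\<chi>s ! b" "\<chi>s ! k0"] \<chi>[OF that(1)] \<chi>[OF that(2)] \<chi>[OF k0(1)] that(3)
        by auto
      have u_i: "u t i = (if \<chi>s ! i = \<chi>s ! k0 then t else if \<chi>s ! j = \<chi>s ! k0 then inverse t else 1)"
        using inverse_iff[OF ij prod] ij by (simp add: u_def)
      have u_j: "u t j = (if \<chi>s ! j = \<chi>s ! k0 then t else if \<chi>s ! i = \<chi>s ! k0 then inverse t else 1)"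
        using inverse_iff[OF ij(2,1) prod'] ij by (simp add: u_def)
      have "\<not> (\<chi>s ! i = \<chi>s ! k0 \<and> \<chi>s ! j = \<chi>s ! k0)"
        using prod k0(3) by auto
      then have "u t i * u t j = 1"
        unfolding u_i u_j using t by auto
      then show ?thesis
        by (simp add: 3 monom_eval_add)
    qed simp
  next
    fix t :: "'k alg_closure" and i j
    assume ij: "i < n" "j < n" "\<And>g. g \<in> carrier G \<Longrightarrow> (\<chi>s ! i) g = (\<chi>s ! j) g"
    have "\<chi>s ! i = \<chi>s ! j"
      by (rule char_group_eqI[OF \<chi>[OF ij(1)] \<chi>[OF ij(2)] ij(3)])
    then show "u t i = u t j"
      using ij by (simp add: u_def)
  qed (use k0 in \<open>auto simp: u_def\<close>)
qed

text \<open>If all characters have trivial square, then every \<open>g \<otimes> g\<close> acts trivially. The characteristic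
  is not two, since in characteristic two a character with trivial square is trivial, while some
  character in the representation is not.\<close>

lemma transcendence_basis_of_degree_2:
  assumes char: "of_nat (card (carrier G)) \<noteq> (0 :: 'k)" and nontriv: "acts_nontrivially G \<rho>"
    and invol: "nontrivial_characters_in G scale bs \<rho> \<subseteq> involutions (char_group G)"
  shows "\<exists>B\<subseteq>invariant_ratfuns_le G scale bs \<rho> 2.
    transcendence_basis ratfun_const (invariant_ratfuns G scale bs \<rho>) B"
proof -
  interpret C: comm_group "char_group G :: ('g \<Rightarrow> 'k alg_closure) monoid"
    by (rule comm_group_char_group[OF comm_group_axioms])
  obtain P \<chi>s where P: "char_decomposition G scale bs \<rho> P \<chi>s"
    using exists_char_decomposition[OF char] by blast
  note \<chi> = characters_of_decomposition[OF P]
  have sq: "(\<chi>s ! i) g * (\<chi>s ! i) g = 1" if i: "i < n" and g: "g \<in> carrier G" for i g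
  proof -
    have eq: "\<chi>s ! i \<otimes>\<^bsub>char_group G\<^esub> \<chi>s ! i = \<one>\<^bsub>char_group G\<^esub>"
      using invol \<chi>[OF i] involutions_iff[OF C.is_group] C.l_one[OF C.one_closed]
      by (cases "\<chi>s ! i = \<one>\<^bsub>char_group G\<^esub>") (auto simp: nontrivial_characters_in_def)
    have "(\<chi>s ! i) g * (\<chi>s ! i) g = (\<chi>s ! i \<otimes>\<^bsub>char_group G\<^esub> \<chi>s ! i) g"
      by (simp add: char_group_mult g)
    also have "\<dots> = 1"
      by (simp add: eq char_group_one g)
    finally show ?thesis .
  qed
  have "mat_of g * mat_of g = 1\<^sub>m n" if g: "g \<in> carrier G" for g
  proof -
    have "mat_of (g \<otimes> g) = 1\<^sub>m n"
    proof (rule mat_of_eq_one_if_characters_trivial[OF P])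
      show "(\<chi>s ! i) (g \<otimes> g) = 1" if "i < n" for i
        using \<chi>(1)[OF that] sq[OF that g] g by (simp add: carrier_char_group_iff)
    qed (use g in simp)
    then show ?thesis
      using g by (simp add: mat_of_mult)
  qed
  moreover have "(2 :: 'k) \<noteq> 0"
  proof
    assume "(2 :: 'k) = 0"
    then have two: "(2 :: 'k alg_closure) = 0"
      by (metis to_ac_0 to_ac_numeral)
    obtain i where i: "i < n" "\<chi>s ! i \<noteq> \<one>\<^bsub>char_group G\<^esub>"
      using exists_nontrivial_character[OF P nontriv] by blast
    have "(\<chi>s ! i) g = 1" if g: "g \<in> carrier G" for g
    proof -
      have "((\<chi>s ! i) g - 1) * ((\<chi>s ! i) g - 1) = (\<chi>s ! i) g * (\<chi>s ! i) g + 1 - 2 * (\<chi>s ! i) g"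
        by (simp add: algebra_simps)
      also have "\<dots> = 0"
        using sq[OF i(1) g] two by simp
      finally show ?thesis
        by simp
    qed
    then have "\<chi>s ! i = \<one>\<^bsub>char_group G\<^esub>"
      using \<chi>(1)[OF i(1)] by (intro char_group_eqI[where G = G]) (simp_all add: char_group_one)
    with i(2) show False
      by simp
  qed
  ultimately show ?thesis
    by (intro quadratic_transcendence_basis)
qed

end

theorem proposition4p3:
  fixes G :: "('g, 'm) monoid_scheme"
    and scale :: "'k::field \<Rightarrow> 'v::ab_group_add \<Rightarrow> 'v"
    and bs :: "'v list"
    and \<rho> :: "'g \<Rightarrow> 'v \<Rightarrow> 'v"
  assumes "comm_group G" and "finite (carrier G)"
    and "\<not> CHAR('k) dvd card (carrier G)"
    and "ordered_basis scale bs"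
    and "is_representation G scale \<rho>"
    and "acts_nontrivially G \<rho>"
  shows "(gamma_rfield G scale bs \<rho> = 2 \<longleftrightarrow>
            nontrivial_characters_in G scale bs \<rho> \<subseteq> involutions (char_group G)) \<and>
         (\<not> nontrivial_characters_in G scale bs \<rho> \<subseteq> involutions (char_group G) \<longrightarrow>
            gamma_rfield G scale bs \<rho> \<ge> 3) \<and>
         (card (nontrivial_characters_in G scale bs \<rho>) > card (involutions G) \<longrightarrow>
            gamma_rfield G scale bs \<rho> \<ge> 3)"
proof -
  interpret abelian_rep G scale bs \<rho>
    by (rule abelian_rep.intro[OF assms(1)], unfold_locales) (rule assms)+
  interpret C: comm_group "char_group G :: ('g \<Rightarrow> 'k alg_closure) monoid"
    by (rule comm_group_char_group[OF assms(1)])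
  let ?\<gamma> = "gamma_rfield G scale bs \<rho>" and ?N = "nontrivial_characters_in G scale bs \<rho>"
    and ?I = "involutions (char_group G :: ('g \<Rightarrow> 'k alg_closure) monoid)"
  define T where "T d \<longleftrightarrow> (\<exists>B\<subseteq>invariant_ratfuns_le G scale bs \<rho> d.
    transcendence_basis ratfun_const (invariant_ratfuns G scale bs \<rho>) B)" for d
  have char: "of_nat (card (carrier G)) \<noteq> (0 :: 'k)"
    using assms(3) by (simp add: of_nat_eq_0_iff_char_dvd)
  have \<gamma>_def: "?\<gamma> = (LEAST d. 0 < d \<and> T d)"
    by (simp add: gamma_rfield_def T_def)
  have \<gamma>: "0 < ?\<gamma> \<and> T ?\<gamma>"
    unfolding \<gamma>_def
    by (rule LeastI_ex) (use exists_transcendence_basis_of_bounded_degree in \<open>simp add: T_def\<close>)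
  have "\<not> T 1"
  proof
    obtain P \<chi>s where P: "char_decomposition G scale bs \<rho> P \<chi>s"
      using exists_char_decomposition[OF char] by blast
    obtain i where i: "i < n" "\<chi>s ! i \<noteq> \<one>\<^bsub>char_group G\<^esub>"
      using exists_nontrivial_character[OF P assms(6)] by blast
    assume "T 1"
    then show False
      using no_transcendence_basis_of_degree_1[OF P i] unfolding T_def by blast
  qed
  then have ge2: "?\<gamma> \<ge> 2"
    using \<gamma> by (metis One_nat_def Suc_1 Suc_leI le_neq_implies_less)
  have ge3: "?\<gamma> \<ge> 3" if not: "\<not> ?N \<subseteq> ?I"
  proof -
    obtain \<chi>0 where \<chi>0: "\<chi>0 \<in> characters_in G scale bs \<rho>" "\<chi>0 \<noteq> \<one>\<^bsub>char_group G\<^esub>" "\<chi>0 \<notin> ?I"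
      using not by (auto simp: nontrivial_characters_in_def)
    then obtain P \<chi>s where P: "char_decomposition G scale bs \<rho> P \<chi>s" "\<chi>0 \<in> set \<chi>s"
      by (auto simp: characters_in_def)
    then obtain k0 where k0: "k0 < n" "\<chi>s ! k0 = \<chi>0"
      by (auto simp: in_set_conv_nth char_decomposition_def)
    have sq: "\<chi>s ! k0 \<otimes>\<^bsub>char_group G\<^esub> \<chi>s ! k0 \<noteq> \<one>\<^bsub>char_group G\<^esub>"
      using \<chi>0 k0 characters_of_decomposition(1)[OF P(1) k0(1)] involutions_iff[OF C.is_group]
      by auto
    have "\<not> T 2"
      using no_transcendence_basis_of_degree_2[OF P(1) k0(1) _ sq] \<chi>0(2) k0(2) unfolding T_def by blast
    then have "?\<gamma> \<noteq> 2"
      using \<gamma> by metis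
    then show ?thesis
      using ge2 by simp
  qed
  have eq2: "?\<gamma> = 2" if "?N \<subseteq> ?I"
  proof -
    have "T 2"
      using transcendence_basis_of_degree_2[OF char assms(6) that] by (simp add: T_def)
    then have "?\<gamma> \<le> 2"
      unfolding \<gamma>_def by (intro Least_le) simp
    then show ?thesis
      using ge2 by simp
  qed
  have not_sub: "\<not> ?N \<subseteq> ?I" if "card ?N > card (involutions G)"
  proof
    assume "?N \<subseteq> ?I"
    then have "card ?N \<le> card ?I"
      by (rule card_mono[OF card_char_involutions_le(1)[OF assms(1,2)]])
    with card_char_involutions_le(2)[OF assms(1,2)] that show False
      by (meson le_trans not_le)
  qed
  show ?thesis
  proof (intro conjI iffI impI)
    show "?N \<subseteq> ?I" if "?\<gamma> = 2"
    proof (rule ccontr)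
      assume "\<not> ?N \<subseteq> ?I"
      from ge3[OF this] that show False
        by simp
    qed
    show "?\<gamma> = 2" if "?N \<subseteq> ?I"
      by (rule eq2[OF that])
    show "?\<gamma> \<ge> 3" if "\<not> ?N \<subseteq> ?I"
      by (rule ge3[OF that])
    show "?\<gamma> \<ge> 3" if "card (involutions G) < card ?N"
      by (rule ge3[OF not_sub[OF that]])
  qed
qed

end
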